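(* Let $R$ be a Reuleaux polygon with $n=2k+1\ge 5$ vertices $x_0,\dots,x_{n-1}$ (labelled counter-clockwise), and let $\theta_i$ be the length of the arc of $\partial R$ opposite to $x_i$. Let $v\in\mathbb{R}^2$ be a unit vector, and let $\mathbf b$ be the unit vector aligned with the bisector of the angle $\angle x_kx_0x_{k+1}$ (pointing from $x_0$ into this angle). For $t$ near $0$ let $R(t)$ be the perturbed Reuleaux $n$-gon obtained by moving $x_0$ to $x_0+tv$, as defined in the context, and let $|R(t)|$ denote its area. (a) The directional derivative of the area when $x_0$ is perturbed in the direction $v$ is $$\left.\frac{d}{dt}|R(t)|\right|_{t=0} = 2\sin\frac{\theta_0}{2}\,(v\cdot \mathbf b)+\tan\frac{\theta_k}{2}\; v\cdot(x_0-x_k)+\tan\frac{\theta_{k+1}}{2}\; v\cdot(x_0-x_{k+1}).$$ If this derivative vanishes for all directions $v$, then $\theta_0=\theta_k=\theta_{k+1}$. In particular, in that case $\theta_0,\theta_k,\theta_{k+1}\in[0,\pi/5]\cup\{\pi/3\}$. (b) If $\theta_0=\theta_k=\theta_{k+1}\le \pi/5$, then $R$ is not a local minimizer for the area with respect to perturbations of $x_0$.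
   Context: All constant width shapes have unit width. $B(c)$ denotes the closed disk of radius $1$ centered at $c\in\mathbb{R}^2$. A Reuleaux polygon is a planar constant width shape that is the intersection of finitely many unit disks with pairwise distinct centers; the minimal number $n\ge3$ of disks involved is its number of sides and vertices. This number is odd, $n=2k+1$, and the centers of the $n$ disks are exactly the vertices (angular points of the boundary). Label the vertices $x_0,\dots,x_{n-1}$ counter-clockwise, indices modulo $n$. The arc opposite to $x_i$ is $\partial R\cap\partial B(x_i)$; it is the arc of the unit circle centered at $x_i$ with endpoints $x_{i+k},x_{i+k+1}$, and $\theta_i$ denotes its length. When $n\ge5$ one has $0<\theta_i<\pi/3$ for all $i$. Perturbation of the vertex $x_0$ (for $n\geq 5$): for $t$ near $0$, let $x_k(t)$ be the intersection point of $\partial B(x_0+tv)$ and $\partial B(x_{n-1})$ depending continuously on $t$ with $x_k(0)=x_k$, and let $x_{k+1}(t)$ be the intersection point of $\partial B(x_0+tv)$ and $\partial B(x_1)$ depending continuously on $t$ with $x_{k+1}(0)=x_{k+1}$. All other vertices are kept fixed. Then $$R(t)=B(x_0+tv)\cap B(x_1)\cap\dots\cap B(x_k(t))\cap B(x_{k+1}(t))\cap\dots\cap B(x_{n-1})$$ is a Reuleaux $n$-gon for $t$ small. "$R$ is a local minimizer for the area with respect to perturbations of $x_0$" means: there is $\varepsilon>0$ such that, for every unit vector $v$ and every $0\le t<\varepsilon$, the Reuleaux polygon $R(t)=B(x_0+tv)\cap B(x_1)\cap\dots\cap B(x_k(t))\cap B(x_{k+1}(t))\cap\dots\cap B(x_{n-1})$,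 where $x_k(t)\in\partial B(x_0+tv)\cap\partial B(x_{n-1})$ and $x_{k+1}(t)\in\partial B(x_0+tv)\cap\partial B(x_1)$ are the intersection points depending continuously on $t$ with $x_k(0)=x_k$ and $x_{k+1}(0)=x_{k+1}$, satisfies $|R(t)|\ge |R|$. *)

theory Defs
  imports "HOL-Analysis.Analysis"
begin

text \<open>The Euclidean plane is the type \<^typ>\<open>complex\<close>, with its usual real inner product.\<close>

definition width :: "complex set \<Rightarrow> complex \<Rightarrow> real" where
  "width K u = (SUP y\<in>K. y \<bullet> u) - (INF y\<in>K. y \<bullet> u)"

definition constant_width_shape :: "complex set \<Rightarrow> bool" where
  "constant_width_shape K \<longleftrightarrow>
     compact K \<and> convex K \<and> K \<noteq> {} \<and> (\<forall>u. norm u = 1 \<longrightarrow> width K u = 1)"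

definition reuleaux_polygon :: "complex set \<Rightarrow> bool" where
  "reuleaux_polygon R \<longleftrightarrow>
     constant_width_shape R \<and> (\<exists>C. finite C \<and> R = (\<Inter>c\<in>C. cball c 1))"

definition num_sides :: "complex set \<Rightarrow> nat" where
  "num_sides R = (LEAST n. \<exists>C. finite C \<and> card C = n \<and> R = (\<Inter>c\<in>C. cball c 1))"

definition outer_unit_normal :: "complex set \<Rightarrow> complex \<Rightarrow> complex \<Rightarrow> bool" where
  "outer_unit_normal K p u \<longleftrightarrow> norm u = 1 \<and> (\<forall>y\<in>K. (y - p) \<bullet> u \<le> 0)"

text \<open>The vertices are the angular points of the boundary, that is, the boundary points with
  more than one outer unit normal.\<close>

definition vertices :: "complex set \<Rightarrow> complex set" where
  "vertices K = {p \<in> frontier K. \<exists>u w. u \<noteq> w \<and> outer_unit_normal K p u \<and> outer_unit_normal K p w}"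

text \<open>Twice the signed area of the triangle \<open>p q r\<close>; positive iff the triangle is
  counter-clockwise.\<close>

definition orientation :: "complex \<Rightarrow> complex \<Rightarrow> complex \<Rightarrow> real" where
  "orientation p q r = Im (cnj (q - p) * (r - p))"

text \<open>The vertices of a Reuleaux polygon are in strictly convex position, so that they are listed
  in counter-clockwise order along the boundary iff all triples with increasing indices are
  counter-clockwise.\<close>

definition ccw_labelling :: "complex set \<Rightarrow> nat \<Rightarrow> (nat \<Rightarrow> complex) \<Rightarrow> bool" where
  "ccw_labelling R n x \<longleftrightarrow>
     bij_betw x {..<n} (vertices R) \<and>
     (\<forall>i j l. i < j \<and> j < l \<and> l < n \<longrightarrow> 0 < orientation (x i) (x j) (x l))"

text \<open>The length of a part \<open>A\<close> of the unit circle centred at \<open>c\<close> is the measure of the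
  corresponding set of angles.\<close>

definition unit_circle_length :: "complex \<Rightarrow> complex set \<Rightarrow> real" where
  "unit_circle_length c A = measure lebesgue {\<phi> \<in> {0..<2 * pi}. c + cis \<phi> \<in> A}"

definition opposite_arc_length :: "complex set \<Rightarrow> complex \<Rightarrow> real" where
  "opposite_arc_length R c = unit_circle_length c (frontier R \<inter> frontier (cball c 1))"

text \<open>The unit vector along the bisector of the angle \<open>q p r\<close>, pointing from \<open>p\<close> into this angle.\<close>

definition bisector :: "complex \<Rightarrow> complex \<Rightarrow> complex \<Rightarrow> complex" where
  "bisector q p r = sgn (sgn (q - p) + sgn (r - p))"

text \<open>The position at time \<open>t\<close> (of either sign) of the point of \<open>\<partial>B(c + s v) \<inter> \<partial>B(d)\<close> that depends
  continuously on \<open>s\<close> and is \<open>p\<close> for \<open>s = 0\<close>. It is well defined for all \<open>t\<close> close to 0 if the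
  unit circles centred at \<open>c\<close> and \<open>d\<close> cross at \<open>p\<close>.\<close>

definition moving_intersection ::
    "complex \<Rightarrow> complex \<Rightarrow> complex \<Rightarrow> complex \<Rightarrow> real \<Rightarrow> complex" where
  "moving_intersection c v d p t =
     (THE z. \<exists>\<gamma>. continuous_on (closed_segment 0 t) \<gamma> \<and> \<gamma> 0 = p \<and> \<gamma> t = z \<and>
        (\<forall>s\<in>closed_segment 0 t.
           \<gamma> s \<in> frontier (cball (c + s *\<^sub>R v) 1) \<inter> frontier (cball d 1)))"

definition perturbed_vertex ::
    "nat \<Rightarrow> nat \<Rightarrow> (nat \<Rightarrow> complex) \<Rightarrow> complex \<Rightarrow> real \<Rightarrow> nat \<Rightarrow> complex" where
  "perturbed_vertex n k x v t i =
     (if i = 0 then x 0 + t *\<^sub>R v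
      else if i = k then moving_intersection (x 0) v (x (n - 1)) (x k) t
      else if i = k + 1 then moving_intersection (x 0) v (x 1) (x (k + 1)) t
      else x i)"

definition perturbed_polygon ::
    "nat \<Rightarrow> nat \<Rightarrow> (nat \<Rightarrow> complex) \<Rightarrow> complex \<Rightarrow> real \<Rightarrow> complex set" where
  "perturbed_polygon n k x v t = (\<Inter>i<n. cball (perturbed_vertex n k x v t i) 1)"

abbreviation area :: "complex set \<Rightarrow> real" where
  "area \<equiv> measure lebesgue"

definition local_area_minimizer ::
    "nat \<Rightarrow> nat \<Rightarrow> complex set \<Rightarrow> (nat \<Rightarrow> complex) \<Rightarrow> bool" where
  "local_area_minimizer n k R x \<longleftrightarrow>
     (\<exists>\<epsilon>>0. \<forall>v t. norm v = 1 \<and> 0 \<le> t \<and> t < \<epsilon> \<longrightarrow> area R \<le> area (perturbed_polygon n k x v t))"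

end

theory Submission
  imports Defs
begin

text \<open>
  The area of an intersection of unit discs is differentiable in the centres: moving the centre \<open>c i\<close> with
  velocity \<open>c' i\<close> changes the area at the rate \<open>c' i \<bullet> N i\<close>, where \<open>N i\<close> is the integral of the outer normal
  over the boundary arc on the \<open>i\<close>-th circle, that is, the chord of this arc turned by a right angle. The
  velocities of \<open>x k\<close> and \<open>x (k + 1)\<close> follow from the unit distances that they have to keep, and this gives
  the formula for the derivative. At a critical point with common angle \<open>\<theta>\<close>, the distance of \<open>x 1\<close> and
  \<open>x (n - 1)\<close> is at most 1, a cubic inequality in \<open>cos \<theta>\<close>.

  For the second part, \<open>x 0\<close> moves along the unit circle around \<open>x k\<close>, so that \<open>x k\<close> stays fixed. The formula
  for the derivative, applied at each time, shows that the area changes at the rate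
  \<open>sin \<theta>\<^sub>0 (tan (\<theta>\<^sub>0 / 2) - tan (\<theta>' / 2))\<close> with \<open>\<theta>'\<close> the angle at \<open>x (k + 1)\<close>, and comparing the chords of the
  two arcs shows that \<open>\<theta>'\<close> becomes larger than \<open>\<theta>\<^sub>0\<close> because \<open>1 < 2 cos \<theta>\<close>.

  That the vertices \<open>x i\<close> and \<open>x j\<close> have distance 1 iff \<open>j - i\<close> is \<open>k\<close> or \<open>k + 1\<close> is a counting argument: every
  vertex has exactly two vertices at distance 1, and any two unit segments between vertices meet.
\<close>

subsection \<open>The area of an intersection of unit discs\<close>


text \<open>Two obstacles shape the proof. The boundary of an intersection of discs is awkward to
  parametrise while its centres move. Areas are therefore sliced by Fubini's theorem, which treats
  \<open>K \<inter> cball c 1\<close> for any Borel set \<open>K\<close>; the shape of the boundary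
  enters only when the flux is evaluated on an arc. At a critical point the first derivative says
  nothing about part (b), and a second derivative would mean differentiating the angles. Instead the
  first-order formula is used at every time of a curved motion. This is why it is proved for any
  \<open>star_configuration\<close>, a condition that persists along the motion, although the
  displaced discs are not known beforehand to bound a Reuleaux polygon. A curved motion is
  admissible because local minimality compares \<open>R\<close> with the result of every small
  displacement \<open>t *\<^sub>R v\<close> of \<open>x 0\<close>: only the end point of the motion
  matters.\<close>

lemma measurable_Complex_pair [measurable]:
  "(\<lambda>(x, y). Complex x y) \<in> borel_measurable (lborel \<Otimes>\<^sub>M lborel)"
proof -
  have "(\<lambda>(x, y). Complex x y) \<in> borel_measurable borel"
    by (intro borel_measurable_continuous_onI)
       (auto simp: split_beta' intro!: continuous_intros continuous_on_Complex)
  then show ?thesis by (simp add: lborel_prod)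
qed

text \<open>A measure on the plane is determined by its values on boxes. In product form the measure
  becomes accessible to Fubini's theorem on horizontal slices.\<close>

lemma lborel_complex_eq_distr:
  "(lborel :: complex measure) = distr (lborel \<Otimes>\<^sub>M lborel) borel (\<lambda>(x, y). Complex x y)"
proof (rule lborel_eqI)
  fix l u :: complex
  assume le: "\<And>b. b \<in> Basis \<Longrightarrow> l \<bullet> b \<le> u \<bullet> b"
  have le': "Re l \<le> Re u" "Im l \<le> Im u"
    using le[of 1] le[of \<i>] by (auto simp: Basis_complex_def inner_complex_def)
  have "(\<lambda>(x, y). Complex x y) -` box l u = {Re l<..<Re u} \<times> {Im l<..<Im u}"
    by (auto simp: box_def Basis_complex_def inner_complex_def)
  then have "emeasure (distr (lborel \<Otimes>\<^sub>M lborel) borel (\<lambda>(x, y). Complex x y)) (box l u)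
    = emeasure (lborel \<Otimes>\<^sub>M lborel) ({Re l<..<Re u} \<times> {Im l<..<Im u})"
    by (subst emeasure_distr) (auto simp: space_pair_measure)
  also have "\<dots> = ennreal (Re u - Re l) * ennreal (Im u - Im l)"
    using le' by (subst lborel.emeasure_pair_measure_Times) auto
  also have "\<dots> = (\<Prod>b\<in>Basis. (u - l) \<bullet> b)"
    using le' by (simp add: Basis_complex_def inner_complex_def ennreal_mult)
  finally show "emeasure (distr (lborel \<Otimes>\<^sub>M lborel) borel (\<lambda>(x, y). Complex x y)) (box l u)
    = (\<Prod>b\<in>Basis. (u - l) \<bullet> b)" .
qed simp

lemma measurable_Complex [measurable (raw)]:
  assumes [measurable]: "f \<in> borel_measurable M" "g \<in> borel_measurable M"
  shows "(\<lambda>x. Complex (f x) (g x)) \<in> borel_measurable M"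
proof -
  have "(\<lambda>x. (\<lambda>(x, y). Complex x y) (f x, g x)) \<in> borel_measurable M"
    by measurable
  then show ?thesis by simp
qed

lemma integrable_bounded_compact_support:
  fixes f :: "'a::euclidean_space \<Rightarrow> 'b::{banach,second_countable_topology}"
  assumes "f \<in> borel_measurable borel" "\<And>x. norm (f x) \<le> B" "\<And>x. x \<notin> cbox a b \<Longrightarrow> f x = 0"
  shows "integrable lborel f"
proof (rule integrableI_bounded_set[where A = "cbox a b" and B = B])
  show "emeasure lborel (cbox a b) < \<infinity>"
    by (simp add: emeasure_lborel_cbox_eq)
qed (use assms in auto)

lemma interval_integrable_bounded:
  fixes f :: "real \<Rightarrow> 'b::{banach,second_countable_topology}"
  assumes "f \<in> borel_measurable borel" "\<And>x. norm (f x) \<le> B"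
  shows "interval_lebesgue_integrable lborel (ereal a) (ereal b) f"
proof -
  have B: "0 \<le> B" using assms(2)[of 0] norm_ge_zero order_trans by blast
  have "set_integrable lborel (einterval (ereal u) (ereal v)) f" for u v
    unfolding set_integrable_def
    by (rule integrable_bounded_compact_support[where a = u and b = v and B = B])
       (use assms B in \<open>auto simp: einterval_def indicator_def\<close>)
  then show ?thesis by (simp add: interval_lebesgue_integrable_def)
qed

lemma interval_integral_shift:
  fixes f :: "real \<Rightarrow> 'b::{banach,second_countable_topology}"
  shows "(LBINT x=ereal a..ereal b. f (x + c)) = (LBINT x=ereal (a + c)..ereal (b + c). f x)"
proof -
  have "(LBINT x:einterval (ereal u) (ereal v). f (x + c)) =
        (LBINT x:einterval (ereal (u + c)) (ereal (v + c)). f x)" for u v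
    unfolding set_lebesgue_integral_def
    by (subst (2) lborel_integral_real_affine[where t = c and c = 1])
       (auto simp: einterval_def indicator_def add.commute intro!: Bochner_Integration.integral_cong)
  then show ?thesis
    by (simp add: interval_lebesgue_integral_def)
qed

lemma interval_integral_sum_bounded:
  fixes f :: "real \<Rightarrow> 'b::{banach,second_countable_topology}"
  assumes "f \<in> borel_measurable borel" "\<And>x. norm (f x) \<le> B"
  shows "(LBINT x=ereal a..ereal b. f x) + (LBINT x=ereal b..ereal c. f x)
       = (LBINT x=ereal a..ereal c. f x)"
  using interval_integral_sum[of "ereal a" "ereal b" "ereal c" f]
    interval_integrable_bounded[OF assms, of "min a (min b c)" "max a (max b c)"]
  by (simp add: ereal_min[symmetric] ereal_max[symmetric] del: ereal_min ereal_max)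

lemma diff_eq_diff_if_add_eq_add:
  fixes p x y z :: "'a::ab_group_add"
  assumes "p + y = x + z"
  shows "z - p = y - x"
  using assms by (simp add: diff_eq_eq eq_diff_eq algebra_simps)

text \<open>Only the two end strips swept by the moving window contribute. Applied to the slices of
  a shifted disc, this turns a difference of areas into an integral over the shift.\<close>

lemma interval_integral_window_diff:
  fixes f :: "real \<Rightarrow> 'b::{banach,second_countable_topology}"
  assumes f [measurable]: "f \<in> borel_measurable borel" and B: "\<And>x. norm (f x) \<le> B"
  shows "(LBINT x=ereal (p + h)..ereal (q + h). f x) - (LBINT x=ereal p..ereal q. f x)
       = (LBINT s=ereal 0..ereal h. f (q + s) - f (p + s))"
proof -
  note sum = interval_integral_sum_bounded[OF f B]
  have sh: "(LBINT s=ereal 0..ereal h. f (r + s)) = (LBINT x=ereal r..ereal (r + h). f x)" for r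
    using interval_integral_shift[of 0 h f r] by (simp add: add.commute)
  have "(LBINT s=ereal 0..ereal h. f (q + s) - f (p + s))
     = (LBINT x=ereal q..ereal (q + h). f x) - (LBINT x=ereal p..ereal (p + h). f x)"
    unfolding sh[symmetric]
    by (rule interval_lebesgue_integral_diff; rule interval_integrable_bounded[where B = B])
       (use B in auto)
  moreover have "(LBINT x=ereal p..ereal q. f x) + (LBINT x=ereal q..ereal (q + h). f x)
     = (LBINT x=ereal p..ereal (p + h). f x) + (LBINT x=ereal (p + h)..ereal (q + h). f x)"
    using sum by (simp add: sum)
  then have "(LBINT x=ereal (p + h)..ereal (q + h). f x) - (LBINT x=ereal p..ereal q. f x)
     = (LBINT x=ereal q..ereal (q + h). f x) - (LBINT x=ereal p..ereal (p + h). f x)"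
    by (rule diff_eq_diff_if_add_eq_add)
  ultimately show ?thesis by simp
qed

lemma interval_integral_periodic:
  fixes f :: "real \<Rightarrow> 'b::{banach,second_countable_topology}"
  assumes f [measurable]: "f \<in> borel_measurable borel" and B: "\<And>x. norm (f x) \<le> B"
    and per: "\<And>x. f (x + T) = f x"
  shows "(LBINT x=ereal a..ereal (a + T). f x) = (LBINT x=ereal 0..ereal T. f x)"
proof -
  have "(LBINT x=ereal (0 + a)..ereal (T + a). f x) - (LBINT x=ereal 0..ereal T. f x)
       = (LBINT s=ereal 0..ereal a. f (T + s) - f (0 + s))"
    by (rule interval_integral_window_diff[OF f B])
  also have "\<dots> = 0" using per by (simp add: add.commute)
  finally show ?thesis by (simp add: add.commute)
qed


text \<open>The integral of the outer normal over the part of the unit circle around \<open>c\<close> in \<open>K\<close>; this is the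
  gradient of the area of \<open>K \<inter> cball c 1\<close> with respect to \<open>c\<close>.\<close>

definition circle_flux :: "complex set \<Rightarrow> complex \<Rightarrow> complex" where
  "circle_flux K c = (LBINT \<phi>=ereal 0..ereal (2 * pi). indicat_real K (c + cis \<phi>) *\<^sub>R cis \<phi>)"

section \<open>The flux of the outer normal and the area swept by one moving disc\<close>

lemma measurable_cis [measurable (raw)]:
  assumes [measurable]: "f \<in> borel_measurable M"
  shows "(\<lambda>x. cis (f x)) \<in> borel_measurable M"
proof -
  have [measurable]: "cis \<in> borel_measurable borel"
    by (intro borel_measurable_continuous_onI continuous_intros)
  show ?thesis by measurable
qed

lemma circle_flux_integrable:
  assumes [measurable]: "K \<in> sets borel"
  shows "interval_lebesgue_integrable lborel (ereal a) (ereal b)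
           (\<lambda>\<phi>. indicat_real K (c + cis \<phi>) *\<^sub>R cis \<phi>)"
  by (rule interval_integrable_bounded[where B = 1]) (auto simp: indicator_def)

lemma circle_flux_window:
  assumes [measurable]: "K \<in> sets borel"
  shows "circle_flux K c
       = (LBINT \<phi>=ereal a..ereal (a + 2 * pi). indicat_real K (c + cis \<phi>) *\<^sub>R cis \<phi>)"
  unfolding circle_flux_def
  by (rule interval_integral_periodic[where B = 1, symmetric])
     (auto simp: indicator_def cis_mult[symmetric])

lemma Re_interval_integral:
  fixes f :: "real \<Rightarrow> complex"
  assumes "interval_lebesgue_integrable lborel a b f"
  shows "Re (LBINT x=a..b. f x) = (LBINT x=a..b. Re (f x))"
  using assms
  by (auto simp: interval_lebesgue_integral_def interval_lebesgue_integrable_def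
      set_lebesgue_integral_def set_integrable_def integral_Re[symmetric] simp del: integral_Re
      split: if_splits)

lemma circle_flux_Re:
  assumes [measurable]: "K \<in> sets borel"
  shows "Re (circle_flux K c)
       = (LBINT \<phi>=ereal 0..ereal (2 * pi). indicat_real K (c + cis \<phi>) * cos \<phi>)"
  unfolding circle_flux_def by (subst Re_interval_integral) (auto intro!: circle_flux_integrable)

text \<open>Heights in a disc are parametrised by angles. Since cos is nonnegative on this half
  period, the substitution covers integrands with jumps, as needed for indicators.\<close>

lemma interval_integral_sin_subst:
  fixes k :: "real \<Rightarrow> real"
  assumes [measurable]: "k \<in> borel_measurable borel" and "\<And>y. norm (k y) \<le> B"
  shows "(LBINT y=ereal (b - 1)..ereal (b + 1). k y)
       = (LBINT \<phi>=ereal (-pi/2)..ereal (pi/2). k (b + sin \<phi>) * cos \<phi>)"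
proof -
  have "set_integrable lborel {b - 1..b + 1} k"
    unfolding set_integrable_def
    by (rule integrable_bounded_compact_support[where a = "b - 1" and b = "b + 1" and B = "\<bar>B\<bar>"])
       (use order_trans[OF assms(2) abs_ge_self] in \<open>auto simp: indicator_def\<close>)
  moreover have "((\<lambda>\<phi>. b + sin \<phi>) has_real_derivative cos x) (at x)" for x
    by (auto intro!: derivative_eq_intros)
  moreover have "0 \<le> cos x" if "x \<in> {-pi/2..pi/2}" for x
    using that by (intro cos_ge_zero) auto
  moreover have "continuous_on {-pi/2..pi/2} cos" by (intro continuous_intros)
  ultimately show ?thesis
    using interval_integral_substitution(2)[of "\<lambda>\<phi>. b + sin \<phi>" "-pi/2" "pi/2" k cos]
    by simp
qed

text \<open>The right and left ends of the slices trace the two half circles. At height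
  \<open>Im c + sin \<phi>\<close> the left end has angle \<open>pi - \<phi>\<close>, where cos
  changes its sign, so the loss on the left and the gain on the right add up to one integral over
  the full circle.\<close>

lemma slices_eq_circle_flux:
  fixes K :: "complex set" and c :: complex
  assumes [measurable]: "K \<in> sets borel"
  defines "g \<equiv> \<lambda>x y. indicat_real K (Complex x y)"
    and "l \<equiv> \<lambda>y. sqrt (1 - (y - Im c)\<^sup>2)"
  shows "(LBINT y=ereal (Im c - 1)..ereal (Im c + 1). g (Re c + l y) y - g (Re c - l y) y)
       = Re (circle_flux K c)"
proof -
  define f where "f \<phi> = indicat_real K (c + cis \<phi>) * cos \<phi>" for \<phi>
  have f_meas [measurable]: "f \<in> borel_measurable borel" unfolding f_def by measurable
  have f_bd: "norm (f \<phi>) \<le> 1" for \<phi> by (auto simp: f_def indicator_def)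
  have g_meas [measurable]: "(\<lambda>y. g (Re c + l y) y - g (Re c - l y) y) \<in> borel_measurable borel"
    unfolding g_def l_def by measurable
  have g_bd: "norm (g (Re c + l y) y - g (Re c - l y) y) \<le> 1" for y
    by (auto simp: g_def indicator_def)
  have "(LBINT y=ereal (Im c - 1)..ereal (Im c + 1). g (Re c + l y) y - g (Re c - l y) y)
      = (LBINT \<phi>=ereal (-pi/2)..ereal (pi/2).
          (g (Re c + l (Im c + sin \<phi>)) (Im c + sin \<phi>)
           - g (Re c - l (Im c + sin \<phi>)) (Im c + sin \<phi>)) * cos \<phi>)"
    by (rule interval_integral_sin_subst[OF g_meas g_bd])
  also have "\<dots> = (LBINT \<phi>=ereal (-pi/2)..ereal (pi/2). f \<phi> + f (pi - \<phi>))"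
  proof (rule interval_integral_cong)
    fix \<phi> :: real
    assume "\<phi> \<in> einterval (min (ereal (-pi/2)) (ereal (pi/2))) (max (ereal (-pi/2)) (ereal (pi/2)))"
    then have "-pi/2 < \<phi>" "\<phi> < pi/2" by (auto simp: einterval_def min_def max_def)
    then have "0 \<le> cos \<phi>" by (intro cos_ge_zero) auto
    then have "l (Im c + sin \<phi>) = cos \<phi>" by (simp add: l_def cos_squared_eq[symmetric])
    moreover have "c + cis \<phi> = Complex (Re c + cos \<phi>) (Im c + sin \<phi>)"
      "c + cis (pi - \<phi>) = Complex (Re c - cos \<phi>) (Im c + sin \<phi>)"
      by (auto simp: complex_eq_iff)
    ultimately show "(g (Re c + l (Im c + sin \<phi>)) (Im c + sin \<phi>)
           - g (Re c - l (Im c + sin \<phi>)) (Im c + sin \<phi>)) * cos \<phi> = f \<phi> + f (pi - \<phi>)"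
      by (simp add: f_def g_def algebra_simps)
  qed
  also have "\<dots> = (LBINT \<phi>=ereal (-pi/2)..ereal (pi/2). f \<phi>)
                + (LBINT \<phi>=ereal (-pi/2)..ereal (pi/2). f (pi - \<phi>))"
    by (rule interval_lebesgue_integral_add; rule interval_integrable_bounded[where B = 1])
       (use f_bd in auto)
  also have "(LBINT \<phi>=ereal (-pi/2)..ereal (pi/2). f (pi - \<phi>))
           = (LBINT \<phi>=ereal (-pi/2)..ereal (pi/2). f (\<phi> + pi))"
    by (subst interval_integral_reflect) (simp add: add.commute)
  also have "\<dots> = (LBINT \<phi>=ereal (-pi/2 + pi)..ereal (pi/2 + pi). f \<phi>)"
    by (rule interval_integral_shift)
  \<comment> \<open>The two half circles fill the window from \<open>-pi/2\<close> to
    \<open>3 * pi/2\<close>, which is a full period.\<close>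
  also have "(LBINT \<phi>=ereal (-pi/2)..ereal (pi/2). f \<phi>) + \<dots>
           = (LBINT \<phi>=ereal (-pi/2)..ereal (-pi/2 + 2 * pi). f \<phi>)"
    using interval_integral_sum_bounded[OF f_meas f_bd, of "-pi/2" "pi/2" "-pi/2 + 2 * pi"]
    by (simp add: field_simps)
  also have "\<dots> = (LBINT \<phi>=ereal 0..ereal (2 * pi). f \<phi>)"
    by (rule interval_integral_periodic[OF f_meas f_bd])
       (simp add: f_def cis_mult[symmetric])
  also have "\<dots> = Re (circle_flux K c)"
    by (simp add: f_def circle_flux_Re)
  finally show ?thesis .
qed

lemma
  fixes A :: "complex set"
  assumes A [measurable]: "A \<in> sets borel" and fin: "emeasure lborel A < \<infinity>"
  shows integrable_slices: "integrable lborel (\<lambda>y. LBINT x. indicat_real A (Complex x y))"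
    and measure_eq_slices: "measure lborel A = (LBINT y. LBINT x. indicat_real A (Complex x y))"
proof -
  have "integrable (lborel :: complex measure) (indicat_real A)"
    using fin by (intro integrable_real_indicator) auto
  then have int: "integrable (lborel \<Otimes>\<^sub>M lborel) (\<lambda>(x, y). indicat_real A (Complex x y))"
    by (subst (asm) lborel_complex_eq_distr, subst (asm) integrable_distr_eq)
       (auto simp: split_beta')
  then show "integrable lborel (\<lambda>y. LBINT x. indicat_real A (Complex x y))"
    by (rule lborel_pair.integrable_snd)
  have "measure lborel A = (\<integral>z. indicat_real A z \<partial>lborel)" by simp
  also have "\<dots> = (\<integral>p. indicat_real A ((\<lambda>(x, y). Complex x y) p) \<partial>(lborel \<Otimes>\<^sub>M lborel))"
    by (subst lborel_complex_eq_distr, subst integral_distr) auto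
  also have "\<dots> = (\<integral>(x, y). indicat_real A (Complex x y) \<partial>(lborel \<Otimes>\<^sub>M lborel))"
    by (simp add: split_beta')
  also have "\<dots> = (LBINT y. LBINT x. indicat_real A (Complex x y))"
    by (rule lborel_pair.integral_snd[OF int, symmetric])
  finally show "measure lborel A = (LBINT y. LBINT x. indicat_real A (Complex x y))" .
qed

lemma disc_slice:
  fixes c :: complex
  defines "l \<equiv> \<lambda>y. sqrt (1 - (y - Im c)\<^sup>2)"
  shows "(LBINT x. indicat_real (K \<inter> cball c 1) (Complex x y))
   = indicat_real {Im c - 1..Im c + 1} y *
      (LBINT x=ereal (Re c - l y)..ereal (Re c + l y). indicat_real K (Complex x y))"
proof (cases "y \<in> {Im c - 1..Im c + 1}")
  case True
  then have "\<bar>y - Im c\<bar> \<le> 1" by auto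
  then have l: "0 \<le> 1 - (y - Im c)\<^sup>2" by (simp add: abs_square_le_1)
  have "Complex x y \<in> cball c 1 \<longleftrightarrow> x \<in> {Re c - l y..Re c + l y}" for x
  proof -
    have "Complex x y \<in> cball c 1 \<longleftrightarrow> (x - Re c)\<^sup>2 \<le> 1 - (y - Im c)\<^sup>2"
      by (simp add: dist_complex_def cmod_def power2_commute algebra_simps real_sqrt_le_1_iff)
    also have "\<dots> \<longleftrightarrow> \<bar>x - Re c\<bar> \<le> l y"
      unfolding l_def by (metis real_sqrt_le_iff real_sqrt_abs)
    finally show ?thesis by auto
  qed
  then have "(\<lambda>x. indicat_real (K \<inter> cball c 1) (Complex x y))
    = (\<lambda>x. indicat_real {Re c - l y..Re c + l y} x *\<^sub>R indicat_real K (Complex x y))"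
    by (auto simp: indicator_def fun_eq_iff)
  moreover have "Re c - l y \<le> Re c + l y" using l by (simp add: l_def)
  ultimately show ?thesis
    using True by (simp add: interval_integral_Icc set_lebesgue_integral_def)
next
  case False
  have "Complex x y \<notin> cball c 1" for x
  proof
    assume "Complex x y \<in> cball c 1"
    then have "\<bar>Im (c - Complex x y)\<bar> \<le> 1"
      by (metis abs_Im_le_cmod dist_complex_def mem_cball order_trans)
    with False show False by auto
  qed
  with False show ?thesis by (simp add: indicator_def)
qed

text \<open>Every horizontal slice of the disc is a window that moves by \<open>h\<close>. The
  change of a slice is an integral over the shift \<open>s\<close>; exchanging \<open>s\<close> with
  the height \<open>y\<close> leaves, for fixed \<open>s\<close>, the flux through the circle around
  the shifted centre.\<close>

lemma measure_disc_shift: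
  fixes K :: "complex set"
  assumes K [measurable]: "K \<in> sets borel" and h: "0 \<le> h"
  shows "measure lborel (K \<inter> cball (c + of_real h) 1) - measure lborel (K \<inter> cball c 1)
       = (LBINT s=ereal 0..ereal h. Re (circle_flux K (c + of_real s)))"
proof -
  define g where "g x y = indicat_real K (Complex x y)" for x y
  define l where "l y = sqrt (1 - (y - Im c)\<^sup>2)" for y
  define W where "W y s = g (Re c + l y + s) y - g (Re c - l y + s) y" for y s
  define H where "H y s = indicat_real {Im c - 1..Im c + 1} y * indicat_real {0..h} s * W y s"
    for y s
  have fin: "emeasure lborel (K \<inter> cball d 1) < \<infinity>" for d
    using le_less_trans[OF emeasure_mono[of "K \<inter> cball d 1" "cball d 1" lborel]]
      emeasure_bounded_finite[of "cball d 1"] by auto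
  have W_bd: "norm (W y s) \<le> 1" for y s by (auto simp: W_def g_def indicator_def)
  have W_meas [measurable]: "(\<lambda>(y, s). W y s) \<in> borel_measurable (borel \<Otimes>\<^sub>M borel)"
    unfolding W_def g_def l_def by measurable
  have slice: "(LBINT x. indicat_real (K \<inter> cball (c + of_real h) 1) (Complex x y))
      - (LBINT x. indicat_real (K \<inter> cball c 1) (Complex x y)) = (LBINT s. H y s)" for y
  proof -
    have "(LBINT x. indicat_real (K \<inter> cball (c + of_real h) 1) (Complex x y))
      - (LBINT x. indicat_real (K \<inter> cball c 1) (Complex x y))
      = indicat_real {Im c - 1..Im c + 1} y *
        ((LBINT x=ereal ((Re c - l y) + h)..ereal ((Re c + l y) + h). g x y)
        - (LBINT x=ereal (Re c - l y)..ereal (Re c + l y). g x y))"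
      unfolding disc_slice by (simp add: l_def g_def algebra_simps)
    also have "(LBINT x=ereal ((Re c - l y) + h)..ereal ((Re c + l y) + h). g x y)
        - (LBINT x=ereal (Re c - l y)..ereal (Re c + l y). g x y)
        = (LBINT s=ereal 0..ereal h. W y s)"
      unfolding W_def
      by (rule interval_integral_window_diff[where B = 1]) (auto simp: g_def indicator_def)
    also have "\<dots> = (LBINT s. indicat_real {0..h} s * W y s)"
      using h by (simp add: interval_integral_Icc set_lebesgue_integral_def)
    finally show ?thesis by (simp add: H_def mult.assoc)
  qed
  have H_int: "integrable (lborel \<Otimes>\<^sub>M lborel) (\<lambda>(y, s). H y s)"
    unfolding lborel_prod
  proof (rule integrable_bounded_compact_support[where a = "(Im c - 1, 0)" and b = "(Im c + 1, h)"
        and B = 1])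
    show "(\<lambda>(y, s). H y s) \<in> borel_measurable borel"
      unfolding H_def borel_prod[symmetric] by measurable
    show "norm (case p of (y, s) \<Rightarrow> H y s) \<le> 1" for p
      using W_bd by (auto simp: H_def indicator_def split: prod.splits)
    show "(case p of (y, s) \<Rightarrow> H y s) = 0" if "p \<notin> cbox (Im c - 1, 0) (Im c + 1, h)" for p
      using that by (auto simp: H_def cbox_Pair_eq indicator_def split: prod.splits)
  qed
  have "measure lborel (K \<inter> cball (c + of_real h) 1) - measure lborel (K \<inter> cball c 1)
      = (LBINT y. LBINT s. H y s)"
    unfolding slice[symmetric] using fin
    by (simp add: measure_eq_slices Bochner_Integration.integral_diff integrable_slices)
  also have "\<dots> = (LBINT s. LBINT y. H y s)"
    by (rule lborel_pair.Fubini_integral[OF H_int, symmetric])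
  also have "\<dots> = (LBINT s. indicat_real {0..h} s * Re (circle_flux K (c + of_real s)))"
  proof (rule Bochner_Integration.integral_cong[OF refl])
    fix s
    have "(LBINT y. H y s)
       = indicat_real {0..h} s * (LBINT y. indicat_real {Im c - 1..Im c + 1} y * W y s)"
      unfolding H_def
      by (subst integral_mult_right_zero[symmetric]) (simp add: mult_ac)
    also have "(LBINT y. indicat_real {Im c - 1..Im c + 1} y * W y s)
       = (LBINT y=ereal (Im c - 1)..ereal (Im c + 1). W y s)"
      by (simp add: interval_integral_Icc set_lebesgue_integral_def)
    also have "\<dots> = Re (circle_flux K (c + of_real s))"
      using slices_eq_circle_flux[OF K, of "c + of_real s"]
      by (simp add: W_def g_def l_def algebra_simps)
    finally show "(LBINT y. H y s) = indicat_real {0..h} s * Re (circle_flux K (c + of_real s))" .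
  qed
  also have "\<dots> = (LBINT s=ereal 0..ereal h. Re (circle_flux K (c + of_real s)))"
    using h by (simp add: interval_integral_Icc set_lebesgue_integral_def)
  finally show ?thesis .
qed


text \<open>The reflection in the diagonal. It preserves area and maps vertical shifts to horizontal
  ones, so the slicing argument is needed in one direction only.\<close>

definition transpose_complex :: "complex \<Rightarrow> complex" where
  "transpose_complex z = Complex (Im z) (Re z)"

lemma transpose_complex_simps [simp]:
  "transpose_complex (transpose_complex z) = z"
  "transpose_complex (z + w) = transpose_complex z + transpose_complex w"
  "transpose_complex (of_real r) = \<i> * of_real r"
  "dist (transpose_complex z) (transpose_complex w) = dist z w"
  by (auto simp: transpose_complex_def complex_eq_iff dist_complex_def cmod_def add.commute)

lemma transpose_complex_cis: "transpose_complex (cis \<phi>) = cis (pi / 2 - \<phi>)"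
  by (simp add: transpose_complex_def complex_eq_iff sin_diff cos_diff)

lemma measurable_transpose_complex [measurable]: "transpose_complex \<in> borel_measurable borel"
  unfolding transpose_complex_def[abs_def] by measurable

lemma distr_transpose_complex: "distr lborel borel transpose_complex = lborel"
proof (rule lborel_eqI[symmetric])
  fix l u :: complex
  assume le: "\<And>b. b \<in> Basis \<Longrightarrow> l \<bullet> b \<le> u \<bullet> b"
  have le': "Re l \<le> Re u" "Im l \<le> Im u"
    using le[of 1] le[of \<i>] by (auto simp: Basis_complex_def inner_complex_def)
  have "transpose_complex -` box l u = box (transpose_complex l) (transpose_complex u)"
    by (auto simp: box_def Basis_complex_def inner_complex_def transpose_complex_def)
  then have "emeasure (distr lborel borel transpose_complex) (box l u)
      = emeasure lborel (box (transpose_complex l) (transpose_complex u))"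
    by (subst emeasure_distr) auto
  also have "\<dots> = (\<Prod>b\<in>Basis. (u - l) \<bullet> b)"
    using le' by (subst emeasure_lborel_box)
      (auto simp: Basis_complex_def inner_complex_def transpose_complex_def mult.commute)
  finally show "emeasure (distr lborel borel transpose_complex) (box l u)
      = (\<Prod>b\<in>Basis. (u - l) \<bullet> b)" .
qed simp

lemma measure_transpose_complex:
  assumes [measurable]: "A \<in> sets borel"
  shows "measure lborel (transpose_complex -` A) = measure lborel A"
proof -
  have "measure lborel A = measure (distr lborel borel transpose_complex) A"
    by (simp add: distr_transpose_complex)
  then show ?thesis by (simp add: measure_distr)
qed

lemma circle_flux_Im:
  assumes [measurable]: "K \<in> sets borel"
  shows "Im (circle_flux K c)
       = (LBINT \<phi>=ereal 0..ereal (2 * pi). indicat_real K (c + cis \<phi>) * sin \<phi>)"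
proof -
  have "Im (circle_flux K c) = Re (- \<i> * circle_flux K c)" by simp
  also have "- \<i> * circle_flux K c
      = (LBINT \<phi>=ereal 0..ereal (2 * pi). - \<i> * (indicat_real K (c + cis \<phi>) *\<^sub>R cis \<phi>))"
    unfolding circle_flux_def by (rule interval_lebesgue_integral_mult_right[symmetric])
  also have "Re \<dots> = (LBINT \<phi>=ereal 0..ereal (2 * pi). indicat_real K (c + cis \<phi>) * sin \<phi>)"
    by (subst Re_interval_integral[OF interval_lebesgue_integrable_mult_right])
       (rule circle_flux_integrable, measurable)
  finally show ?thesis .
qed

lemma circle_flux_transpose:
  assumes [measurable]: "K \<in> sets borel"
  shows "Re (circle_flux (transpose_complex -` K) (transpose_complex c)) = Im (circle_flux K c)"
proof -
  define f where "f \<phi> = indicat_real K (c + cis \<phi>) * sin \<phi>" for \<phi>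
  have f_meas: "f \<in> borel_measurable borel" unfolding f_def by measurable
  have f_bd: "norm (f \<phi>) \<le> 1" for \<phi> by (auto simp: f_def indicator_def)
  have "transpose_complex -` K \<in> sets borel"
    using measurable_sets[OF measurable_transpose_complex assms] by simp
  then have "Re (circle_flux (transpose_complex -` K) (transpose_complex c))
      = (LBINT \<phi>=ereal 0..ereal (2 * pi). f (pi / 2 - \<phi>))"
    by (simp add: circle_flux_Re f_def indicator_def transpose_complex_cis sin_diff)
  also have "\<dots> = (LBINT \<phi>=ereal (- 2 * pi)..ereal 0. f (\<phi> + pi / 2))"
    by (subst interval_integral_reflect) (simp add: add.commute zero_ereal_def)
  also have "\<dots> = (LBINT \<phi>=ereal (- 2 * pi + pi / 2)..ereal (0 + pi / 2). f \<phi>)"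
    by (rule interval_integral_shift)
  also have "\<dots> = (LBINT \<phi>=ereal (- 2 * pi + pi / 2)..ereal ((- 2 * pi + pi / 2) + 2 * pi). f \<phi>)"
    by simp
  also have "\<dots> = (LBINT \<phi>=ereal 0..ereal (2 * pi). f \<phi>)"
    by (rule interval_integral_periodic[OF f_meas f_bd]) (simp add: f_def cis_mult[symmetric])
  also have "\<dots> = Im (circle_flux K c)" by (simp add: f_def circle_flux_Im)
  finally show ?thesis .
qed

lemma measurable_circle_flux_line:
  assumes [measurable]: "K \<in> sets borel"
  shows "(\<lambda>s. circle_flux K (c + of_real s)) \<in> borel_measurable borel"
  unfolding circle_flux_def interval_lebesgue_integral_def set_lebesgue_integral_def
  by measurable

lemma measure_disc_shift_horizontal_bound:
  assumes K: "K \<in> sets borel"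
    and near: "\<And>s. \<bar>s\<bar> \<le> \<bar>h\<bar> \<Longrightarrow> \<bar>Re (circle_flux K (c + of_real s)) - r\<bar> \<le> \<epsilon>"
  shows "\<bar>measure lborel (K \<inter> cball (c + of_real h) 1) - measure lborel (K \<inter> cball c 1) - h * r\<bar>
       \<le> \<epsilon> * \<bar>h\<bar>"
proof -
  have pos: "\<bar>measure lborel (K \<inter> cball (c + of_real h) 1) - measure lborel (K \<inter> cball c 1)
        - h * r\<bar> \<le> \<epsilon> * h"
    if h: "0 \<le> h" and near: "\<And>s. 0 \<le> s \<Longrightarrow> s \<le> h \<Longrightarrow> \<bar>Re (circle_flux K (c + of_real s)) - r\<bar> \<le> \<epsilon>"
    for h :: real and c :: complex
  proof -
    define g where "g s = Re (circle_flux K (c + of_real s))" for s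
    have g_meas [measurable]: "g \<in> borel_measurable borel"
      unfolding g_def using measurable_circle_flux_line[OF K, of c] by measurable
    have g: "\<bar>g s - r\<bar> \<le> \<epsilon>" if "0 \<le> s" "s \<le> h" for s
      using near[OF that] by (simp add: g_def)
    have g_int: "integrable lborel (\<lambda>s. indicat_real {0..h} s * (g s - r))"
      by (rule integrable_bounded_compact_support[where a = 0 and b = h and B = "\<bar>\<epsilon>\<bar>"])
         (use order_trans[OF g abs_ge_self] in \<open>auto simp: indicator_def\<close>)
    have c_int: "integrable lborel (\<lambda>s. indicat_real {0..h} s * a)" for a
      by (rule integrable_bounded_compact_support[where a = 0 and b = h and B = "\<bar>a\<bar>"])
         (auto simp: indicator_def)
    have "measure lborel (K \<inter> cball (c + of_real h) 1) - measure lborel (K \<inter> cball c 1)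
        = (LBINT s. indicat_real {0..h} s * g s)"
      using h by (simp add: measure_disc_shift[OF K h] interval_integral_Icc set_lebesgue_integral_def g_def)
    also have "\<dots> = (LBINT s. indicat_real {0..h} s * (g s - r) + indicat_real {0..h} s * r)"
      by (simp add: algebra_simps)
    also have "\<dots> = (LBINT s. indicat_real {0..h} s * (g s - r)) + h * r"
      by (subst Bochner_Integration.integral_add[OF g_int c_int]) (use h in simp)
    finally have "\<bar>measure lborel (K \<inter> cball (c + of_real h) 1) - measure lborel (K \<inter> cball c 1)
        - h * r\<bar> = \<bar>LBINT s. indicat_real {0..h} s * (g s - r)\<bar>" by simp
    also have "\<dots> \<le> (LBINT s. indicat_real {0..h} s * \<epsilon>)"
      by (rule integral_abs_bound_integral[OF g_int c_int]) (use g in \<open>auto simp: indicator_def\<close>)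
    also have "\<dots> = \<epsilon> * h" using h by simp
    finally show ?thesis .
  qed
  show ?thesis
  proof (cases "0 \<le> h")
    case True
    then show ?thesis using pos[of h c] near by auto
  next
    case False
    \<comment> \<open>A shift by a negative \<open>h\<close> is undone by a shift by
      \<open>- h\<close> that starts from the displaced centre.\<close>
    have "\<bar>measure lborel (K \<inter> cball ((c + of_real h) + of_real (- h)) 1)
        - measure lborel (K \<inter> cball (c + of_real h) 1) - (- h) * r\<bar> \<le> \<epsilon> * (- h)"
    proof (rule pos)
      fix s assume "0 \<le> s" "s \<le> - h"
      then show "\<bar>Re (circle_flux K (c + of_real h + of_real s)) - r\<bar> \<le> \<epsilon>"
        using near[of "h + s"] by (simp add: add.assoc)
    qed (use False in simp)
    then show ?thesis using False by simp
  qed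
qed

lemma measure_disc_shift_vertical_bound:
  assumes K [measurable]: "K \<in> sets borel"
    and near: "\<And>s. \<bar>s\<bar> \<le> \<bar>h\<bar> \<Longrightarrow> \<bar>Im (circle_flux K (c + \<i> * of_real s)) - r\<bar> \<le> \<epsilon>"
  shows "\<bar>measure lborel (K \<inter> cball (c + \<i> * of_real h) 1) - measure lborel (K \<inter> cball c 1) - h * r\<bar>
       \<le> \<epsilon> * \<bar>h\<bar>"
proof -
  define T where "T = transpose_complex"
  have T: "T (c + \<i> * of_real s) = T c + of_real s" for c s
    by (simp add: T_def transpose_complex_def complex_eq_iff)
  have meas: "measure lborel (T -` K \<inter> cball (T d) 1) = measure lborel (K \<inter> cball d 1)" for d
  proof -
    have "T -` K \<inter> cball (T d) 1 = T -` (K \<inter> cball d 1)"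
      using transpose_complex_simps(4)[of d "T _"] by (auto simp: T_def)
    moreover have "measure lborel (T -` (K \<inter> cball d 1)) = measure lborel (K \<inter> cball d 1)"
      unfolding T_def by (rule measure_transpose_complex) auto
    ultimately show ?thesis by simp
  qed
  have "T -` K \<in> sets borel"
    using measurable_sets[OF measurable_transpose_complex K] by (simp add: T_def)
  then have "\<bar>measure lborel (T -` K \<inter> cball (T c + of_real h) 1)
      - measure lborel (T -` K \<inter> cball (T c) 1) - h * r\<bar> \<le> \<epsilon> * \<bar>h\<bar>"
  proof (rule measure_disc_shift_horizontal_bound)
    fix s assume "\<bar>s\<bar> \<le> \<bar>h\<bar>"
    then show "\<bar>Re (circle_flux (T -` K) (T c + of_real s)) - r\<bar> \<le> \<epsilon>"
      using near circle_flux_transpose[OF K, of "c + \<i> * of_real s"]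
      unfolding T[symmetric] unfolding T_def by presburger
  qed
  then show ?thesis unfolding T[symmetric] meas .
qed

text \<open>The way from \<open>c\<close> to \<open>c'\<close> is split into a horizontal and a
  vertical leg. Both stay within \<open>dist c' c\<close> of \<open>c\<close>, where the flux is
  close to \<open>N\<close>; each leg contributes one \<open>\<epsilon>\<close>, hence the factor
  2.\<close>

lemma measure_disc_shift_bound:
  assumes K: "K \<in> sets borel"
    and near: "\<And>z. dist z c \<le> dist c' c \<Longrightarrow> norm (circle_flux K z - N) \<le> \<epsilon>"
  shows "\<bar>measure lborel (K \<inter> cball c' 1) - measure lborel (K \<inter> cball c 1) - (c' - c) \<bullet> N\<bar>
       \<le> 2 * \<epsilon> * dist c' c"
proof -
  define w where "w = c' - c"
  define c1 where "c1 = c + of_real (Re w)"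
  have \<epsilon>: "0 \<le> \<epsilon>" by (rule order_trans[OF norm_ge_zero near[of c]]) simp
  have c': "c' = c1 + \<i> * of_real (Im w)" by (simp add: c1_def w_def complex_eq_iff)
  have d: "dist c' c = norm w" by (simp add: w_def dist_norm)
  have hor: "\<bar>measure lborel (K \<inter> cball c1 1) - measure lborel (K \<inter> cball c 1) - Re w * Re N\<bar>
      \<le> \<epsilon> * \<bar>Re w\<bar>"
    unfolding c1_def
  proof (rule measure_disc_shift_horizontal_bound[OF K])
    fix s assume "\<bar>s\<bar> \<le> \<bar>Re w\<bar>"
    then have "dist (c + of_real s) c \<le> dist c' c"
      using abs_Re_le_cmod[of w] unfolding d by (simp add: dist_norm)
    from order_trans[OF abs_Re_le_cmod near[OF this]]
    show "\<bar>Re (circle_flux K (c + of_real s)) - Re N\<bar> \<le> \<epsilon>" by simp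
  qed
  have ver: "\<bar>measure lborel (K \<inter> cball c' 1) - measure lborel (K \<inter> cball c1 1) - Im w * Im N\<bar>
      \<le> \<epsilon> * \<bar>Im w\<bar>"
    unfolding c'
  proof (rule measure_disc_shift_vertical_bound[OF K])
    fix s assume "\<bar>s\<bar> \<le> \<bar>Im w\<bar>"
    then have "s\<^sup>2 \<le> (Im w)\<^sup>2" using abs_le_square_iff by blast
    then have "dist (c1 + \<i> * of_real s) c \<le> dist c' c"
      unfolding d by (simp add: dist_norm c1_def cmod_def)
    from order_trans[OF abs_Im_le_cmod near[OF this]]
    show "\<bar>Im (circle_flux K (c1 + \<i> * of_real s)) - Im N\<bar> \<le> \<epsilon>" by simp
  qed
  have "\<epsilon> * \<bar>Re w\<bar> \<le> \<epsilon> * norm w" "\<epsilon> * \<bar>Im w\<bar> \<le> \<epsilon> * norm w"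
    using \<epsilon> by (auto intro!: mult_left_mono abs_Re_le_cmod abs_Im_le_cmod)
  with hor ver show ?thesis
    unfolding d w_def[symmetric] inner_complex_def by linarith
qed

section \<open>Continuity of the flux and the first variation of the area\<close>

lemma finite_unit_circles_inter:
  fixes u :: complex
  assumes "u \<noteq> 0"
  shows "finite {z. norm z = 1 \<and> norm (u + z) = 1}"
proof (rule finite_subset)
  \<comment> \<open>On the unit circle \<open>cnj z\<close> is the inverse of \<open>z\<close>.
    Multiplying the second circle equation by \<open>z\<close> makes it quadratic, with leading
    coefficient \<open>cnj u\<close>, which is nonzero.\<close>
  let ?p = "[:u, of_real ((norm u)\<^sup>2), cnj u:]"
  show "{z. norm z = 1 \<and> norm (u + z) = 1} \<subseteq> {z. poly ?p z = 0}"
  proof clarsimp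
    fix z :: complex assume z: "norm z = 1" "norm (u + z) = 1"
    define zc uc where "zc = cnj z" and "uc = cnj u"
    have "z * zc = 1" using z complex_norm_square[of z] by (simp add: zc_def)
    moreover have "(u + z) * (uc + zc) = 1"
      using z complex_norm_square[of "u + z"] by (simp add: zc_def uc_def)
    ultimately have "u + z * (u * uc + z * uc) = 0" by algebra
    then show "u + z * ((of_real (norm u))\<^sup>2 + z * cnj u) = 0"
      using complex_norm_square[of u] by (simp add: uc_def)
  qed
  show "finite {z. poly ?p z = 0}" using assms by (intro poly_roots_finite) auto
qed

lemma inj_on_cis: "inj_on cis {0..<2 * pi}"
proof (rule inj_on_inverseI)
  fix \<phi> assume "\<phi> \<in> {0..<2 * pi}"
  then show "Arg2pi (cis \<phi>) = \<phi>"
    by (intro Arg2pi_unique[of 1]) (auto simp: cis_conv_exp)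
qed

lemma finite_angles_on_unit_circle:
  fixes C D :: complex
  assumes "C \<noteq> D"
  shows "finite {\<phi> \<in> {0..<2 * pi}. norm (C + cis \<phi> - D) = 1}"
proof (rule finite_subset)
  have "finite {z. norm z = 1 \<and> norm ((C - D) + z) = 1}"
    using assms by (intro finite_unit_circles_inter) auto
  then show "finite (cis -` {z. norm z = 1 \<and> norm ((C - D) + z) = 1} \<inter> {0..<2 * pi})"
    by (rule finite_vimage_IntI[OF _ inj_on_cis])
  show "{\<phi> \<in> {0..<2 * pi}. norm (C + cis \<phi> - D) = 1}
      \<subseteq> cis -` {z. norm z = 1 \<and> norm ((C - D) + z) = 1} \<inter> {0..<2 * pi}"
  proof (rule subsetI)
    fix \<phi> assume "\<phi> \<in> {\<phi> \<in> {0..<2 * pi}. norm (C + cis \<phi> - D) = 1}"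
    then have \<phi>: "\<phi> \<in> {0..<2 * pi}" and "norm (C + cis \<phi> - D) = 1" by blast+
    moreover have "C + cis \<phi> - D = (C - D) + cis \<phi>" by simp
    ultimately have "norm ((C - D) + cis \<phi>) = 1" by metis
    with \<phi> show "\<phi> \<in> cis -` {z. norm z = 1 \<and> norm ((C - D) + z) = 1} \<inter> {0..<2 * pi}"
      by (intro IntI vimageI2 CollectI conjI norm_cis)
  qed
qed


text \<open>By dominated convergence along a sequence of supposed counterexamples: membership in the
  discs is locally constant in all centres at every angle whose point on the limit circle avoids the
  other limit circles. As the centres differ, only finitely many angles are lost.\<close>

lemma circle_flux_continuous:
  fixes D :: "'i \<Rightarrow> complex"
  assumes fin: "finite J" and ne: "\<And>j. j \<in> J \<Longrightarrow> C \<noteq> D j" and \<epsilon>: "0 < \<epsilon>"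
  obtains \<delta> where "0 < \<delta>"
    "\<And>c d. dist c C \<le> \<delta> \<Longrightarrow> (\<And>j. j \<in> J \<Longrightarrow> dist (d j) (D j) \<le> \<delta>) \<Longrightarrow>
       norm (circle_flux (\<Inter>j\<in>J. cball (d j) 1) c - circle_flux (\<Inter>j\<in>J. cball (D j) 1) C) \<le> \<epsilon>"
proof (rule ccontr)
  define K where "K d = (\<Inter>j\<in>J. cball (d j) 1)" for d :: "'i \<Rightarrow> complex"
  define F where "F d c \<phi> = indicat_real {0..2 * pi} \<phi> *\<^sub>R (indicat_real (K d) (c + cis \<phi>) *\<^sub>R cis \<phi>)"
    for d c \<phi>
  have K_meas [measurable]: "K d \<in> sets borel" for d
    unfolding K_def by (intro borel_closed closed_INT) auto
  have flux: "circle_flux (K d) c = (LBINT \<phi>. F d c \<phi>)" for d c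
    by (simp add: circle_flux_def F_def interval_integral_Icc set_lebesgue_integral_def)
  assume neg: "\<not> thesis"
  note thesisI = that
  have ex: "\<exists>c d. dist c C \<le> \<delta> \<and> (\<forall>j\<in>J. dist (d j) (D j) \<le> \<delta>) \<and>
      \<epsilon> < norm (circle_flux (K d) c - circle_flux (K D) C)" if "0 < \<delta>" for \<delta>
  proof (rule ccontr)
    assume "\<not> (\<exists>c d. dist c C \<le> \<delta> \<and> (\<forall>j\<in>J. dist (d j) (D j) \<le> \<delta>) \<and>
      \<epsilon> < norm (circle_flux (K d) c - circle_flux (K D) C))"
    then have thesis
      by (intro thesisI[OF \<open>0 < \<delta>\<close>]) (auto simp: K_def not_less)
    with neg show False ..
  qed
  have "\<forall>n. \<exists>c d. dist c C \<le> 1 / Suc n \<and> (\<forall>j\<in>J. dist (d j) (D j) \<le> 1 / Suc n) \<and>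
      \<epsilon> < norm (circle_flux (K d) c - circle_flux (K D) C)"
    by (intro allI ex) simp
  then obtain c d where c: "\<And>n. dist (c n) C \<le> 1 / Suc n"
    and d: "\<And>n j. j \<in> J \<Longrightarrow> dist (d n j) (D j) \<le> 1 / Suc n"
    and far: "\<And>n. \<epsilon> < norm (circle_flux (K (d n)) (c n) - circle_flux (K D) C)"
    by metis
  have lim0: "(\<lambda>n. 1 / real (Suc n)) \<longlonglongrightarrow> 0" by (rule LIMSEQ_inverse_real_of_nat[unfolded inverse_eq_divide])
  have c_lim: "c \<longlonglongrightarrow> C"
    by (rule metric_tendsto_imp_tendsto[OF lim0]) (use c in auto)
  have d_lim: "(\<lambda>n. d n j) \<longlonglongrightarrow> D j" if "j \<in> J" for j
    by (rule metric_tendsto_imp_tendsto[OF lim0]) (use d[OF that] in auto)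
  have "(\<lambda>n. LBINT \<phi>. F (d n) (c n) \<phi>) \<longlonglongrightarrow> (LBINT \<phi>. F D C \<phi>)"
  proof (rule integral_dominated_convergence[where w = "indicat_real {0..2 * pi}"])
    show "F D C \<in> borel_measurable lborel" "\<And>n. F (d n) (c n) \<in> borel_measurable lborel"
      unfolding F_def by measurable
    show "integrable lborel (indicat_real {0..2 * pi})"
      by (rule integrable_real_indicator) auto
    show "AE \<phi> in lborel. norm (F (d n) (c n) \<phi>) \<le> indicat_real {0..2 * pi} \<phi>" for n
      by (auto simp: F_def indicator_def)
    \<comment> \<open>The exceptional angles. The end point \<open>2 * pi\<close> is added because
      finiteness was shown on the half-open period, while \<open>F\<close> lives on the closed
      one.\<close>
    define E where "E = insert (2 * pi) (\<Union>j\<in>J. {\<phi> \<in> {0..<2 * pi}. norm (C + cis \<phi> - D j) = 1})"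
    have "finite E" unfolding E_def 
      by (intro finite.insertI finite_UN_I fin finite_angles_on_unit_circle ne)
    then have "AE \<phi> in lborel. \<phi> \<notin> E"
      by (intro AE_not_in) (auto intro: finite_imp_null_set_lborel)
    then show "AE \<phi> in lborel. (\<lambda>n. F (d n) (c n) \<phi>) \<longlonglongrightarrow> F D C \<phi>"
    proof eventually_elim
      case (elim \<phi>)
      show ?case
      proof (cases "\<phi> \<in> {0..2 * pi}")
        case True
        have "\<forall>\<^sub>F n in sequentially. \<forall>j\<in>J. c n + cis \<phi> \<in> cball (d n j) 1 \<longleftrightarrow> C + cis \<phi> \<in> cball (D j) 1"
        proof (intro eventually_ball_finite[OF fin] ballI)
          fix j assume j: "j \<in> J"
          have ne1: "norm (C + cis \<phi> - D j) \<noteq> 1" using elim True j by (auto simp: E_def)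
          have lim: "(\<lambda>n. norm (c n + cis \<phi> - d n j)) \<longlonglongrightarrow> norm (C + cis \<phi> - D j)"
            by (intro tendsto_intros c_lim d_lim j)
          show "\<forall>\<^sub>F n in sequentially. c n + cis \<phi> \<in> cball (d n j) 1 \<longleftrightarrow> C + cis \<phi> \<in> cball (D j) 1"
          proof (cases "norm (C + cis \<phi> - D j) < 1")
            case True
            from order_tendstoD(2)[OF lim this] show ?thesis
              by eventually_elim (use True in \<open>auto simp: dist_norm norm_minus_commute\<close>)
          next
            case False
            with ne1 have gt: "1 < norm (C + cis \<phi> - D j)" by simp
            from order_tendstoD(1)[OF lim this] show ?thesis
              by eventually_elim (use gt in \<open>auto simp: dist_norm norm_minus_commute\<close>)
          qed
        qed
        then have "\<forall>\<^sub>F n in sequentially. F (d n) (c n) \<phi> = F D C \<phi>"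
          by eventually_elim (auto simp: F_def K_def indicator_def)
        then show ?thesis by (rule tendsto_eventually)
      qed (simp add: F_def)
    qed
  qed
  then have "(\<lambda>n. circle_flux (K (d n)) (c n)) \<longlonglongrightarrow> circle_flux (K D) C" by (simp add: flux)
  then have "\<forall>\<^sub>F n in sequentially. dist (circle_flux (K (d n)) (c n)) (circle_flux (K D) C) < \<epsilon>"
    using \<epsilon> by (rule tendstoD)
  then show False using far by (auto simp: dist_norm eventually_sequentially less_le_not_le)
qed

text \<open>The discs are moved one at a time, by induction on the set \<open>S\<close> of moved
  indices. When disc \<open>i\<close> moves, some others are already displaced, so the flux has to
  be close to \<open>N i\<close> uniformly in all centres; this is the reason for joint
  continuity.\<close>

theorem area_disc_intersection_first_variation:
  fixes C :: "'i \<Rightarrow> complex"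
  assumes fin: "finite I" and inj: "inj_on C I" and \<epsilon>: "0 < \<epsilon>"
  defines "N \<equiv> \<lambda>i. circle_flux (\<Inter>j\<in>I - {i}. cball (C j) 1) (C i)"
  obtains \<delta> where "0 < \<delta>"
    "\<And>c. (\<And>i. i \<in> I \<Longrightarrow> dist (c i) (C i) \<le> \<delta>) \<Longrightarrow>
      \<bar>measure lborel (\<Inter>i\<in>I. cball (c i) 1) - measure lborel (\<Inter>i\<in>I. cball (C i) 1)
        - (\<Sum>i\<in>I. (c i - C i) \<bullet> N i)\<bar> \<le> \<epsilon> * (\<Sum>i\<in>I. dist (c i) (C i))"
proof -
  have "\<exists>\<delta>>0. \<forall>c d. dist c (C i) \<le> \<delta> \<longrightarrow> (\<forall>j\<in>I - {i}. dist (d j) (C j) \<le> \<delta>) \<longrightarrow>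
      norm (circle_flux (\<Inter>j\<in>I - {i}. cball (d j) 1) c - N i) \<le> \<epsilon> / 2" if "i \<in> I" for i
  proof -
    have "C i \<noteq> C j" if "j \<in> I - {i}" for j using inj \<open>i \<in> I\<close> that by (auto dest: inj_onD)
    then show ?thesis
      using circle_flux_continuous[of "I - {i}" "C i" C "\<epsilon> / 2"] fin \<epsilon> unfolding N_def
      by (metis finite_Diff half_gt_zero)
  qed
  then obtain \<delta>' where \<delta>': "\<And>i. i \<in> I \<Longrightarrow> 0 < \<delta>' i"
    and near: "\<And>i c d. \<lbrakk>i \<in> I; dist c (C i) \<le> \<delta>' i; \<forall>j\<in>I - {i}. dist (d j) (C j) \<le> \<delta>' i\<rbrakk> \<Longrightarrow>
      norm (circle_flux (\<Inter>j\<in>I - {i}. cball (d j) 1) c - N i) \<le> \<epsilon> / 2"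
    by metis
  define \<delta> where "\<delta> = Min (insert 1 (\<delta>' ` I))"
  have "0 < \<delta>" using fin \<delta>' by (simp add: \<delta>_def)
  moreover have \<delta>_le: "\<delta> \<le> \<delta>' i" if "i \<in> I" for i using fin that by (simp add: \<delta>_def)
  moreover have step: "\<bar>measure lborel (\<Inter>i\<in>I. cball (c i) 1) - measure lborel (\<Inter>i\<in>I. cball (C i) 1)
        - (\<Sum>i\<in>S. (c i - C i) \<bullet> N i)\<bar> \<le> \<epsilon> * (\<Sum>i\<in>S. dist (c i) (C i))"
    if "finite S" "S \<subseteq> I" "\<And>i. i \<in> I \<Longrightarrow> dist (c i) (C i) \<le> \<delta>" "\<And>i. i \<in> I - S \<Longrightarrow> c i = C i" for S c
    using that
  proof (induction S arbitrary: c rule: finite_induct)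
    case empty
    then have "(\<Inter>i\<in>I. cball (c i) 1) = (\<Inter>i\<in>I. cball (C i) 1)" by auto
    then show ?case by simp
  next
    case (insert i S)
    define c' where "c' = c(i := C i)"
    define K where "K = (\<Inter>j\<in>I - {i}. cball (c j) 1)"
    have i: "i \<in> I" using insert.prems by auto
    have K: "K \<in> sets borel" unfolding K_def by (intro borel_closed closed_INT) auto
    have eq: "(\<Inter>i\<in>I. cball (c i) 1) = K \<inter> cball (c i) 1" "(\<Inter>i\<in>I. cball (c' i) 1) = K \<inter> cball (C i) 1"
      using i by (auto simp: K_def c'_def split: if_splits)
    have "\<bar>measure lborel (K \<inter> cball (c i) 1) - measure lborel (K \<inter> cball (C i) 1)
        - (c i - C i) \<bullet> N i\<bar> \<le> 2 * (\<epsilon> / 2) * dist (c i) (C i)"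
    proof (rule measure_disc_shift_bound[OF K])
      fix z assume "dist z (C i) \<le> dist (c i) (C i)"
      then have "dist z (C i) \<le> \<delta>' i" using insert.prems(2)[OF i] \<delta>_le[OF i] by linarith
      moreover have "\<forall>j\<in>I - {i}. dist (c j) (C j) \<le> \<delta>' i"
        using insert.prems(2) \<delta>_le[OF i] order_trans by blast
      ultimately show "norm (circle_flux K z - N i) \<le> \<epsilon> / 2"
        unfolding K_def by (rule near[OF i])
    qed
    moreover have "\<bar>measure lborel (\<Inter>i\<in>I. cball (c' i) 1) - measure lborel (\<Inter>i\<in>I. cball (C i) 1)
        - (\<Sum>i\<in>S. (c' i - C i) \<bullet> N i)\<bar> \<le> \<epsilon> * (\<Sum>i\<in>S. dist (c' i) (C i))"
      using insert.prems \<open>0 < \<delta>\<close> by (intro insert.IH) (auto simp: c'_def)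
    moreover have "(\<Sum>i\<in>S. (c' i - C i) \<bullet> N i) = (\<Sum>i\<in>S. (c i - C i) \<bullet> N i)"
      "(\<Sum>i\<in>S. dist (c' i) (C i)) = (\<Sum>i\<in>S. dist (c i) (C i))"
      using insert.hyps by (auto simp: c'_def intro!: sum.cong)
    ultimately show ?case
      using insert.hyps by (simp add: eq algebra_simps)
  qed
  ultimately show ?thesis using that[of \<delta>] fin by blast
qed

lemma area_disc_intersection_has_real_derivative:
  fixes c :: "'i \<Rightarrow> real \<Rightarrow> complex"
  assumes fin: "finite I" and inj: "inj_on (\<lambda>i. c i t0) I"
    and der: "\<And>i. i \<in> I \<Longrightarrow> (c i has_vector_derivative c' i) (at t0)"
  shows "((\<lambda>t. measure lborel (\<Inter>i\<in>I. cball (c i t) 1)) has_real_derivative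
     (\<Sum>i\<in>I. c' i \<bullet> circle_flux (\<Inter>j\<in>I - {i}. cball (c j t0) 1) (c i t0))) (at t0)"
proof -
  define G where "G t = measure lborel (\<Inter>i\<in>I. cball (c i t) 1)" for t
  define N where "N i = circle_flux (\<Inter>j\<in>I - {i}. cball (c j t0) 1) (c i t0)" for i
  define S where "S t = (\<Sum>i\<in>I. (c i t - c i t0) \<bullet> N i)" for t
  have c_cont: "(c i \<longlongrightarrow> c i t0) (at t0)" if "i \<in> I" for i
    using has_vector_derivative_continuous[OF der[OF that]] by (simp add: isCont_def)
  have "(S has_real_derivative (\<Sum>i\<in>I. c' i \<bullet> N i)) (at t0)"
  proof -
    have "((\<lambda>t. c i t \<bullet> N i) has_vector_derivative (c' i \<bullet> N i)) (at t0)" if "i \<in> I" for i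
      using bounded_linear.has_vector_derivative[OF bounded_linear_inner_left der[OF that]] .
    then have "((\<lambda>t. c i t \<bullet> N i) has_real_derivative (c' i \<bullet> N i)) (at t0)" if "i \<in> I" for i
      using that by (simp add: has_real_derivative_iff_has_vector_derivative)
    then show ?thesis
      unfolding S_def inner_diff_left by (auto intro!: derivative_eq_intros)
  qed
  moreover have "((\<lambda>t. G t - G t0 - S t) has_real_derivative 0) (at t0)"
  proof -
    \<comment> \<open>Differentiability bounds the displacement of centre \<open>i\<close> by
      \<open>(norm (c' i) + 1) * \<bar>t - t0\<bar>\<close> near \<open>t0\<close>; \<open>L\<close>
      adds up these constants.\<close>
    define L where "L = (\<Sum>i\<in>I. norm (c' i) + 1)"
    have L: "0 \<le> L" by (simp add: L_def sum_nonneg)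
    have "\<forall>\<^sub>F t in at t0. \<forall>i\<in>I. dist (c i t) (c i t0) \<le> (norm (c' i) + 1) * \<bar>t - t0\<bar>"
    proof (intro eventually_ball_finite[OF fin] ballI)
      fix i assume "i \<in> I"
      then have "((\<lambda>t. norm (c i t - c i t0 - (t - t0) *\<^sub>R c' i) / norm (t - t0)) \<longlongrightarrow> 0) (at t0)"
        using der[unfolded has_vector_derivative_def has_derivative_iff_norm] by blast
      from order_tendstoD(2)[OF this zero_less_one]
      have "\<forall>\<^sub>F t in at t0. norm (c i t - c i t0 - (t - t0) *\<^sub>R c' i) / norm (t - t0) < 1" .
      moreover have "\<forall>\<^sub>F t in at t0. t \<noteq> t0" by (simp add: eventually_at_filter)
      ultimately show "\<forall>\<^sub>F t in at t0. dist (c i t) (c i t0) \<le> (norm (c' i) + 1) * \<bar>t - t0\<bar>"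
      proof eventually_elim
        case (elim t)
        then have "norm (c i t - c i t0 - (t - t0) *\<^sub>R c' i) \<le> \<bar>t - t0\<bar>" by simp
        moreover have "norm (c i t - c i t0) \<le> norm (c i t - c i t0 - (t - t0) *\<^sub>R c' i)
            + norm ((t - t0) *\<^sub>R c' i)" by (metis add.commute norm_triangle_sub)
        ultimately show ?case by (simp add: dist_norm distrib_left mult.commute)
      qed
    qed
    then have Lip: "\<forall>\<^sub>F t in at t0. (\<Sum>i\<in>I. dist (c i t) (c i t0)) \<le> L * \<bar>t - t0\<bar>"
      by eventually_elim (auto simp: L_def sum_distrib_right intro!: sum_mono)
    have "((\<lambda>t. (G t - G t0 - S t) / (t - t0)) \<longlongrightarrow> 0) (at t0)"
    proof (rule tendstoI)
      fix e :: real assume e: "0 < e"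
      \<comment> \<open>With this tolerance the error is at most
        \<open>e * \<bar>t - t0\<bar>\<close> times \<open>L / (2 * (L + 1))\<close>, a factor below
        1 even for \<open>L = 0\<close>.\<close>
      then have "0 < e / (2 * (L + 1))" using L by simp
      from area_disc_intersection_first_variation[OF fin inj this]
      obtain \<delta> where \<delta>: "0 < \<delta>" and
        var: "\<And>d. (\<And>i. i \<in> I \<Longrightarrow> dist (d i) (c i t0) \<le> \<delta>) \<Longrightarrow>
          \<bar>measure lborel (\<Inter>i\<in>I. cball (d i) 1) - measure lborel (\<Inter>i\<in>I. cball (c i t0) 1)
          - (\<Sum>i\<in>I. (d i - c i t0) \<bullet> N i)\<bar> \<le> e / (2 * (L + 1)) * (\<Sum>i\<in>I. dist (d i) (c i t0))"
        unfolding N_def by blast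
      have "\<forall>\<^sub>F t in at t0. \<forall>i\<in>I. dist (c i t) (c i t0) < \<delta>"
        by (intro eventually_ball_finite[OF fin] ballI tendstoD[OF c_cont \<delta>])
      moreover have "\<forall>\<^sub>F t in at t0. t \<noteq> t0" by (simp add: eventually_at_filter)
      ultimately show "\<forall>\<^sub>F t in at t0. dist ((G t - G t0 - S t) / (t - t0)) 0 < e"
        using Lip
      proof eventually_elim
        case (elim t)
        have "\<bar>G t - G t0 - S t\<bar> \<le> e / (2 * (L + 1)) * (\<Sum>i\<in>I. dist (c i t) (c i t0))"
          unfolding G_def S_def using elim(1) by (intro var) (auto intro: less_imp_le)
        also have "\<dots> \<le> e / (2 * (L + 1)) * (L * \<bar>t - t0\<bar>)"
          using elim(3) e L by (intro mult_left_mono) auto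
        also have "\<dots> = e * \<bar>t - t0\<bar> * (L / (2 * (L + 1)))" by simp
        also have "\<dots> < e * \<bar>t - t0\<bar> * 1"
          using e L elim(2) by (intro mult_strict_left_mono) (auto simp: field_simps)
        finally show ?case using elim(2) by (simp add: dist_norm abs_divide field_simps)
      qed
    qed
    then show ?thesis by (simp add: has_field_derivative_iff S_def)
  qed
  ultimately have "((\<lambda>t. (G t - G t0 - S t) + S t + G t0) has_real_derivative
      0 + (\<Sum>i\<in>I. c' i \<bullet> N i) + 0) (at t0)"
    by (intro DERIV_add DERIV_const)
  then show ?thesis by (simp add: G_def N_def)
qed


subsection \<open>Arcs of unit circles\<close>

text \<open>Multiplication by a unit complex number is a rotation. This allows computations in the
  frame in which \<open>P\<close> becomes 1.\<close>

lemma inner_mult_unit: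
  assumes "norm P = 1"
  shows "(a * P) \<bullet> (b * P) = a \<bullet> (b :: complex)"
proof -
  have "(Re P)\<^sup>2 + (Im P)\<^sup>2 = 1" using assms by (simp add: cmod_power2[symmetric])
  then show ?thesis by (simp add: inner_complex_def) algebra
qed

lemma norm_add_squared: "(norm (x + y))\<^sup>2 = (norm x)\<^sup>2 + 2 * (x \<bullet> y) + (norm (y :: complex))\<^sup>2"
  by (simp add: power2_norm_eq_inner inner_add_left inner_add_right inner_commute)

lemma norm_diff_squared: "(norm (x - y))\<^sup>2 = (norm x)\<^sup>2 - 2 * (x \<bullet> y) + (norm (y :: complex))\<^sup>2"
  by (simp add: power2_norm_eq_inner inner_diff_left inner_diff_right inner_commute)

text \<open>For points of a unit circle, membership in another unit disc is linear in the point. All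
  convexity arguments on arcs rest on this.\<close>

lemma unit_add_le_one_iff:
  assumes "norm (P :: complex) = 1"
  shows "norm (P + d) \<le> 1 \<longleftrightarrow> 2 * (P \<bullet> d) \<le> - (norm d)\<^sup>2"
    and "norm (P + d) < 1 \<longleftrightarrow> 2 * (P \<bullet> d) < - (norm d)\<^sup>2"
proof -
  have "norm (P + d) \<le> 1 \<longleftrightarrow> (norm (P + d))\<^sup>2 \<le> 1" "norm (P + d) < 1 \<longleftrightarrow> (norm (P + d))\<^sup>2 < 1"
    by (simp_all add: power_le_one_iff power_less_one_iff)
  then show "norm (P + d) \<le> 1 \<longleftrightarrow> 2 * (P \<bullet> d) \<le> - (norm d)\<^sup>2"
    "norm (P + d) < 1 \<longleftrightarrow> 2 * (P \<bullet> d) < - (norm d)\<^sup>2"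
    using assms by (auto simp: norm_add_squared)
qed

text \<open>By the triangle inequality \<open>1 \<le> a + b\<close>, so the combination of the two
  linear inequalities is at least as strong as the one required. Thus a unit disc containing both
  ends of a short unit arc contains the arc.\<close>

lemma unit_combination_add_le_one:
  fixes P Q d :: complex
  assumes unit: "norm P = 1" "norm Q = 1" "norm (a *\<^sub>R P + b *\<^sub>R Q) = 1"
    and nonneg: "0 \<le> a" "0 \<le> b" and le: "norm (P + d) \<le> 1" "norm (Q + d) \<le> 1"
  shows "norm ((a *\<^sub>R P + b *\<^sub>R Q) + d) \<le> 1"
proof -
  have "1 \<le> a + b" using norm_triangle_ineq[of "a *\<^sub>R P" "b *\<^sub>R Q"] unit nonneg by simp
  then have "(a + b) * (norm d)\<^sup>2 \<ge> 1 * (norm d)\<^sup>2" by (intro mult_right_mono) auto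
  moreover have "a * (2 * (P \<bullet> d)) \<le> a * (- (norm d)\<^sup>2)" "b * (2 * (Q \<bullet> d)) \<le> b * (- (norm d)\<^sup>2)"
    using le[unfolded unit_add_le_one_iff(1)[OF unit(1)] unit_add_le_one_iff(1)[OF unit(2)]] nonneg
    by (intro mult_left_mono; simp)+
  ultimately show ?thesis
    unfolding unit_add_le_one_iff[OF unit(3)] inner_add_left inner_scaleR_left
    by (simp add: algebra_simps)
qed

text \<open>For \<open>P \<noteq> Q\<close> the triangle inequality is strict, so
  \<open>1 < a + b\<close>, and the slack \<open>(a + b - 1) * (norm d)\<^sup>2\<close> makes the
  conclusion strict.\<close>

lemma unit_combination_add_less_one:
  fixes P Q d :: complex
  assumes unit: "norm P = 1" "norm Q = 1" "norm (a *\<^sub>R P + b *\<^sub>R Q) = 1"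
    and pos: "0 < a" "0 < b" and ne: "P \<noteq> Q" "d \<noteq> 0"
    and le: "norm (P + d) \<le> 1" "norm (Q + d) \<le> 1"
  shows "norm ((a *\<^sub>R P + b *\<^sub>R Q) + d) < 1"
proof -
  have "0 < (norm (P - Q))\<^sup>2" using ne by simp
  then have PQ: "P \<bullet> Q < 1" using unit by (simp add: norm_diff_squared)
  have "1 = (norm (a *\<^sub>R P + b *\<^sub>R Q))\<^sup>2" using unit by simp
  also have "\<dots> = a\<^sup>2 + b\<^sup>2 + 2 * (a * b) * (P \<bullet> Q)"
    unfolding norm_add_squared using unit(1,2) by (simp add: power_mult_distrib)
  also have "\<dots> < a\<^sup>2 + b\<^sup>2 + 2 * (a * b) * 1"
    using PQ pos by (intro add_strict_left_mono mult_strict_left_mono) auto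
  also have "\<dots> = (a + b)\<^sup>2" by (simp add: power2_eq_square algebra_simps)
  finally have "1 < a + b" using pos by (metis less_eq_real_def add_pos_pos one_power2 power2_less_imp_less)
  then have "(a + b) * (norm d)\<^sup>2 > 1 * (norm d)\<^sup>2" using ne by (intro mult_strict_right_mono) auto
  moreover have "a * (2 * (P \<bullet> d)) \<le> a * (- (norm d)\<^sup>2)" "b * (2 * (Q \<bullet> d)) \<le> b * (- (norm d)\<^sup>2)"
    using le[unfolded unit_add_le_one_iff(1)[OF unit(1)] unit_add_le_one_iff(1)[OF unit(2)]] pos
    by (intro mult_left_mono; simp)+
  ultimately show ?thesis
    unfolding unit_add_le_one_iff[OF unit(3)] inner_add_left inner_scaleR_left
    by (simp add: algebra_simps)
qed

lemma cis_mult_eq_combination: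
  assumes "sin \<theta> \<noteq> 0"
  shows "cis \<psi> * P = (sin (\<theta> - \<psi>) / sin \<theta>) *\<^sub>R P + (sin \<psi> / sin \<theta>) *\<^sub>R (cis \<theta> * P)"
proof -
  have "cis \<psi> = of_real (sin (\<theta> - \<psi>) / sin \<theta>) + of_real (sin \<psi> / sin \<theta>) * cis \<theta>"
    using assms by (simp add: complex_eq_iff sin_diff field_simps)
  then show ?thesis by (simp add: scaleR_conv_of_real algebra_simps)
qed

lemma arc_subset_disc:
  assumes "norm (p - v) = 1" and \<theta>: "0 < \<theta>" "\<theta> < pi" and \<psi>: "0 \<le> \<psi>" "\<psi> \<le> \<theta>"
    and "dist p c \<le> 1" "dist (v + cis \<theta> * (p - v)) c \<le> 1"
  shows "dist (v + cis \<psi> * (p - v)) c \<le> 1"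
proof -
  have s: "0 < sin \<theta>" using \<theta> by (rule sin_gt_zero)
  have "norm ((sin (\<theta> - \<psi>) / sin \<theta>) *\<^sub>R (p - v) + (sin \<psi> / sin \<theta>) *\<^sub>R (cis \<theta> * (p - v)) + (v - c)) \<le> 1"
  proof (rule unit_combination_add_le_one)
    show "norm ((sin (\<theta> - \<psi>) / sin \<theta>) *\<^sub>R (p - v) + (sin \<psi> / sin \<theta>) *\<^sub>R (cis \<theta> * (p - v))) = 1"
      using s assms by (simp add: cis_mult_eq_combination[symmetric] norm_mult)
    show "norm (cis \<theta> * (p - v)) = 1" using assms(1) by (simp add: norm_mult)
    show "norm (p - v + (v - c)) \<le> 1" using assms by (simp add: dist_norm)
    show "norm (cis \<theta> * (p - v) + (v - c)) \<le> 1"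
    proof -
      have "cis \<theta> * (p - v) + (v - c) = v + cis \<theta> * (p - v) - c" by simp
      then show ?thesis using assms(7) by (metis dist_norm)
    qed
  qed (use assms s in \<open>auto intro!: divide_nonneg_pos sin_ge_zero\<close>)
  moreover have "sin \<theta> \<noteq> 0" using s by simp
  ultimately have "norm (cis \<psi> * (p - v) + (v - c)) \<le> 1"
    by (metis cis_mult_eq_combination)
  moreover have "cis \<psi> * (p - v) + (v - c) = v + cis \<psi> * (p - v) - c" by simp
  ultimately show ?thesis by (metis dist_norm)
qed

text \<open>In the frame of \<open>P\<close>, with \<open>u = x * P\<close>, the disc condition
  reads \<open>Re x \<le> cos \<psi> * Re x + sin \<psi> * Im x\<close>. As \<open>0 < Re x\<close>,
  the sine term cannot be negative: from \<open>P\<close> the circle enters the disc only on the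
  side of its centre \<open>u\<close>.\<close>

lemma unit_circle_inter_disc_sin:
  assumes P: "norm P = 1" "norm (P - u) = 1" and u: "u \<noteq> 0"
    and e: "norm (cis \<psi> * P - u) \<le> 1"
  shows "0 \<le> sin \<psi> * Im (cnj P * u)"
proof -
  define x where "x = cnj P * u"
  have "cnj P * P = 1" using P complex_norm_square[of P] by (simp add: mult.commute)
  then have x: "u = x * P" by (simp add: x_def mult_ac)
  have in1: "P \<bullet> u = Re x"
    using inner_mult_unit[OF P(1), of 1 x] unfolding x by (simp add: inner_complex_def)
  have in2: "(cis \<psi> * P) \<bullet> u = cos \<psi> * Re x + sin \<psi> * Im x"
    using inner_mult_unit[OF P(1), of "cis \<psi>" x] unfolding x by (simp add: inner_complex_def)
  have "(norm (P - u))\<^sup>2 = 1" using P by simp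
  then have "2 * Re x = (norm u)\<^sup>2" unfolding norm_diff_squared using P(1) by (simp add: in1)
  then have "0 < Re x" using u by (smt (verit) zero_less_norm_iff zero_less_power)
  have "(norm (cis \<psi> * P - u))\<^sup>2 \<le> 1" using e by (simp add: power_le_one_iff)
  then have "Re x \<le> cos \<psi> * Re x + sin \<psi> * Im x"
    using P \<open>2 * Re x = (norm u)\<^sup>2\<close> by (simp add: norm_diff_squared in2 norm_mult)
  moreover have "cos \<psi> * Re x \<le> 1 * Re x"
    using \<open>0 < Re x\<close> by (intro mult_right_mono) auto
  ultimately show ?thesis by (simp add: x_def)
qed

text \<open>The disc \<open>j1\<close> ends the arc at \<open>p\<close> and forces
  \<open>0 \<le> sin \<psi>\<close>; the disc \<open>j2\<close> ends it at \<open>q\<close> and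
  forces \<open>sin (\<psi> - \<theta>) \<le> 0\<close>. Within one period these leave the angles up
  to \<open>\<theta>\<close>; the remaining discs contain this arc because they contain its
  ends.\<close>

lemma circle_inter_discs_eq_arc:
  fixes c :: "'i \<Rightarrow> complex"
  assumes p: "norm (p - v) = 1" and q: "q = v + cis \<theta> * (p - v)" and \<theta>: "0 < \<theta>" "\<theta> < pi"
    and within: "\<And>j. j \<in> J \<Longrightarrow> dist p (c j) \<le> 1" "\<And>j. j \<in> J \<Longrightarrow> dist q (c j) \<le> 1"
    and j1: "j1 \<in> J" "dist p (c j1) = 1" "0 < orientation v p (c j1)"
    and j2: "j2 \<in> J" "dist q (c j2) = 1" "0 < orientation v (c j2) q"
    and \<psi>: "0 \<le> \<psi>" "\<psi> < 2 * pi"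
  shows "v + cis \<psi> * (p - v) \<in> (\<Inter>j\<in>J. cball (c j) 1) \<longleftrightarrow> \<psi> \<le> \<theta>"
proof
  assume "\<psi> \<le> \<theta>"
  then show "v + cis \<psi> * (p - v) \<in> (\<Inter>j\<in>J. cball (c j) 1)"
    using arc_subset_disc[OF p \<theta> \<psi>(1) _ within(1) within(2)[unfolded q]]
    by (auto simp: dist_commute)
next
  assume e: "v + cis \<psi> * (p - v) \<in> (\<Inter>j\<in>J. cball (c j) 1)"
  have Q: "norm (q - v) = 1" using p by (simp add: q norm_mult)
  have "0 \<le> sin \<psi> * Im (cnj (p - v) * (c j1 - v))"
  proof (rule unit_circle_inter_disc_sin[OF p])
    show "c j1 - v \<noteq> 0" using j1 by (auto simp: orientation_def)
    show "norm (p - v - (c j1 - v)) = 1" using j1 by (simp add: dist_norm)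
    show "norm (cis \<psi> * (p - v) - (c j1 - v)) \<le> 1"
      using e j1(1) by (auto simp: dist_norm norm_minus_commute algebra_simps)
  qed
  then have s1: "0 \<le> sin \<psi>" using j1(3) by (simp add: orientation_def zero_le_mult_iff)
  have e': "cis (\<psi> - \<theta>) * (q - v) = cis \<psi> * (p - v)"
    by (simp add: q mult.assoc[symmetric] cis_mult)
  have "0 \<le> sin (\<psi> - \<theta>) * Im (cnj (q - v) * (c j2 - v))"
  proof (rule unit_circle_inter_disc_sin[OF Q])
    show "c j2 - v \<noteq> 0" using j2 by (auto simp: orientation_def)
    show "norm (q - v - (c j2 - v)) = 1" using j2 by (simp add: dist_norm)
    show "norm (cis (\<psi> - \<theta>) * (q - v) - (c j2 - v)) \<le> 1"
      unfolding e' using e j2(1) by (auto simp: dist_norm norm_minus_commute algebra_simps)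
  qed
  moreover have "Im (cnj (q - v) * (c j2 - v)) < 0"
    using j2(3) by (simp add: orientation_def algebra_simps)
  ultimately have s2: "sin (\<psi> - \<theta>) \<le> 0" by (simp add: zero_le_mult_iff)
  have "\<psi> \<le> pi" using s1 \<psi> sin_lt_zero[of \<psi>] by fastforce
  then show "\<psi> \<le> \<theta>" using s2 \<theta> \<psi> sin_gt_zero[of "\<psi> - \<theta>"] by fastforce
qed

lemma interval_integral_initial_segment:
  fixes h :: "real \<Rightarrow> 'b::{banach,second_countable_topology}"
  assumes meas: "(\<lambda>\<phi>. indicat_real A \<phi> *\<^sub>R h \<phi>) \<in> borel_measurable borel"
    and bd: "\<And>\<phi>. norm (h \<phi>) \<le> 1"
    and le: "a \<le> b" "b \<le> d" and A: "\<And>\<phi>. a \<le> \<phi> \<Longrightarrow> \<phi> < d \<Longrightarrow> \<phi> \<in> A \<longleftrightarrow> \<phi> \<le> b"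
  shows "(LBINT \<phi>=ereal a..ereal d. indicat_real A \<phi> *\<^sub>R h \<phi>) = (LBINT \<phi>=ereal a..ereal b. h \<phi>)"
proof -
  have "norm (indicat_real A \<phi> *\<^sub>R h \<phi>) \<le> 1" for \<phi>
    using bd by (auto simp: indicator_def)
  from interval_integral_sum_bounded[OF meas this, of a b d]
  have "(LBINT \<phi>=ereal a..ereal d. indicat_real A \<phi> *\<^sub>R h \<phi>)
      = (LBINT \<phi>=ereal a..ereal b. indicat_real A \<phi> *\<^sub>R h \<phi>)
      + (LBINT \<phi>=ereal b..ereal d. indicat_real A \<phi> *\<^sub>R h \<phi>)" by simp
  also have "(LBINT \<phi>=ereal a..ereal b. indicat_real A \<phi> *\<^sub>R h \<phi>) = (LBINT \<phi>=ereal a..ereal b. h \<phi>)"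
    by (rule interval_integral_cong) (use le A in \<open>auto simp: einterval_def min_def max_def\<close>)
  also have "(LBINT \<phi>=ereal b..ereal d. indicat_real A \<phi> *\<^sub>R h \<phi>) = (LBINT \<phi>=ereal b..ereal d. 0)"
    by (rule interval_integral_cong)
       (use le A in \<open>auto simp: einterval_def min_def max_def indicator_def split: if_splits\<close>)
  finally show ?thesis by simp
qed

lemma interval_integral_cis:
  "(LBINT \<phi>=ereal a..ereal b. cis \<phi>) = - \<i> * (cis b - cis a)"
proof -
  have "((\<lambda>\<phi>. - \<i> * cis \<phi>) has_vector_derivative cis x) (at x within S)" for x S
    by (auto simp: has_vector_derivative_complex_iff cis.code cis.ctr
        intro!: derivative_eq_intros simp flip: has_real_derivative_iff_has_vector_derivative)
  then have "(LBINT \<phi>=ereal a..ereal b. cis \<phi>) = (- \<i> * cis b) - (- \<i> * cis a)"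
    by (intro interval_integral_FTC_finite) (auto intro!: continuous_intros)
  then show ?thesis by (simp add: algebra_simps)
qed

lemma unit_eq_cis:
  assumes "norm (z :: complex) = 1"
  obtains \<alpha> where "z = cis \<alpha>"
  using assms by (metis cis_Arg norm_zero sgn_div_norm div_by_1 scaleR_one inverse_1 zero_neq_one)

lemma
  fixes K :: "complex set"
  assumes K: "K \<in> sets borel" and P: "norm P = 1" and \<theta>: "0 < \<theta>" "\<theta> < pi"
    and arc: "\<And>\<psi>. 0 \<le> \<psi> \<Longrightarrow> \<psi> < 2 * pi \<Longrightarrow> v + cis \<psi> * P \<in> K \<longleftrightarrow> \<psi> \<le> \<theta>"
  shows circle_flux_arc: "circle_flux K v = - \<i> * (cis \<theta> * P - P)"
    and measure_angles_arc: "measure lebesgue {\<phi> \<in> {0..<2 * pi}. v + cis \<phi> \<in> K} = \<theta>"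
proof -
  \<comment> \<open>Angles are counted from the argument of \<open>P\<close>. By periodicity the
    integration may start there, and then the arc is an initial segment of the window.\<close>
  obtain \<alpha> where \<alpha>: "P = cis \<alpha>" using unit_eq_cis[OF P] .
  define A where "A = {\<phi>. v + cis \<phi> \<in> K}"
  have A [measurable]: "A \<in> sets borel"
    unfolding A_def using K by measurable
  have A_iff: "\<phi> \<in> A \<longleftrightarrow> \<phi> \<le> \<alpha> + \<theta>" if "\<alpha> \<le> \<phi>" "\<phi> < \<alpha> + 2 * pi" for \<phi>
    using arc[of "\<phi> - \<alpha>"] that by (simp add: A_def \<alpha> cis_mult) linarith
  have ind: "indicat_real K (v + cis \<phi>) = indicat_real A \<phi>" for \<phi> by (simp add: A_def indicator_def)
  have "circle_flux K v = (LBINT \<phi>=ereal \<alpha>..ereal (\<alpha> + \<theta>). cis \<phi>)"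
    unfolding circle_flux_window[OF K, of v \<alpha>] ind
    by (rule interval_integral_initial_segment) (use \<theta> A_iff in auto)
  then show "circle_flux K v = - \<i> * (cis \<theta> * P - P)"
    by (simp add: interval_integral_cis \<alpha> cis_mult add.commute)
  have "measure lebesgue {\<phi> \<in> {0..<2 * pi}. v + cis \<phi> \<in> K} = measure lborel ({0..<2 * pi} \<inter> A)"
  proof -
    have "{\<phi> \<in> {0..<2 * pi}. v + cis \<phi> \<in> K} = {0..<2 * pi} \<inter> A" by (auto simp: A_def)
    then show ?thesis by simp
  qed
  also have "\<dots> = (LBINT \<phi>=ereal 0..ereal (2 * pi). indicat_real A \<phi> *\<^sub>R 1)"
    by (subst interval_integral_Ico) (auto simp: set_lebesgue_integral_def indicator_inter_arith[symmetric])
  also have "\<dots> = (LBINT \<phi>=ereal \<alpha>..ereal (\<alpha> + 2 * pi). indicat_real A \<phi> *\<^sub>R 1)"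
  proof (rule interval_integral_periodic[where B = 1, symmetric])
    show "(\<lambda>\<phi>. indicat_real A \<phi> *\<^sub>R (1::real)) \<in> borel_measurable borel" by measurable
  qed (auto simp: indicator_def A_def cis_mult[symmetric])
  also have "\<dots> = (LBINT \<phi>=ereal \<alpha>..ereal (\<alpha> + \<theta>). 1)"
    by (rule interval_integral_initial_segment) (use \<theta> A_iff in auto)
  also have "\<dots> = \<theta>" using \<theta> by simp
  finally show "measure lebesgue {\<phi> \<in> {0..<2 * pi}. v + cis \<phi> \<in> K} = \<theta>" .
qed


subsection \<open>Vertices of Reuleaux polygons\<close>

lemma constant_width_dist_le:
  assumes R: "constant_width_shape R" and p: "p \<in> R" and q: "q \<in> R"
  shows "dist p q \<le> 1"
proof (cases "p = q")
  case False
  define u where "u = sgn (p - q)"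
  have u: "norm u = 1" using False by (simp add: u_def norm_sgn)
  have "compact ((\<lambda>y. y \<bullet> u) ` R)"
    using R by (auto simp: constant_width_shape_def intro!: compact_continuous_image continuous_intros)
  then have bd: "bdd_above ((\<lambda>y. y \<bullet> u) ` R)" "bdd_below ((\<lambda>y. y \<bullet> u) ` R)"
    by (auto intro: bounded_imp_bdd_above bounded_imp_bdd_below compact_imp_bounded)
  have "p \<bullet> u - q \<bullet> u \<le> width R u"
    unfolding width_def by (intro diff_mono cSUP_upper cINF_lower bd p q)
  moreover have "(p - q) \<bullet> u = norm (p - q)"
    using False by (simp add: u_def sgn_div_norm power2_norm_eq_inner[symmetric] power2_eq_square)
  then have "p \<bullet> u - q \<bullet> u = dist p q" by (simp add: inner_diff_left dist_norm)
  ultimately show ?thesis using R u by (simp add: constant_width_shape_def)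
qed simp

text \<open>A point \<open>q\<close> of \<open>R\<close> lowest in direction \<open>u\<close>
  satisfies \<open>(p - q) \<bullet> u = 1\<close>, while \<open>norm (p - q)\<close> is at most 1.
  Equality in Cauchy-Schwarz gives \<open>p - q = u\<close>.\<close>

lemma constant_width_antipode:
  assumes R: "constant_width_shape R" and p: "p \<in> R" and u: "outer_unit_normal R p u"
  shows "p - u \<in> R"
proof -
  have "compact R" "R \<noteq> {}" using R by (auto simp: constant_width_shape_def)
  moreover have "continuous_on R (\<lambda>y. y \<bullet> u)" by (intro continuous_intros)
  ultimately obtain q where q: "q \<in> R" "\<And>y. y \<in> R \<Longrightarrow> q \<bullet> u \<le> y \<bullet> u"
    using continuous_attains_inf[of R "\<lambda>y. y \<bullet> u"] by blast
  have nu: "norm u = 1" and pu: "\<And>y. y \<in> R \<Longrightarrow> y \<bullet> u \<le> p \<bullet> u"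
    using u by (auto simp: outer_unit_normal_def inner_diff_left)
  have "(SUP y\<in>R. y \<bullet> u) = p \<bullet> u" using p pu by (intro cSup_eq_maximum) auto
  moreover have "(INF y\<in>R. y \<bullet> u) = q \<bullet> u" using q by (intro cInf_eq_minimum) auto
  ultimately have "p \<bullet> u - q \<bullet> u = 1"
    using R nu by (auto simp: constant_width_shape_def width_def)
  moreover have "(norm (p - q))\<^sup>2 \<le> 1"
    using constant_width_dist_le[OF R p q(1)] by (simp add: dist_norm power_le_one_iff)
  ultimately have "(norm (p - q - u))\<^sup>2 \<le> 0"
    using nu by (simp add: norm_diff_squared[of "p - q" u] inner_diff_left)
  then show ?thesis using q(1) by (simp add: algebra_simps)
qed

lemma outer_unit_normal_contact:
  assumes "R \<subseteq> cball a 1" "dist p a = 1"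
  shows "outer_unit_normal R p (p - a)"
  unfolding outer_unit_normal_def
proof (intro conjI ballI)
  show np: "norm (p - a) = 1" using assms by (simp add: dist_norm)
  fix y assume "y \<in> R"
  then have "norm (y - a) \<le> 1" using assms by (auto simp: dist_norm norm_minus_commute)
  then have "(y - a) \<bullet> (p - a) \<le> 1"
    using norm_cauchy_schwarz[of "y - a" "p - a"] np by simp
  moreover have "(y - p) \<bullet> (p - a) = (y - a) \<bullet> (p - a) - (norm (p - a))\<^sup>2"
    by (simp add: power2_norm_eq_inner inner_diff_left inner_diff_right)
  ultimately show "(y - p) \<bullet> (p - a) \<le> 0" using np by simp
qed

text \<open>Outer normals \<open>u\<close> at \<open>p\<close> correspond to points
  \<open>p - u\<close> of \<open>R\<close> at distance 1: antipodes give one direction, contact with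
  a disc containing \<open>R\<close> the other. Angular points thus become a matter of
  distances.\<close>

lemma vertices_constant_width_iff:
  assumes R: "constant_width_shape R"
  shows "p \<in> vertices R \<longleftrightarrow> p \<in> R \<and> (\<exists>a\<in>R. \<exists>b\<in>R. a \<noteq> b \<and> dist p a = 1 \<and> dist p b = 1)"
proof
  assume p: "p \<in> vertices R"
  have "closed R" using R by (auto simp: constant_width_shape_def compact_imp_closed)
  then have "frontier R \<subseteq> R" by (rule frontier_subset_closed)
  with p obtain u w where pR: "p \<in> R" and uw: "u \<noteq> w" "outer_unit_normal R p u" "outer_unit_normal R p w"
    by (auto simp: vertices_def)
  have "p - u \<in> R" "p - w \<in> R" using constant_width_antipode[OF R pR] uw by auto
  moreover have "dist p (p - u) = 1" "dist p (p - w) = 1"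
    using uw by (auto simp: outer_unit_normal_def dist_norm)
  ultimately show "p \<in> R \<and> (\<exists>a\<in>R. \<exists>b\<in>R. a \<noteq> b \<and> dist p a = 1 \<and> dist p b = 1)"
    using pR uw(1) by (metis diff_diff_eq2 add_diff_cancel_left')
next
  assume "p \<in> R \<and> (\<exists>a\<in>R. \<exists>b\<in>R. a \<noteq> b \<and> dist p a = 1 \<and> dist p b = 1)"
  then obtain a b where p: "p \<in> R" and ab: "a \<in> R" "b \<in> R" "a \<noteq> b" "dist p a = 1" "dist p b = 1"
    by blast
  have sub: "R \<subseteq> cball y 1" if "y \<in> R" for y
    using constant_width_dist_le[OF R that] by auto
  have "interior R \<subseteq> ball a 1" using interior_mono[OF sub[OF ab(1)]] by simp
  then have "p \<in> frontier R"
    using p ab(4) closure_subset by (fastforce simp: frontier_def dist_commute)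
  moreover have "p - a \<noteq> p - b" using ab(3) by simp
  ultimately show "p \<in> vertices R"
    using outer_unit_normal_contact[OF sub[OF ab(1)] ab(4)]
      outer_unit_normal_contact[OF sub[OF ab(2)] ab(5)]
    unfolding vertices_def by blast
qed

text \<open>The vectors \<open>v - p\<close> and \<open>v - q\<close> are outer normals at
  \<open>v\<close>, and so are the unit vectors in the cone that they span. Their antipodes are the
  points of the arc.\<close>

lemma constant_width_arc:
  assumes R: "constant_width_shape R" and v: "v \<in> R" and pq: "p \<in> R" "q \<in> R" "dist v p = 1" "dist v q = 1"
    and ab: "0 \<le> a" "0 \<le> b" and unit: "norm (a *\<^sub>R (p - v) + b *\<^sub>R (q - v)) = 1"
  shows "v + (a *\<^sub>R (p - v) + b *\<^sub>R (q - v)) \<in> R"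
proof -
  have sub: "R \<subseteq> cball y 1" if "y \<in> R" for y
    using constant_width_dist_le[OF R that] by auto
  let ?E = "a *\<^sub>R (p - v) + b *\<^sub>R (q - v)"
  have "outer_unit_normal R v (- ?E)"
    unfolding outer_unit_normal_def
  proof (intro conjI ballI)
    fix y assume y: "y \<in> R"
    have "(y - v) \<bullet> (v - p) \<le> 0" "(y - v) \<bullet> (v - q) \<le> 0"
      using outer_unit_normal_contact[OF sub[OF pq(1)] pq(3)] y
        outer_unit_normal_contact[OF sub[OF pq(2)] pq(4)] by (auto simp: outer_unit_normal_def)
    then have "a * ((y - v) \<bullet> (v - p)) + b * ((y - v) \<bullet> (v - q)) \<le> 0"
      using ab by (simp add: add_nonpos_nonpos mult_nonneg_nonpos)
    then show "(y - v) \<bullet> (- ?E) \<le> 0"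
      by (simp add: inner_diff_right inner_add_right inner_minus_right algebra_simps)
  qed (use unit in \<open>simp only: norm_minus_cancel\<close>)
  from constant_width_antipode[OF R v this] show ?thesis by (simp only: diff_minus_eq_add)
qed

text \<open>The middle \<open>y\<close> of the arc opposite to \<open>v\<close> must lie on the
  circle around some centre \<open>c\<close>. If \<open>c\<close> were not \<open>v\<close>, the
  disc around \<open>c\<close> would contain both ends of the arc and therefore \<open>y\<close> in
  its interior.\<close>

lemma vertices_subset_centres:
  assumes R: "constant_width_shape R" and C: "finite C" "R = (\<Inter>c\<in>C. cball c 1)"
  shows "vertices R \<subseteq> C"
proof
  fix v assume "v \<in> vertices R"
  then obtain p q where v: "v \<in> R" and pq: "p \<in> R" "q \<in> R" "p \<noteq> q" "dist v p = 1" "dist v q = 1"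
    by (auto simp: vertices_constant_width_iff[OF R])
  define P Q where "P = p - v" and "Q = q - v"
  have PQ: "norm P = 1" "norm Q = 1" "P \<noteq> Q"
    using pq by (auto simp: P_def Q_def dist_norm norm_minus_commute)
  \<comment> \<open>Antipodal directions would put \<open>p\<close> and \<open>q\<close> at distance
    2, more than the diameter of \<open>R\<close>.\<close>
  have "P + Q \<noteq> 0"
  proof
    assume "P + Q = 0"
    then have "Q = - P" by (simp add: add_eq_0_iff)
    then have "norm (P - Q) = norm (2 * P)" by simp
    then have "norm (P - Q) = 2" using PQ(1) by (simp add: norm_mult)
    moreover have "norm (P - Q) \<le> 1"
      using constant_width_dist_le[OF R pq(1,2)] by (simp add: P_def Q_def dist_norm)
    ultimately show False by simp
  qed
  define r where "r = 1 / norm (P + Q)"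
  have r: "0 < r" using \<open>P + Q \<noteq> 0\<close> by (simp add: r_def)
  have E: "norm (r *\<^sub>R P + r *\<^sub>R Q) = 1"
    using \<open>P + Q \<noteq> 0\<close> unfolding scaleR_add_right[symmetric] by (simp add: r_def)
  define y where "y = v + (r *\<^sub>R P + r *\<^sub>R Q)"
  have y: "y \<in> R"
    unfolding y_def P_def Q_def
    by (rule constant_width_arc[OF R v]) (use pq r E in \<open>auto simp: P_def Q_def\<close>)
  have "\<exists>c\<in>C. dist y c = 1"
  proof (rule ccontr)
    assume "\<not> (\<exists>c\<in>C. dist y c = 1)"
    \<comment> \<open>Strictly inside all discs, \<open>y\<close> could be pushed away from
      \<open>v\<close> without leaving \<open>R\<close>, to a distance above 1 from
      \<open>v\<close>.\<close>
    then have "y \<in> (\<Inter>c\<in>C. ball c 1)"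
      using y unfolding C(2) by (force simp: dist_commute order_le_less)
    moreover have "open (\<Inter>c\<in>C. ball c 1)" using C(1) by (intro open_INT) auto
    ultimately obtain e where e: "0 < e" "ball y e \<subseteq> (\<Inter>c\<in>C. ball c 1)"
      by (meson open_contains_ball)
    define z where "z = y + (e / 2) *\<^sub>R (r *\<^sub>R P + r *\<^sub>R Q)"
    have "z \<in> ball y e" using e E by (simp add: z_def dist_norm)
    then have "z \<in> R" using e(2) unfolding C(2) by (auto simp: less_imp_le)
    moreover have "z - v = (1 + e / 2) *\<^sub>R (r *\<^sub>R P + r *\<^sub>R Q)"
      unfolding z_def y_def scaleR_left_distrib by simp
    then have "norm (z - v) = 1 + e / 2" using E e(1) by (simp only: norm_scaleR, simp)
    ultimately show False using constant_width_dist_le[OF R _ v] e(1) by (force simp: dist_norm)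
  qed
  then obtain c where c: "c \<in> C" "dist y c = 1" by blast
  have "v = c"
  proof (rule ccontr)
    assume "v \<noteq> c"
    have "norm (r *\<^sub>R P + r *\<^sub>R Q + (v - c)) < 1"
    proof (rule unit_combination_add_less_one[OF PQ(1,2) E r r PQ(3)])
      show "norm (P + (v - c)) \<le> 1" "norm (Q + (v - c)) \<le> 1"
        using pq(1,2) c(1) unfolding C(2) by (auto simp: P_def Q_def dist_norm norm_minus_commute)
    qed (use \<open>v \<noteq> c\<close> in simp)
    moreover have "r *\<^sub>R P + r *\<^sub>R Q + (v - c) = y - c" by (simp add: y_def)
    ultimately show False using c(2) by (simp add: dist_norm)
  qed
  with c show "v \<in> C" by simp
qed

lemma constant_width_off_line:
  assumes R: "constant_width_shape R" and "norm u = 1"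
  shows "\<exists>z\<in>R. (z - y) \<bullet> u \<noteq> 0"
proof (rule ccontr)
  assume "\<not> (\<exists>z\<in>R. (z - y) \<bullet> u \<noteq> 0)"
  then have "(\<lambda>z. z \<bullet> u) ` R = (\<lambda>z. y \<bullet> u) ` R"
    by (intro image_cong) (auto simp: inner_diff_left)
  moreover have "R \<noteq> {}" using R by (simp add: constant_width_shape_def)
  ultimately have "width R u = 0" by (simp add: width_def)
  then show False using assms by (simp add: constant_width_shape_def)
qed

text \<open>Removing the disc around \<open>c\<close> adds a point \<open>y\<close>. The segments from \<open>y\<close> to two points of \<open>R\<close> not collinear
  with \<open>y\<close> leave the disc at two different contact points of \<open>c\<close>.\<close>

lemma essential_centre_is_vertex:
  assumes R: "constant_width_shape R" and C: "finite C" "R = (\<Inter>c\<in>C. cball c 1)"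
    and c: "c \<in> C" "(\<Inter>c\<in>C - {c}. cball c 1) \<noteq> R"
  shows "c \<in> vertices R"
proof -
  define K where "K = (\<Inter>c\<in>C - {c}. cball c 1)"
  have RK: "R = K \<inter> cball c 1" using c(1) by (auto simp: C(2) K_def)
  moreover have "K \<noteq> R" using c(2) by (simp add: K_def)
  ultimately obtain y where y: "y \<in> K" "y \<notin> cball c 1" by blast
  have "convex K" unfolding K_def by (intro convex_INT) auto
  have contact: "\<exists>s. 0 \<le> s \<and> s < 1 \<and> z + s *\<^sub>R (y - z) \<in> R \<and> dist (z + s *\<^sub>R (y - z)) c = 1"
    if z: "z \<in> R" for z
  proof -
    have "\<exists>s\<ge>0. s \<le> 1 \<and> dist (z + s *\<^sub>R (y - z)) c = 1"
      using z y by (intro IVT') (auto simp: RK dist_commute intro!: continuous_intros)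
    then obtain s where s: "0 \<le> s" "s \<le> 1" "dist (z + s *\<^sub>R (y - z)) c = 1" by blast
    have "s \<noteq> 1" using s(3) y by (auto simp: dist_commute)
    moreover have "z + s *\<^sub>R (y - z) = (1 - s) *\<^sub>R z + s *\<^sub>R y" by (simp add: algebra_simps)
    then have "z + s *\<^sub>R (y - z) \<in> K"
      using z y s \<open>convex K\<close> by (auto simp: RK convex_alt)
    ultimately show ?thesis using s by (auto simp: RK dist_commute intro!: exI[of _ s])
  qed
  obtain z1 where z1: "z1 \<in> R" using R by (auto simp: constant_width_shape_def)
  have "z1 \<noteq> y" using z1 y by (auto simp: RK)
  define u where "u = \<i> * sgn (z1 - y)"
  have "norm u = 1" using \<open>z1 \<noteq> y\<close> by (simp add: u_def norm_mult norm_sgn)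
  then obtain z2 where z2: "z2 \<in> R" "(z2 - y) \<bullet> u \<noteq> 0"
    using constant_width_off_line[OF R] by blast
  have z1u: "(z1 - y) \<bullet> u = 0" by (simp add: u_def inner_complex_def sgn_div_norm algebra_simps)
  obtain s where s: "s < 1" "z1 + s *\<^sub>R (y - z1) \<in> R" "dist (z1 + s *\<^sub>R (y - z1)) c = 1"
    using contact[OF z1] by blast
  obtain t where t: "t < 1" "z2 + t *\<^sub>R (y - z2) \<in> R" "dist (z2 + t *\<^sub>R (y - z2)) c = 1"
    using contact[OF z2(1)] by blast
  have ne: "z1 + s *\<^sub>R (y - z1) \<noteq> z2 + t *\<^sub>R (y - z2)"
  proof
    assume eq: "z1 + s *\<^sub>R (y - z1) = z2 + t *\<^sub>R (y - z2)"
    have "z + s *\<^sub>R (y - z) - y = (1 - s) *\<^sub>R (z - y)" for z s by (simp add: algebra_simps)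
    then have "(1 - s) *\<^sub>R (z1 - y) = (1 - t) *\<^sub>R (z2 - y)" using eq by metis
    then have "(1 - s) * ((z1 - y) \<bullet> u) = (1 - t) * ((z2 - y) \<bullet> u)"
      by (metis inner_scaleR_left)
    then show False using z1u z2 t(1) by simp
  qed
  \<comment> \<open>The normal at a contact point is the vector from \<open>c\<close> to it, so the
    antipode of the contact point is \<open>c\<close> itself.\<close>
  have "R \<subseteq> cball c 1" using RK by auto
  from outer_unit_normal_contact[OF this s(3)] have "c \<in> R"
    using constant_width_antipode[OF R s(2)] by fastforce
  then show ?thesis
    unfolding vertices_constant_width_iff[OF R]
    using s(2,3) t(2,3) ne dist_commute by metis
qed

text \<open>In a family with the least number of discs every centre is essential, hence a vertex.
  Conversely all vertices occur among the centres of any finite family.\<close>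

lemma reuleaux_polygon_eq_Inter_vertices:
  assumes "reuleaux_polygon R"
  shows "finite (vertices R)" "R = (\<Inter>c\<in>vertices R. cball c 1)"
proof -
  have R: "constant_width_shape R" using assms by (simp add: reuleaux_polygon_def)
  define rep where "rep n \<longleftrightarrow> (\<exists>C. finite C \<and> card C = n \<and> R = (\<Inter>c\<in>C. cball c 1))" for n
  have "\<exists>n. rep n" using assms by (auto simp: reuleaux_polygon_def rep_def)
  then obtain C where C: "finite C" "card C = (LEAST n. rep n)" "R = (\<Inter>c\<in>C. cball c 1)"
    using LeastI_ex[of rep] unfolding rep_def by blast
  have "C \<subseteq> vertices R"
  proof
    fix c assume c: "c \<in> C"
    have "(\<Inter>c\<in>C - {c}. cball c 1) \<noteq> R"
    proof
      assume "(\<Inter>c\<in>C - {c}. cball c 1) = R"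
      then have "rep (card (C - {c}))" using C(1) unfolding rep_def by blast
      then have "card C \<le> card (C - {c})" unfolding C(2) by (rule Least_le)
      then show False using c C(1) card_Diff1_less by fastforce
    qed
    then show "c \<in> vertices R" by (rule essential_centre_is_vertex[OF R C(1,3) c])
  qed
  then have "vertices R = C" using vertices_subset_centres[OF R C(1,3)] by blast
  then show "finite (vertices R)" "R = (\<Inter>c\<in>vertices R. cball c 1)" using C by auto
qed


section \<open>Every vertex has exactly two vertices at distance 1\<close>

lemma complex_eq_combination:
  fixes P Q W :: complex
  assumes unit: "norm P = 1" "norm Q = 1" "\<bar>P \<bullet> Q\<bar> < 1"
  shows "W = ((W \<bullet> P - (P \<bullet> Q) * (W \<bullet> Q)) / (1 - (P \<bullet> Q)\<^sup>2)) *\<^sub>R P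
           + ((W \<bullet> Q - (P \<bullet> Q) * (W \<bullet> P)) / (1 - (P \<bullet> Q)\<^sup>2)) *\<^sub>R Q"
proof -
  have P: "(Re P)\<^sup>2 + (Im P)\<^sup>2 = 1" and Q: "(Re Q)\<^sup>2 + (Im Q)\<^sup>2 = 1"
    using unit by (simp_all add: cmod_power2[symmetric])
  define d where "d = 1 - (P \<bullet> Q)\<^sup>2"
  have d: "d \<noteq> 0" using unit(3) by (simp add: d_def abs_square_less_1 less_imp_neq[THEN not_sym])
  define a b where "a = W \<bullet> P - (P \<bullet> Q) * (W \<bullet> Q)" and "b = W \<bullet> Q - (P \<bullet> Q) * (W \<bullet> P)"
  have "d * Re W = a * Re P + b * Re Q" "d * Im W = a * Im P + b * Im Q"
    using P Q unfolding a_def b_def d_def inner_complex_def by algebra+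
  then have "Re W = (a * Re P + b * Re Q) / d" "Im W = (a * Im P + b * Im Q) / d"
    using d by (simp_all add: eq_divide_eq mult.commute)
  then show ?thesis
    unfolding d_def[symmetric] a_def[symmetric] b_def[symmetric]
    by (simp add: complex_eq_iff add_divide_distrib)
qed

text \<open>The boundary is smooth strictly inside an arc: a second unit disc containing both ends of the arc contains
  its inner points in the interior.\<close>

lemma contact_between_maximal_pair:
  fixes P Q W d :: complex
  assumes unit: "norm P = 1" "norm Q = 1" "norm W = 1" and PQ: "norm (P - Q) \<le> 1" "P \<noteq> Q"
    and far: "norm (W - P) \<le> norm (P - Q)" "norm (W - Q) \<le> norm (P - Q)"
    and W: "W \<noteq> P" "W \<noteq> Q" and d: "d \<noteq> 0" "norm (P + d) \<le> 1" "norm (Q + d) \<le> 1"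
  shows "norm (W + d) < 1"
proof -
  define \<kappa> where "\<kappa> = P \<bullet> Q"
  have "(norm (P - Q))\<^sup>2 \<le> 1" using PQ(1) by (simp add: power_le_one_iff)
  then have \<kappa>: "1 / 2 \<le> \<kappa>" using unit by (simp add: norm_diff_squared \<kappa>_def)
  have "0 < (norm (P - Q))\<^sup>2" using PQ(2) by simp
  then have \<kappa>1: "\<kappa> < 1" using unit by (simp add: norm_diff_squared \<kappa>_def)
  have "(norm (W - P))\<^sup>2 \<le> (norm (P - Q))\<^sup>2" "(norm (W - Q))\<^sup>2 \<le> (norm (P - Q))\<^sup>2"
    using far by (auto intro: power_mono)
  then have ge: "\<kappa> \<le> W \<bullet> P" "\<kappa> \<le> W \<bullet> Q" using unit by (simp_all add: norm_diff_squared \<kappa>_def)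
  have "0 < (norm (W - P))\<^sup>2" "0 < (norm (W - Q))\<^sup>2" using W by auto
  then have lt: "W \<bullet> P < 1" "W \<bullet> Q < 1" using unit by (simp_all add: norm_diff_squared)
  define a b where "a = (W \<bullet> P - \<kappa> * (W \<bullet> Q)) / (1 - \<kappa>\<^sup>2)" and "b = (W \<bullet> Q - \<kappa> * (W \<bullet> P)) / (1 - \<kappa>\<^sup>2)"
  have Weq: "W = a *\<^sub>R P + b *\<^sub>R Q"
    using complex_eq_combination[OF unit(1,2), of W] \<kappa> \<kappa>1 by (simp add: a_def b_def \<kappa>_def)
  \<comment> \<open>The numerators of \<open>a\<close> and \<open>b\<close> are positive:
    \<open>W \<bullet> P\<close> is at least \<open>\<kappa>\<close>, whereas
    \<open>\<kappa> * (W \<bullet> Q)\<close> is strictly below it, and likewise with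
    \<open>P\<close> and \<open>Q\<close> exchanged. So \<open>W\<close> lies strictly between
    \<open>P\<close> and \<open>Q\<close>.\<close>
  have "\<kappa> * (W \<bullet> Q) < \<kappa> * 1" "\<kappa> * (W \<bullet> P) < \<kappa> * 1"
    using lt \<kappa> by (intro mult_strict_left_mono; simp)+
  moreover have "\<kappa>\<^sup>2 < 1" using \<kappa> \<kappa>1 by (simp add: power_less_one_iff)
  ultimately have "0 < a" "0 < b" using ge by (auto simp: a_def b_def)
  then show ?thesis
    using unit_combination_add_less_one[OF unit(1,2) _ _ _ PQ(2) d] unit(3) Weq by metis
qed

text \<open>The sign of \<open>\<beta>\<close> tells on which side of \<open>P\<close> the point
  \<open>Q\<close> lies. Turning to the other side lowers the inner product with \<open>Q\<close>,
  because \<open>\<kappa>\<close> is positive.\<close>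

lemma rotate_away:
  fixes P Q :: complex
  assumes unit: "norm P = 1" "norm Q = 1" and PQ: "norm (P - Q) \<le> 1" "P \<noteq> Q"
  shows "\<exists>\<sigma>. \<forall>s. 0 < s \<and> s < pi \<longrightarrow> norm (P - Q) < norm (cis (\<sigma> * s) * P - Q)"
proof -
  define \<kappa> \<beta> where "\<kappa> = P \<bullet> Q" and "\<beta> = (\<i> * P) \<bullet> Q"
  have "(norm (P - Q))\<^sup>2 \<le> 1" using PQ(1) by (simp add: power_le_one_iff)
  then have \<kappa>: "0 < \<kappa>" using unit by (simp add: norm_diff_squared \<kappa>_def)
  have "0 < (norm (P - Q))\<^sup>2" using PQ(2) by simp
  then have \<kappa>1: "\<kappa> < 1" using unit by (simp add: norm_diff_squared \<kappa>_def)
  have "(Re P)\<^sup>2 + (Im P)\<^sup>2 = 1" "(Re Q)\<^sup>2 + (Im Q)\<^sup>2 = 1"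
    using unit by (simp_all add: cmod_power2[symmetric])
  then have "\<kappa>\<^sup>2 + \<beta>\<^sup>2 = 1" unfolding \<kappa>_def \<beta>_def inner_complex_def by simp algebra
  moreover have "\<kappa>\<^sup>2 < 1" using \<kappa> \<kappa>1 by (simp add: power_less_one_iff)
  ultimately have \<beta>: "\<beta> \<noteq> 0" by auto
  have "norm (P - Q) < norm (cis (- sgn \<beta> * s) * P - Q)" if s: "0 < s" "s < pi" for s
  proof -
    have "(cis (- sgn \<beta> * s) * P) \<bullet> Q = cos (sgn \<beta> * s) * \<kappa> - sin (sgn \<beta> * s) * \<beta>"
      by (simp add: \<kappa>_def \<beta>_def inner_complex_def algebra_simps)
    also have "sin (sgn \<beta> * s) * \<beta> = sin s * \<bar>\<beta>\<bar>" by (cases "0 < \<beta>") (use \<beta> in \<open>auto simp: sgn_if\<close>)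
    also have "cos (sgn \<beta> * s) * \<kappa> - sin s * \<bar>\<beta>\<bar> < 1 * \<kappa>"
      using mult_right_mono[OF cos_le_one[of "sgn \<beta> * s"], of \<kappa>] \<kappa> \<beta> sin_gt_zero[OF s]
      by (smt (verit) mult_pos_pos zero_less_abs_iff)
    finally have "(norm (P - Q))\<^sup>2 < (norm (cis (- sgn \<beta> * s) * P - Q))\<^sup>2"
      unfolding norm_diff_squared norm_mult using unit by (simp add: \<kappa>_def)
    then show ?thesis by (rule power_less_imp_less_base) simp
  qed
  then show ?thesis by blast
qed

text \<open>Take two contact points \<open>p\<close>, \<open>q\<close> of \<open>v\<close> at maximal distance. Each of them touches a second disc, since
  otherwise it could be rotated further away around \<open>v\<close>; hence both are vertices.\<close>

lemma reuleaux_vertex_degree: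
  assumes "reuleaux_polygon R" and v: "v \<in> vertices R"
  shows "card {w \<in> vertices R. dist v w = 1} = 2"
proof -
  have R: "constant_width_shape R" using assms by (simp add: reuleaux_polygon_def)
  note V = reuleaux_polygon_eq_Inter_vertices[OF assms(1)]
  note iff = vertices_constant_width_iff[OF R]
  note diam = constant_width_dist_le[OF R]
  define N where "N = {p \<in> R. dist v p = 1}"
  have vR: "v \<in> R" using v iff by simp
  obtain a0 b0 where ab0: "a0 \<in> N" "b0 \<in> N" "a0 \<noteq> b0" using v unfolding iff N_def by auto
  have "N = R \<inter> sphere v 1" by (auto simp: N_def)
  then have "compact N" using R by (auto simp: constant_width_shape_def intro!: compact_Int)
  then have "compact (N \<times> N)" by (intro compact_Times)
  moreover have "continuous_on (N \<times> N) (\<lambda>z. dist (fst z) (snd z))" by (intro continuous_intros)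
  ultimately obtain z where "z \<in> N \<times> N" "\<forall>y\<in>N \<times> N. dist (fst y) (snd y) \<le> dist (fst z) (snd z)"
    using continuous_attains_sup[of "N \<times> N"] ab0 by blast
  then obtain p q where pN: "p \<in> N" and qN: "q \<in> N"
    and max: "\<And>y y'. y \<in> N \<Longrightarrow> y' \<in> N \<Longrightarrow> dist y y' \<le> dist p q"
    by (cases z) auto
  have pq: "p \<noteq> q" using max[OF ab0(1,2)] ab0(3) by auto
  have endpoint: "p \<in> vertices R" if pq: "p \<in> N" "q \<in> N" "p \<noteq> q"
    and max: "\<And>y. y \<in> N \<Longrightarrow> dist y q \<le> dist p q" for p q
  proof -
    define P Q where "P = p - v" and "Q = q - v"
    have unit: "norm P = 1" "norm Q = 1" using pq by (auto simp: P_def Q_def N_def dist_norm norm_minus_commute)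
    have PQ: "norm (P - Q) \<le> 1" "P \<noteq> Q"
      using pq diam[of p q] by (auto simp: P_def Q_def N_def dist_norm)
    obtain \<sigma> where \<sigma>: "\<And>s. 0 < s \<Longrightarrow> s < pi \<Longrightarrow> norm (P - Q) < norm (cis (\<sigma> * s) * P - Q)"
      using rotate_away[OF unit PQ] by blast
    have "\<exists>c\<in>vertices R - {v}. dist p c = 1"
    proof (rule ccontr)
      assume neg: "\<not> (\<exists>c\<in>vertices R - {v}. dist p c = 1)"
      have "\<forall>\<^sub>F s in at_right 0. \<forall>c\<in>vertices R - {v}. dist (v + cis (\<sigma> * s) * P) c < 1"
      proof (intro eventually_ball_finite ballI)
        show "finite (vertices R - {v})" using V(1) by simp
        fix c assume c: "c \<in> vertices R - {v}"
        have "((\<lambda>s. dist (v + cis (\<sigma> * s) * P) c) \<longlongrightarrow> dist (v + cis (\<sigma> * 0) * P) c) (at_right 0)"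
        proof (rule tendsto_mono[OF at_le[OF subset_UNIV]])
          have "continuous_on UNIV (\<lambda>s. dist (v + cis (\<sigma> * s) * P) c)"
            by (intro continuous_intros)
          then show "((\<lambda>s. dist (v + cis (\<sigma> * s) * P) c) \<longlongrightarrow> dist (v + cis (\<sigma> * 0) * P) c) (at 0)"
            unfolding continuous_on_def by (rule bspec[OF _ UNIV_I])
        qed
        moreover have "dist p c \<le> 1" using diam[of p c] pq(1) c iff by (auto simp: N_def)
        then have "dist (v + cis (\<sigma> * 0) * P) c < 1" using neg c by (force simp: P_def)
        ultimately show "\<forall>\<^sub>F s in at_right 0. dist (v + cis (\<sigma> * s) * P) c < 1"
          by (rule order_tendstoD(2))
      qed
      moreover have "\<forall>\<^sub>F s :: real in at_right 0. s < pi" "\<forall>\<^sub>F s :: real in at_right 0. 0 < s"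
        by (auto simp: eventually_at_right_field intro!: exI[of _ pi])
      ultimately have "\<forall>\<^sub>F s in at_right 0.
          (\<forall>c\<in>vertices R - {v}. dist (v + cis (\<sigma> * s) * P) c < 1) \<and> s < pi \<and> 0 < s"
        by (intro eventually_conj)
      then obtain s where s: "\<forall>c\<in>vertices R - {v}. dist (v + cis (\<sigma> * s) * P) c < 1" "s < pi" "0 < s"
        using eventually_happens'[OF trivial_limit_at_right_real] by blast
      define y where "y = v + cis (\<sigma> * s) * P"
      have yv: "dist y v = 1" using unit by (simp add: y_def dist_norm norm_mult)
      then have "y \<in> (\<Inter>c\<in>vertices R. cball c 1)"
        using s(1) unfolding y_def[symmetric] by (force simp: dist_commute)
      then have "y \<in> N" using V(2) yv by (simp add: N_def dist_commute)
      then have "dist y q \<le> dist p q" by (rule max)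
      moreover have "dist y q = norm (cis (\<sigma> * s) * P - Q)" "dist p q = norm (P - Q)"
        by (simp_all add: y_def P_def Q_def dist_norm algebra_simps)
      ultimately show False using \<sigma>[OF s(3,2)] by linarith
    qed
    then obtain c where "c \<in> vertices R" "c \<noteq> v" "dist p c = 1" by blast
    moreover from this have "c \<in> R" using iff by blast
    moreover have "p \<in> R" "dist p v = 1" using pq(1) by (auto simp: N_def dist_commute)
    ultimately show ?thesis unfolding iff using vR by blast
  qed
  have pV: "p \<in> vertices R" by (rule endpoint[OF pN qN pq max[OF _ qN]])
  have qV: "q \<in> vertices R"
    by (rule endpoint[OF qN pN]) (use pq max[OF _ pN] in \<open>auto simp: dist_commute\<close>)
  have only: "w = p \<or> w = q" if w: "w \<in> vertices R" "dist v w = 1" for w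
  proof (rule ccontr)
    assume neq: "\<not> (w = p \<or> w = q)"
    \<comment> \<open>A third contact point \<open>w\<close> would lie strictly between
      \<open>p\<close> and \<open>q\<close>. As a vertex it touches a second disc, around
      \<open>v'\<close>; but that disc contains \<open>p\<close> and \<open>q\<close> and so has
      \<open>w\<close> in its interior.\<close>
    obtain v' where v': "v' \<in> R" "dist w v' = 1" "v' \<noteq> v" using w(1) unfolding iff by metis
    have wN: "w \<in> N" using w iff by (simp add: N_def)
    have "norm ((w - v) + (v - v')) < 1"
    proof (rule contact_between_maximal_pair[where P = "p - v" and Q = "q - v"])
      show "norm (p - v) = 1" "norm (q - v) = 1" "norm (w - v) = 1"
        using pN qN wN by (auto simp: N_def dist_norm norm_minus_commute)
      show "norm (p - v - (q - v)) \<le> 1" using diam[of p q] pN qN by (simp add: N_def dist_norm)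
      show "norm (w - v - (p - v)) \<le> norm (p - v - (q - v))"
        "norm (w - v - (q - v)) \<le> norm (p - v - (q - v))"
        using max[OF wN pN] max[OF wN qN] by (simp_all add: dist_norm)
      show "norm (p - v + (v - v')) \<le> 1" "norm (q - v + (v - v')) \<le> 1"
        using diam[OF _ v'(1)] pN qN by (auto simp: N_def dist_norm)
    qed (use pq neq v' in auto)
    then show False using v'(2) by (simp add: dist_norm)
  qed
  have "{w \<in> vertices R. dist v w = 1} = {p, q}"
    using only pV qV pN qN by (auto simp: N_def)
  then show ?thesis using pq by simp
qed


section \<open>Unit segments between vertices meet; which index differences give unit
  distance\<close>

lemma half_lens_dist_less:
  fixes z w :: complex
  assumes z: "0 < Im z" "norm z \<le> 1" "norm (z - 1) \<le> 1" and w: "0 < Im w" "norm w \<le> 1" "norm (w - 1) \<le> 1"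
  shows "norm (z - w) < 1"
proof -
  \<comment> \<open>Let \<open>z\<close> be the lower point. Horizontally it is no farther from
    \<open>w\<close> than 0 or 1 is, and its vertical distance to \<open>w\<close> is less than
    \<open>Im w\<close>. So \<open>z\<close> is strictly closer to \<open>w\<close> than that end of
    the segment, which has distance at most 1.\<close>
  have *: "norm (z - w) < 1"
    if z: "0 < Im z" "norm z \<le> 1" "norm (z - 1) \<le> 1" and w: "norm w \<le> 1" "norm (w - 1) \<le> 1"
      and le: "Im z \<le> Im w" for z w :: complex
  proof -
    have w2: "(Re w)\<^sup>2 + (Im w)\<^sup>2 \<le> 1" "(1 - Re w)\<^sup>2 + (Im w)\<^sup>2 \<le> 1"
      using power_mono[OF w(1) norm_ge_zero, of 2] power_mono[OF w(2) norm_ge_zero, of 2]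
      by (simp_all add: cmod_power2 power2_commute)
    have "\<bar>Re z\<bar> \<le> 1" "\<bar>Re (z - 1)\<bar> \<le> 1"
      using abs_Re_le_cmod order_trans z(2,3) by blast+
    then have rz: "0 \<le> Re z" "Re z \<le> 1" by auto
    have "(Im w - Im z)\<^sup>2 < (Im w)\<^sup>2"
      using z(1) le by (intro power_strict_mono) auto
    then have "(Im z - Im w)\<^sup>2 < (Im w)\<^sup>2" by (simp add: power2_commute)
    moreover have "(Re z - Re w)\<^sup>2 \<le> (Re w)\<^sup>2 \<or> (Re z - Re w)\<^sup>2 \<le> (1 - Re w)\<^sup>2"
      using rz by (cases "Re z \<le> Re w") (auto simp: abs_le_square_iff[symmetric])
    ultimately have "(Re z - Re w)\<^sup>2 + (Im z - Im w)\<^sup>2 < 1" using w2 by linarith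
    then have "(norm (z - w))\<^sup>2 < 1" by (simp add: cmod_power2)
    then show ?thesis by (simp add: power_less_one_iff)
  qed
  show ?thesis
    using *[OF z w(2,3)] *[OF w z(2,3)] by (cases "Im z \<le> Im w") (auto simp: norm_minus_commute)
qed

text \<open>The map \<open>f\<close> moves the segment to the one from 0 to 1 without changing
  distances. Consequently vertices at distance 1 from each other never lie strictly on the same side
  of a unit segment.\<close>

lemma unit_segments_cross:
  assumes "dist p q = 1" "dist r p \<le> 1" "dist r q \<le> 1" "dist s p \<le> 1" "dist s q \<le> 1"
    and "0 < orientation p q r" "0 < orientation p q s"
  shows "dist r s < 1"
proof -
  define f where "f y = cnj (q - p) * (y - p)" for y
  have u: "norm (cnj (q - p)) = 1"
    unfolding complex_mod_cnj using assms(1) by (simp add: dist_norm norm_minus_commute)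
  have "f q = of_real ((norm (q - p))\<^sup>2)"
    unfolding complex_norm_square f_def by (rule mult.commute)
  then have fq: "f q = 1" using u unfolding complex_mod_cnj by simp
  have f_diff: "f y - f z = cnj (q - p) * (y - z)" for y z by (simp add: f_def algebra_simps)
  have n: "norm (f y - f z) = dist y z" for y z
    unfolding f_diff norm_mult u by (simp add: dist_norm)
  have fp: "f p = 0" by (simp add: f_def)
  have Im_f: "Im (f y) = orientation p q y" for y unfolding orientation_def f_def ..
  have "norm (f r - f s) < 1"
    using assms n[of r p] n[of r q] n[of s p] n[of s q] unfolding fp fq
    by (intro half_lens_dist_less) (auto simp: Im_f)
  then show ?thesis by (simp add: n)
qed

lemma orientation_swap: "orientation q p r = - orientation p q r"
  and orientation_rotate: "orientation q r p = orientation p q r"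
  by (simp_all add: orientation_def algebra_simps)

text \<open>Here \<open>cl\<close> and \<open>co\<close> are the numbers of vertices on the two
  sides of an edge, \<open>S\<close> counts the edges across, and \<open>p\<close>, \<open>r\<close>
  (for one end) and \<open>q\<close>, \<open>s\<close> (for the other) record on which side the
  second edge of that end goes. Second edges on opposite sides would make \<open>2 * k\<close> odd;
  the other two cases give \<open>k\<close> and \<open>k + 1\<close>.\<close>

lemma edge_count_arith:
  fixes cl co p q r s S d k :: nat
  assumes a: "2 * cl = p + q + S" "2 * co = r + s + S" "p + r = 1" "q + s = 1" "cl + 1 = d" "co + d = 2 * k"
  shows "d = k \<or> d = k + 1"
proof -
  have "p = 0 \<and> r = 1 \<or> p = 1 \<and> r = 0" "q = 0 \<and> s = 1 \<or> q = 1 \<and> s = 0" using a(3,4) by linarith+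
  then consider "p + q = 0" "r + s = 2" | "p + q = 1" "r + s = 1" | "p + q = 2" "r + s = 0" by linarith
  then show ?thesis
  proof cases
    case 2
    then have "cl = co" using a by simp
    then have "2 * k = Suc (2 * cl)" using a by simp
    then have False by presburger
    then show ?thesis ..
  qed (use a in linarith)+
qed

text \<open>Double counting of the edges that join the two sides of the edge \<open>i j\<close>.\<close>

lemma noncrossing_edge_length:
  fixes adj :: "nat \<Rightarrow> nat \<Rightarrow> bool"
  assumes n: "n = 2 * k + 1" and sym: "\<And>i j. adj i j \<Longrightarrow> adj j i" and irrefl: "\<And>i. \<not> adj i i"
    and deg: "\<And>i. i < n \<Longrightarrow> card {j. j < n \<and> adj i j} = 2"
    and ij: "i < j" "j < n" "adj i j"
    and inner: "\<And>l m. \<lbrakk>i < l; l < j; i < m; m < j\<rbrakk> \<Longrightarrow> \<not> adj l m"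
    and outer: "\<And>l m. \<lbrakk>l < n; m < n; l \<notin> {i..j}; m \<notin> {i..j}\<rbrakk> \<Longrightarrow> \<not> adj l m"
  shows "j - i = k \<or> j - i = k + 1"
proof -
  define L where "L = {i<..<j}"
  define O' where "O' = {..<n} - {i..j}"
  define a :: "nat \<Rightarrow> nat \<Rightarrow> nat" where "a l m = of_bool (adj l m)" for l m
  have a_sym: "a l m = a m l" for l m using sym by (auto simp: a_def)
  have fin: "finite L" "finite O'" by (auto simp: L_def O'_def)
  have split: "{..<n} = insert i (insert j (L \<union> O'))" using ij by (auto simp: L_def O'_def)
  have deg': "a l i + a l j + (\<Sum>m\<in>L. a l m) + (\<Sum>m\<in>O'. a l m) = 2" if "l < n" for l
  proof -
    have "2 = (\<Sum>m<n. a l m)"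
      using deg[OF that] by (simp add: a_def sum.If_cases Int_def of_bool_def)
    also have "\<dots> = a l i + a l j + ((\<Sum>m\<in>L. a l m) + (\<Sum>m\<in>O'. a l m))"
      unfolding split using ij fin
      by (subst sum.insert; (subst sum.insert)?; (subst sum.union_disjoint)?) (auto simp: L_def O'_def)
    finally show ?thesis by simp
  qed
  have L0: "(\<Sum>m\<in>L. a l m) = 0" if "l \<in> L" for l
    using inner that by (auto simp: L_def a_def)
  have O0: "(\<Sum>m\<in>O'. a l m) = 0" if "l \<in> O'" for l
    using outer that by (auto simp: O'_def a_def)
  have "2 * card L = (\<Sum>l\<in>L. a l i + a l j + (\<Sum>m\<in>O'. a l m))"
  proof -
    have "(\<Sum>l\<in>L. a l i + a l j + (\<Sum>m\<in>O'. a l m)) = (\<Sum>l\<in>L. 2)"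
    proof (rule sum.cong[OF refl])
      fix l assume "l \<in> L"
      moreover from this have "l < n" using ij by (simp add: L_def)
      ultimately show "a l i + a l j + (\<Sum>m\<in>O'. a l m) = 2" using deg' L0 by fastforce
    qed
    then show ?thesis by simp
  qed
  then have cL: "2 * card L = (\<Sum>l\<in>L. a i l) + (\<Sum>l\<in>L. a j l) + (\<Sum>l\<in>L. \<Sum>m\<in>O'. a l m)"
    by (simp add: sum.distrib a_sym[of _ i] a_sym[of _ j])
  have "2 * card O' = (\<Sum>l\<in>O'. a l i + a l j + (\<Sum>m\<in>L. a l m))"
  proof -
    have "(\<Sum>l\<in>O'. a l i + a l j + (\<Sum>m\<in>L. a l m)) = (\<Sum>l\<in>O'. 2)"
    proof (rule sum.cong[OF refl])
      fix l assume "l \<in> O'"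
      moreover from this have "l < n" by (simp add: O'_def)
      ultimately show "a l i + a l j + (\<Sum>m\<in>L. a l m) = 2" using deg' O0 by fastforce
    qed
    then show ?thesis by simp
  qed
  moreover have "(\<Sum>l\<in>O'. \<Sum>m\<in>L. a l m) = (\<Sum>l\<in>L. \<Sum>m\<in>O'. a l m)"
    by (subst sum.swap) (intro sum.cong refl a_sym)
  ultimately have cO: "2 * card O' = (\<Sum>l\<in>O'. a i l) + (\<Sum>l\<in>O'. a j l) + (\<Sum>l\<in>L. \<Sum>m\<in>O'. a l m)"
    by (simp add: sum.distrib a_sym[of _ i] a_sym[of _ j])
  have "a i i = 0" "a j j = 0" "a i j = 1" "a j i = 1"
    using ij sym irrefl by (auto simp: a_def)
  then have "(\<Sum>l\<in>L. a i l) + (\<Sum>l\<in>O'. a i l) = 1" "(\<Sum>l\<in>L. a j l) + (\<Sum>l\<in>O'. a j l) = 1"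
    using deg'[of i] deg'[of j] ij by auto
  moreover have "card L + 1 = j - i" using ij by (simp add: L_def)
  moreover have "card O' + (j - i) = 2 * k"
    unfolding O'_def using ij n by (subst card_Diff_subset) auto
  ultimately show ?thesis using cL cO by (intro edge_count_arith)
qed

text \<open>Unit distances occur only at the two index differences. These leave two candidates per
  vertex, and by degree 2 both are attained, which gives the converse.\<close>

lemma reuleaux_unit_distances:
  assumes R: "reuleaux_polygon R" and n: "n = 2 * k + 1" and lab: "ccw_labelling R n x"
    and i: "i < j" "j < n"
  shows "dist (x i) (x j) = 1 \<longleftrightarrow> j - i = k \<or> j - i = k + 1"
proof -
  have cw: "constant_width_shape R" using R by (simp add: reuleaux_polygon_def)
  have bij: "bij_betw x {..<n} (vertices R)"
    and ccw: "\<And>i j l. \<lbrakk>i < j; j < l; l < n\<rbrakk> \<Longrightarrow> 0 < orientation (x i) (x j) (x l)"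
    using lab by (auto simp: ccw_labelling_def)
  have xR: "x i \<in> R" if "i < n" for i
    using bij_betwE[OF bij] that by (simp add: vertices_constant_width_iff[OF cw])
  have diam: "dist (x i) (x j) \<le> 1" if "i < n" "j < n" for i j
    using constant_width_dist_le[OF cw xR[OF that(1)] xR[OF that(2)]] .
  define adj where "adj i j \<longleftrightarrow> dist (x i) (x j) = 1" for i j
  have deg: "card {j. j < n \<and> adj i j} = 2" if i: "i < n" for i
  proof -
    have "{w \<in> vertices R. dist (x i) w = 1} = x ` {j. j < n \<and> adj i j}"
      using bij by (auto simp: adj_def bij_betw_def)
    moreover have "inj_on x {j. j < n \<and> adj i j}"
      using bij by (auto simp: bij_betw_def intro: inj_on_subset)
    ultimately show ?thesis
      using reuleaux_vertex_degree[OF R, of "x i"] bij_betwE[OF bij] i by (simp add: card_image)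
  qed
  have length: "j - i = k \<or> j - i = k + 1" if ij: "i < j" "j < n" and "adj i j" for i j
  proof (rule noncrossing_edge_length[where adj = adj, OF n _ _ deg ij \<open>adj i j\<close>])
    show "adj j i" if "adj i j" for i j using that by (simp add: adj_def dist_commute)
    show "\<not> adj i i" for i by (simp add: adj_def)
    have one: "dist (x i) (x j) = 1" "dist (x j) (x i) = 1"
      using \<open>adj i j\<close> by (simp_all add: adj_def dist_commute)
    show "\<not> adj l m" if lm: "i < l" "l < j" "i < m" "m < j" for l m
    proof -
      have "0 < orientation (x j) (x i) (x l)" if "i < l" "l < j" for l
        using ccw[of i l j] that ij by (metis orientation_rotate)
      then have "dist (x l) (x m) < 1"
        using lm ij by (intro unit_segments_cross[OF one(2)] diam) auto
      then show ?thesis by (simp add: adj_def)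
    qed
    show "\<not> adj l m" if lm: "l < n" "m < n" "l \<notin> {i..j}" "m \<notin> {i..j}" for l m
    proof -
      have "0 < orientation (x i) (x j) (x l)" if "l < n" "l \<notin> {i..j}" for l
      proof (cases "l < i")
        case True
        then show ?thesis using ccw[of l i j] ij by (metis orientation_rotate)
      qed (use that ij ccw[of i j l] in auto)
      then have "dist (x l) (x m) < 1"
        using lm ij by (intro unit_segments_cross[OF one(1)] diam) auto
      then show ?thesis by (simp add: adj_def)
    qed
  qed
  have "0 < k" using i n by linarith
  \<comment> \<open>The candidates are \<open>i + k\<close> and \<open>i + k + 1\<close> modulo
    \<open>2 * k + 1\<close>. The case \<open>i = k\<close> is separate because exactly one of them
    wraps around there.\<close>
  define c where "c i = (if i < k then {i + k, i + k + 1} else if i = k then {0, 2 * k} else {i - k - 1, i - k})" for i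
  have eq: "{j. j < n \<and> adj i j} = c i" if i: "i < n" for i
  proof (rule card_subset_eq)
    show "finite (c i)" by (simp add: c_def)
    show "{j. j < n \<and> adj i j} \<subseteq> c i"
    proof clarify
      fix j assume j: "j < n" "adj i j"
      then have "i \<noteq> j" by (auto simp: adj_def)
      then have "i < j \<and> (j - i = k \<or> j - i = k + 1) \<or> j < i \<and> (i - j = k \<or> i - j = k + 1)"
        using length[of i j] length[of j i] j i by (force simp: adj_def dist_commute)
      then show "j \<in> c i" using i j(1) n unfolding c_def by auto
    qed
    have "card (c i) = 2" using deg[OF i] \<open>{j. j < n \<and> adj i j} \<subseteq> c i\<close>
        card_mono[OF \<open>finite (c i)\<close>] \<open>0 < k\<close> by (auto simp: c_def card_insert_if split: if_splits)
    then show "card {j. j < n \<and> adj i j} = card (c i)" using deg[OF i] by simp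
  qed
  have "dist (x i) (x j) = 1 \<longleftrightarrow> j \<in> c i" using eq[of i] i by (auto simp: adj_def)
  also have "\<dots> \<longleftrightarrow> j - i = k \<or> j - i = k + 1" using i n unfolding c_def by auto
  finally show ?thesis .
qed


subsection \<open>Moving intersection points\<close>

text \<open>The intersection point of the unit circles around \<open>c\<close> and \<open>d\<close> that lies on the left of the ray from
  \<open>c\<close> to \<open>d\<close> for \<open>\<sigma> = 1\<close> and on the right for \<open>\<sigma> = -1\<close>.\<close>

definition circles_meet :: "real \<Rightarrow> complex \<Rightarrow> complex \<Rightarrow> complex" where
  "circles_meet \<sigma> d c = c + (d - c) * (1 / 2 + \<i> * of_real (\<sigma> * sqrt (1 / ((d - c) \<bullet> (d - c)) - 1 / 4)))"

lemma circles_meet_gap: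
  assumes "0 < dist c d" "dist c d < 2"
  shows "0 < 1 / ((d - c) \<bullet> (d - c)) - 1 / (4 :: real)"
proof -
  have "(d - c) \<bullet> (d - c) = (dist c d)\<^sup>2"
    by (simp add: power2_norm_eq_inner[symmetric] dist_norm norm_minus_commute)
  moreover have "(dist c d)\<^sup>2 < 2\<^sup>2" using assms by (intro power_strict_mono) auto
  ultimately show ?thesis using assms by (simp add: field_simps)
qed

lemma circles_meet_on_circles:
  assumes cd: "0 < dist c d" "dist c d < 2" and \<sigma>: "\<bar>\<sigma>\<bar> = 1"
  shows "dist (circles_meet \<sigma> d c) c = 1" "dist (circles_meet \<sigma> d c) d = 1"
    and "0 < \<sigma> * orientation c d (circles_meet \<sigma> d c)"
proof -
  define D r h where "D = d - c" and "r = D \<bullet> D" and "h = sqrt (1 / r - 1 / 4)"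
  have gap: "0 < 1 / r - 1 / 4" using circles_meet_gap[OF cd] by (simp add: r_def D_def)
  then have h: "0 < h" "h\<^sup>2 = 1 / r - 1 / 4" by (simp_all add: h_def)
  have r: "0 < r" "(norm D)\<^sup>2 = r" using cd by (auto simp: r_def D_def power2_norm_eq_inner)
  have \<sigma>2: "\<sigma>\<^sup>2 = 1" using \<sigma> by (metis one_power2 power2_abs)
  have z: "circles_meet \<sigma> d c = c + D * (1 / 2 + \<i> * of_real (\<sigma> * h))"
    by (simp add: circles_meet_def D_def h_def r_def)
  have unit: "norm (D * (a + \<i> * of_real (\<sigma> * h))) = 1" if "\<bar>a\<bar> = 1 / 2" for a :: real
  proof -
    have "a\<^sup>2 = (1 / 2)\<^sup>2" using that by (metis power2_abs)
    then have "(norm (a + \<i> * of_real (\<sigma> * h)))\<^sup>2 = 1 / r"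
      using h(2) \<sigma>2 by (simp add: cmod_power2 power_mult_distrib power_divide)
    then have "(norm (D * (a + \<i> * of_real (\<sigma> * h))))\<^sup>2 = 1"
      using r by (simp add: norm_mult power_mult_distrib)
    then show ?thesis by (metis abs_norm_cancel abs_square_eq_1)
  qed
  show "dist (circles_meet \<sigma> d c) c = 1"
    using unit[of "1 / 2"] by (simp add: z dist_norm)
  have "circles_meet \<sigma> d c - d = D * (of_real (- 1 / 2) + \<i> * of_real (\<sigma> * h))"
    unfolding z D_def by (simp add: field_simps)
  then show "dist (circles_meet \<sigma> d c) d = 1"
    using unit[of "- 1 / 2"] by (simp only: dist_norm)
  have "orientation c d (circles_meet \<sigma> d c) = (norm D)\<^sup>2 * (\<sigma> * h)"
    unfolding z orientation_def cmod_power2 by (simp add: D_def power2_eq_square algebra_simps)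
  then have "\<sigma> * orientation c d (circles_meet \<sigma> d c) = r * h * \<sigma>\<^sup>2"
    unfolding r(2) by (simp add: power2_eq_square)
  then show "0 < \<sigma> * orientation c d (circles_meet \<sigma> d c)" using r h \<sigma>2 by simp
qed

text \<open>The value \<open>f\<close> describes \<open>z\<close> in the frame of the ray from
  \<open>c\<close> to \<open>d\<close>, scaled by their distance. The circle equations fix its real
  part and the square of its imaginary part, so an intersection point is determined by the sign of
  its orientation.\<close>

lemma circles_inter_coords:
  assumes "dist z c = 1" "dist z d = 1"
  defines "f \<equiv> cnj (d - c) * (z - c)"
  shows "2 * Re f = (dist c d)\<^sup>2" "(Im f)\<^sup>2 = (dist c d)\<^sup>2 - (dist c d)^4 / 4"
proof -
  have norms: "norm (z - c) = 1" "norm (d - c) = dist c d"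
    using assms(1) by (simp_all add: dist_norm norm_minus_commute)
  have "(norm (z - c - (d - c)))\<^sup>2 = 1" using assms(2) by (simp add: dist_norm)
  moreover have "Re f = (z - c) \<bullet> (d - c)"
    by (simp add: f_def inner_complex_def algebra_simps)
  ultimately show re: "2 * Re f = (dist c d)\<^sup>2"
    unfolding norm_diff_squared norms by simp
  have "norm f = dist c d"
    unfolding f_def norm_mult complex_mod_cnj using assms(1) by (simp add: dist_norm norm_minus_commute)
  then have "(Re f)\<^sup>2 + (Im f)\<^sup>2 = (dist c d)\<^sup>2" by (simp add: cmod_power2[symmetric])
  moreover have "(Re f)\<^sup>2 = (dist c d)^4 / 4"
    using arg_cong[OF re, of "\<lambda>x. x\<^sup>2"] by (simp add: power_mult_distrib)
  ultimately show "(Im f)\<^sup>2 = (dist c d)\<^sup>2 - (dist c d)^4 / 4" by simp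
qed

lemma circles_inter_orientation_nonzero:
  assumes "dist z c = 1" "dist z d = 1" "0 < dist c d" "dist c d < 2"
  shows "orientation c d z \<noteq> 0"
proof -
  have "(dist c d)\<^sup>2 < 2\<^sup>2" using assms by (intro power_strict_mono) auto
  then have "(dist c d)\<^sup>2 * (dist c d)\<^sup>2 < (dist c d)\<^sup>2 * 4"
    using assms by (intro mult_strict_left_mono) auto
  moreover have "(orientation c d z)\<^sup>2 = (dist c d)\<^sup>2 - (dist c d)^4 / 4"
    unfolding orientation_def by (rule circles_inter_coords(2)[OF assms(1,2)])
  moreover have "(dist c d)^4 = (dist c d)\<^sup>2 * (dist c d)\<^sup>2"
    by (simp add: power4_eq_xxxx power2_eq_square)
  ultimately have "0 < (orientation c d z)\<^sup>2" by linarith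
  then show ?thesis by simp
qed

lemma circles_inter_unique:
  assumes "dist z c = 1" "dist z d = 1" "dist w c = 1" "dist w d = 1"
    and same_side: "0 < orientation c d z * orientation c d w"
  shows "z = w"
proof -
  let ?f = "\<lambda>z. cnj (d - c) * (z - c)"
  have "(Im (?f z))\<^sup>2 = (Im (?f w))\<^sup>2" "Re (?f z) = Re (?f w)"
    using circles_inter_coords[OF assms(1,2)] circles_inter_coords[OF assms(3,4)] by simp_all
  moreover have "0 < Im (?f z) * Im (?f w)" using same_side by (simp only: orientation_def)
  ultimately have "Re (?f z) = Re (?f w)" "Im (?f z) = Im (?f w)"
    by (auto simp only: power2_eq_iff mult_minus_left mult_minus_right) (smt (verit) zero_le_square)+
  then have "?f z = ?f w" by (rule complex_eqI)
  moreover have "cnj (d - c) \<noteq> 0" using same_side by (auto simp: orientation_def)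
  ultimately show ?thesis by simp
qed

lemma circles_meet_orientation:
  assumes p: "dist p c = 1" "dist p d = 1" and cd: "0 < dist c d" "dist c d < 2"
  shows "circles_meet (sgn (orientation c d p)) d c = p"
proof -
  define \<sigma> where "\<sigma> = sgn (orientation c d p)"
  have "orientation c d p \<noteq> 0" by (intro circles_inter_orientation_nonzero p cd)
  then have \<sigma>: "\<bar>\<sigma>\<bar> = 1" "0 < \<sigma> * orientation c d p" by (auto simp: \<sigma>_def sgn_if)
  note meet = circles_meet_on_circles[OF cd \<sigma>(1)]
  have "0 < (\<sigma> * orientation c d (circles_meet \<sigma> d c)) * (\<sigma> * orientation c d p)"
    using meet(3) \<sigma>(2) by simp
  also have "\<dots> = \<sigma>\<^sup>2 * (orientation c d (circles_meet \<sigma> d c) * orientation c d p)"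
    by (simp add: power2_eq_square)
  also have "\<sigma>\<^sup>2 = 1" using \<sigma>(1) by (metis one_power2 power2_abs)
  finally show ?thesis
    unfolding \<sigma>_def[symmetric] using meet(1,2) p by (intro circles_inter_unique[where c = c and d = d]) auto
qed

lemma continuous_on_circles_meet:
  assumes "continuous_on S c" "\<And>s. s \<in> S \<Longrightarrow> 0 < dist (c s) d"
  shows "continuous_on S (\<lambda>s. circles_meet \<sigma> d (c s))"
  unfolding circles_meet_def using assms by (intro continuous_intros assms(1)) force

text \<open>The bounds on \<open>t\<close> keep the distance of the centres strictly between 0 and
  2, so the orientation of an intersection point never vanishes on the way. A continuous path cannot
  change its sign and must follow the explicit branch.\<close>

lemma moving_intersection_eq_circles_meet:
  assumes v: "norm v = 1" and p: "dist p c = 1" "dist p d = 1"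
    and t: "\<bar>t\<bar> < dist c d" "\<bar>t\<bar> < 2 - dist c d"
  shows "moving_intersection c v d p t = circles_meet (sgn (orientation c d p)) d (c + t *\<^sub>R v)"
proof -
  define S where "S = closed_segment 0 t"
  define \<sigma> where "\<sigma> = sgn (orientation c d p)"
  define e where "e s = c + s *\<^sub>R v" for s
  have abs_le: "\<bar>s\<bar> \<le> \<bar>t\<bar>" if "s \<in> S" for s
    using that by (auto simp: S_def closed_segment_eq_real_ivl split: if_splits)
  have range: "0 < dist (e s) d" "dist (e s) d < 2" if "s \<in> S" for s
  proof -
    have "dist (e s) c = \<bar>s\<bar>" "dist c (e s) = \<bar>s\<bar>" using v by (simp_all add: e_def dist_norm)
    then show "0 < dist (e s) d" "dist (e s) d < 2"
      using abs_le[OF that] t dist_triangle[of c d "e s"] dist_triangle[of "e s" d c]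
      by linarith+
  qed
  have "orientation c d p \<noteq> 0"
    using t by (intro circles_inter_orientation_nonzero p) linarith+
  then have \<sigma>: "\<bar>\<sigma>\<bar> = 1" "0 < \<sigma> * orientation c d p" by (auto simp: \<sigma>_def sgn_if)
  have e_cont: "continuous_on S e" unfolding e_def by (intro continuous_intros)
  have e0: "e 0 = c" "0 \<in> S" "t \<in> S" by (simp_all add: e_def S_def)
  define \<mu> where "\<mu> s = circles_meet \<sigma> d (e s)" for s
  note \<mu> = circles_meet_on_circles[OF range \<sigma>(1), folded \<mu>_def]
  have unique: "\<gamma> s = \<mu> s"
    if \<gamma>: "continuous_on S \<gamma>" "\<gamma> 0 = p" "\<And>s. s \<in> S \<Longrightarrow> dist (\<gamma> s) (e s) = 1 \<and> dist (\<gamma> s) d = 1" and s: "s \<in> S"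
    for \<gamma> s
  proof -
    define g where "g s = orientation (e s) d (\<gamma> s)" for s
    have g_cont: "continuous_on S (\<lambda>s. \<sigma> * g s)"
      unfolding g_def orientation_def by (intro continuous_intros e_cont \<gamma>)
    have g_nz: "g s \<noteq> 0" if "s \<in> S" for s
      unfolding g_def using \<gamma>(3)[OF that] range[OF that] by (intro circles_inter_orientation_nonzero) auto
    have "connected ((\<lambda>s. \<sigma> * g s) ` S)"
      by (rule connected_continuous_image[OF g_cont]) (simp add: S_def)
    moreover have "0 < \<sigma> * g 0" using \<sigma>(2) \<gamma>(2) e0 by (simp add: g_def)
    moreover have "0 \<notin> (\<lambda>s. \<sigma> * g s) ` S" using g_nz \<sigma> by auto
    ultimately have "0 < \<sigma> * g s"
      using s e0(2) connectedD_interval[of "(\<lambda>s. \<sigma> * g s) ` S" "\<sigma> * g s" "\<sigma> * g 0" 0]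
      by (meson imageI less_imp_le not_le)
    then have "0 < (\<sigma> * g s) * (\<sigma> * orientation (e s) d (\<mu> s))" using \<mu>(3)[OF s s] by simp
    also have "\<dots> = \<sigma>\<^sup>2 * (orientation (e s) d (\<gamma> s) * orientation (e s) d (\<mu> s))"
      by (simp add: g_def power2_eq_square)
    also have "\<sigma>\<^sup>2 = 1" using \<sigma>(1) by (metis one_power2 power2_abs)
    finally show ?thesis
      using \<gamma>(3)[OF s] \<mu>(1,2)[OF s s] by (intro circles_inter_unique) auto
  qed
  have on_circles: "z \<in> frontier (cball (c + s *\<^sub>R v) 1) \<inter> frontier (cball d 1)
      \<longleftrightarrow> dist z (e s) = 1 \<and> dist z d = 1" for z s
    by (auto simp: e_def dist_commute)
  have "\<mu> 0 = p"
    using circles_meet_orientation[OF p] range[OF e0(2)] by (simp add: \<mu>_def \<sigma>_def e0(1))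
  moreover have "continuous_on S \<mu>"
    unfolding \<mu>_def by (intro continuous_on_circles_meet e_cont range)
  ultimately have ex: "\<exists>\<gamma>. continuous_on S \<gamma> \<and> \<gamma> 0 = p \<and> \<gamma> t = \<mu> t \<and>
      (\<forall>s\<in>S. dist (\<gamma> s) (e s) = 1 \<and> dist (\<gamma> s) d = 1)"
    using \<mu>(1,2) by blast
  show ?thesis
    unfolding moving_intersection_def on_circles S_def[symmetric] \<sigma>_def[symmetric] e_def[of t, symmetric]
      \<mu>_def[symmetric]
    by (rule the_equality) (use ex unique[OF _ _ _ e0(3)] in blast)+
qed

lemma circles_meet_differentiable:
  assumes c: "(c has_vector_derivative c') (at s)" and cd: "0 < dist (c s) d" "dist (c s) d < 2"
  shows "\<exists>z'. ((\<lambda>s. circles_meet \<sigma> d (c s)) has_vector_derivative z') (at s)"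
proof -
  define r where "r s = (d - c s) \<bullet> (d - c s)" for s
  have D: "((\<lambda>s. d - c s) has_vector_derivative - c') (at s)"
    using c by (auto intro!: derivative_eq_intros)
  have "(r has_derivative (\<lambda>h. (d - c s) \<bullet> (h *\<^sub>R - c') + (h *\<^sub>R - c') \<bullet> (d - c s))) (at s)"
    unfolding r_def using D unfolding has_vector_derivative_def by (intro has_derivative_inner)
  then have r: "(r has_real_derivative (- 2 * ((d - c s) \<bullet> c'))) (at s)"
    unfolding has_field_derivative_def by (rule has_derivative_eq_rhs) (auto simp: inner_commute)
  have gap: "0 < 1 / r s - 1 / 4" using circles_meet_gap[OF cd] by (simp add: r_def)
  have "r s \<noteq> 0" using cd by (auto simp: r_def)
  have "(\<lambda>s. sqrt (1 / r s - 1 / 4)) differentiable (at s)"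
    using gap \<open>r s \<noteq> 0\<close> r unfolding real_differentiable_def
    by (intro exI) (auto intro!: derivative_eq_intros)
  then obtain h' where "((\<lambda>s. sqrt (1 / r s - 1 / 4)) has_real_derivative h') (at s)"
    unfolding real_differentiable_def by blast
  then have "((\<lambda>s. \<sigma> * sqrt (1 / r s - 1 / 4)) has_real_derivative \<sigma> * h') (at s)"
    by (rule DERIV_cmult)
  then have "((\<lambda>s. complex_of_real (\<sigma> * sqrt (1 / r s - 1 / 4))) has_vector_derivative of_real (\<sigma> * h')) (at s)"
    by (intro has_vector_derivative_of_real) (simp add: has_real_derivative_iff_has_vector_derivative)
  then have "((\<lambda>s. 1 / 2 + \<i> * complex_of_real (\<sigma> * sqrt (1 / r s - 1 / 4)))
      has_vector_derivative 0 + \<i> * of_real (\<sigma> * h')) (at s)"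
    by (intro has_vector_derivative_add has_vector_derivative_const has_vector_derivative_mult_right)
  from has_vector_derivative_add[OF c has_vector_derivative_mult[OF D this]]
  show ?thesis unfolding circles_meet_def r_def[symmetric] by blast
qed

lemma has_real_derivative_norm_squared:
  fixes f :: "real \<Rightarrow> 'a::real_inner"
  assumes "(f has_vector_derivative f') (at s)"
  shows "((\<lambda>s. (norm (f s))\<^sup>2) has_real_derivative 2 * (f' \<bullet> f s)) (at s)"
proof -
  have "((\<lambda>u. f u \<bullet> f u) has_derivative (\<lambda>h. f s \<bullet> (h *\<^sub>R f') + (h *\<^sub>R f') \<bullet> f s)) (at s)"
    using assms unfolding has_vector_derivative_def by (intro has_derivative_inner)
  then show ?thesis
    unfolding has_field_derivative_def power2_norm_eq_inner
    by (rule has_derivative_eq_rhs) (auto simp: inner_commute)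
qed

lemma has_vector_derivative_unit_orthogonal:
  fixes f :: "real \<Rightarrow> 'a::real_inner"
  assumes f: "(f has_vector_derivative f') (at s)" and unit: "\<forall>\<^sub>F u in nhds s. norm (f u) = 1"
  shows "f' \<bullet> f s = 0"
proof -
  have "((\<lambda>u. (norm (f u))\<^sup>2) has_real_derivative 0) (at s)"
  proof (rule has_field_derivative_cong_ev[THEN iffD1, OF refl _ refl refl])
    show "\<forall>\<^sub>F u in nhds s. u \<in> UNIV \<longrightarrow> 1 = (norm (f u))\<^sup>2"
      using unit by eventually_elim simp
  qed (use eventually_nhds_x_imp_x[OF unit] in auto)
  from DERIV_unique[OF this has_real_derivative_norm_squared[OF f]] show ?thesis by simp
qed

text \<open>The explicit formula supplies only the existence of the velocity. Its value is encoded
  by the two unit distances that are preserved, since a vector of constant length is orthogonal to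
  its derivative.\<close>

lemma circles_meet_velocity:
  assumes c: "(c has_vector_derivative c') (at s)" and cd: "0 < dist (c s) d" "dist (c s) d < 2"
    and \<sigma>: "\<bar>\<sigma>\<bar> = 1"
  obtains z' where "((\<lambda>s. circles_meet \<sigma> d (c s)) has_vector_derivative z') (at s)"
    "z' \<bullet> (circles_meet \<sigma> d (c s) - d) = 0" "(z' - c') \<bullet> (circles_meet \<sigma> d (c s) - c s) = 0"
proof -
  obtain z' where z': "((\<lambda>s. circles_meet \<sigma> d (c s)) has_vector_derivative z') (at s)"
    using circles_meet_differentiable[OF c cd] by blast
  have lim: "((\<lambda>u. dist (c u) d) \<longlongrightarrow> dist (c s) d) (at s)"
    using has_vector_derivative_continuous[OF c] by (intro tendsto_intros) (simp add: isCont_def)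
  have "\<forall>\<^sub>F u in nhds s. 0 < dist (c u) d" "\<forall>\<^sub>F u in nhds s. dist (c u) d < 2"
    unfolding eventually_nhds_conv_at using order_tendstoD[OF lim] cd by blast+
  then have on: "\<forall>\<^sub>F u in nhds s. norm (circles_meet \<sigma> d (c u) - d) = 1"
    "\<forall>\<^sub>F u in nhds s. norm (circles_meet \<sigma> d (c u) - c u) = 1"
    by (eventually_elim, use circles_meet_on_circles(1,2)[OF _ _ \<sigma>] in \<open>simp add: dist_norm\<close>)+
  have "((\<lambda>s. circles_meet \<sigma> d (c s) - d) has_vector_derivative z' - 0) (at s)"
    by (intro has_vector_derivative_diff z' has_vector_derivative_const)
  then have "z' \<bullet> (circles_meet \<sigma> d (c s) - d) = 0"
    using has_vector_derivative_unit_orthogonal[OF _ on(1)] by simp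
  moreover have "((\<lambda>s. circles_meet \<sigma> d (c s) - c s) has_vector_derivative z' - c') (at s)"
    by (intro has_vector_derivative_diff z' c)
  then have "(z' - c') \<bullet> (circles_meet \<sigma> d (c s) - c s) = 0"
    using has_vector_derivative_unit_orthogonal[OF _ on(2)] by simp
  ultimately show ?thesis using that z' by blast
qed


subsection \<open>The derivative of the area\<close>

lemma sin_mult_tan_half:
  assumes "0 < \<theta>" "\<theta> < pi"
  shows "sin \<theta> * tan (\<theta> / 2) = 1 - cos \<theta>"
    and "(1 + cos \<theta>) * tan (\<theta> / 2) = sin \<theta>"
proof -
  define y where "y = \<theta> / 2"
  have y: "\<theta> = 2 * y" "cos y \<noteq> 0" using assms cos_gt_zero[of y] by (auto simp: y_def)
  then show "sin \<theta> * tan (\<theta> / 2) = 1 - cos \<theta>"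
    by (simp add: sin_double cos_double_sin tan_def power2_eq_square)
  show "(1 + cos \<theta>) * tan (\<theta> / 2) = sin \<theta>"
    using y by (simp add: sin_double cos_double_cos tan_def power2_eq_square)
qed

lemma unit_complex_frame:
  assumes "norm P = 1"
  obtains a where "z = a * (P :: complex)"
proof
  have "P \<noteq> 0" using assms by auto
  then show "z = (z / P) * P" by simp
qed

text \<open>Used at \<open>x k\<close>: \<open>U\<close> points to the moving \<open>x 0\<close> and
  \<open>S\<close> to the fixed \<open>x (2 * k)\<close>. In the frame of \<open>S\<close> the
  velocity is purely imaginary, and the second condition determines its size.\<close>

lemma velocity_flux_clockwise:
  assumes S: "norm S = 1" and U: "U = cis \<theta> * S" and \<theta>: "0 < \<theta>" "\<theta> < pi"
    and vel: "z' \<bullet> S = 0" "(z' - v) \<bullet> U = 0"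
  shows "z' \<bullet> (- \<i> * (U - S)) = tan (\<theta> / 2) * (v \<bullet> U)"
proof -
  obtain a where a: "z' = a * S" using unit_complex_frame[OF S] .
  obtain w where w: "v = w * S" using unit_complex_frame[OF S] .
  have "a \<bullet> 1 = 0" using vel(1) inner_mult_unit[OF S, of a 1] by (simp add: a)
  moreover have "(a - w) \<bullet> cis \<theta> = 0"
    using vel(2) inner_mult_unit[OF S, of "a - w" "cis \<theta>"] by (simp add: a w U left_diff_distrib)
  ultimately have aw: "Re a = 0" "w \<bullet> cis \<theta> = Im a * sin \<theta>"
    by (simp_all add: inner_complex_def left_diff_distrib)
  have "- \<i> * (U - S) = (- \<i> * (cis \<theta> - 1)) * S" by (simp add: U algebra_simps)
  then have "z' \<bullet> (- \<i> * (U - S)) = a \<bullet> (- \<i> * (cis \<theta> - 1))"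
    unfolding a using inner_mult_unit[OF S] by metis
  also have "\<dots> = Im a * (1 - cos \<theta>)" by (simp add: inner_complex_def aw algebra_simps)
  also have "\<dots> = tan (\<theta> / 2) * (w \<bullet> cis \<theta>)"
    by (simp add: aw sin_mult_tan_half(1)[OF \<theta>, symmetric])
  also have "w \<bullet> cis \<theta> = v \<bullet> U" by (simp add: w U inner_mult_unit[OF S])
  finally show ?thesis .
qed

text \<open>The mirror image, used at \<open>x (k + 1)\<close>, whose arc runs from the moving
  \<open>x 0\<close> to the fixed \<open>x 1\<close>.\<close>

lemma velocity_flux_counterclockwise:
  assumes U: "norm U = 1" and S: "S = cis \<theta> * U" and \<theta>: "0 < \<theta>" "\<theta> < pi"
    and vel: "z' \<bullet> S = 0" "(z' - v) \<bullet> U = 0"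
  shows "z' \<bullet> (- \<i> * (S - U)) = tan (\<theta> / 2) * (v \<bullet> U)"
proof -
  obtain a where a: "z' = a * U" using unit_complex_frame[OF U] .
  obtain w where w: "v = w * U" using unit_complex_frame[OF U] .
  have "a \<bullet> cis \<theta> = 0" using vel(1) inner_mult_unit[OF U, of a "cis \<theta>"] by (simp add: a S)
  moreover have "(a - w) \<bullet> 1 = 0"
    using vel(2) inner_mult_unit[OF U, of "a - w" 1] by (simp add: a w left_diff_distrib)
  ultimately have aw: "Re a * cos \<theta> + Im a * sin \<theta> = 0" "Re w = Re a"
    by (simp_all add: inner_complex_def)
  have s: "sin \<theta> \<noteq> 0" using sin_gt_zero[OF \<theta>] by simp
  have sc: "(sin \<theta>)\<^sup>2 = 1 - (cos \<theta>)\<^sup>2" by (rule sin_squared_eq)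
  have "- \<i> * (S - U) = (- \<i> * (cis \<theta> - 1)) * U" by (simp add: S algebra_simps)
  then have "z' \<bullet> (- \<i> * (S - U)) = a \<bullet> (- \<i> * (cis \<theta> - 1))"
    unfolding a using inner_mult_unit[OF U] by metis
  also have "\<dots> = Re a * sin \<theta> + Im a * (1 - cos \<theta>)" by (simp add: inner_complex_def algebra_simps)
  also have "\<dots> = tan (\<theta> / 2) * Re a"
  proof -
    have "sin \<theta> * (Re a * sin \<theta> + Im a * (1 - cos \<theta>)) = Re a * (1 - cos \<theta>)"
      using aw(1) sc by algebra
    also have "\<dots> = sin \<theta> * (tan (\<theta> / 2) * Re a)"
      by (simp add: sin_mult_tan_half(1)[OF \<theta>, symmetric])
    finally show ?thesis using s by simp
  qed
  also have "Re a = v \<bullet> U"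
    using inner_mult_unit[OF U, of w 1] aw(2) by (simp add: w inner_complex_def)
  finally show ?thesis .
qed

text \<open>Both forms come from half angles: \<open>1 + cis \<theta>\<close> and
  \<open>cis \<theta> - 1\<close> are multiples of \<open>cis (\<theta> / 2)\<close>. The bisector
  form appears in the final formula; the form with \<open>P + Q\<close> can be compared with the
  tangent terms at \<open>x k\<close> and \<open>x (k + 1)\<close>.\<close>

lemma chord_flux_eq_bisector:
  assumes P: "norm P = 1" and Q: "Q = cis \<theta> * P" and \<theta>: "0 < \<theta>" "\<theta> < pi"
  shows "- \<i> * (Q - P) = of_real (2 * sin (\<theta> / 2)) * sgn (sgn P + sgn Q)"
    and "- \<i> * (Q - P) = of_real (tan (\<theta> / 2)) * (P + Q)"
proof -
  define y where "y = \<theta> / 2"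
  have y: "\<theta> = y + y" and c: "0 < cos y" using \<theta> cos_gt_zero[of y] by (auto simp: y_def)
  have "norm Q = 1" by (simp add: Q norm_mult P)
  then have sgn: "sgn P = P" "sgn Q = Q" using P by (simp_all add: sgn_eq)
  have cc: "1 + cis \<theta> = cis y * of_real (2 * cos y)" "cis \<theta> - 1 = cis y * (\<i> * of_real (2 * sin y))"
  proof -
    have "1 + cos \<theta> = cos y * (2 * cos y)"
      unfolding y by (simp add: cos_double_cos power2_eq_square flip: mult_2)
    moreover have "cos \<theta> - 1 = - (sin y * (2 * sin y))"
      unfolding y by (simp add: cos_double_sin power2_eq_square flip: mult_2)
    moreover have "sin \<theta> = 2 * sin y * cos y" unfolding y by (simp add: sin_double flip: mult_2)
    ultimately show "1 + cis \<theta> = cis y * of_real (2 * cos y)" "cis \<theta> - 1 = cis y * (\<i> * of_real (2 * sin y))"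
      by (simp_all add: complex_eq_iff)
  qed
  have sum: "P + Q = (cis y * P) * of_real (2 * cos y)"
  proof -
    have "P + Q = (1 + cis \<theta>) * P" by (simp add: Q algebra_simps)
    then show ?thesis unfolding cc by (simp add: mult_ac)
  qed
  have "sgn (P + Q) = cis y * P"
    unfolding sum using c P by (simp add: sgn_eq norm_mult)
  moreover have diff: "- \<i> * (Q - P) = of_real (2 * sin y) * (cis y * P)"
  proof -
    have "- \<i> * (Q - P) = - \<i> * (cis \<theta> - 1) * P" by (simp add: Q algebra_simps)
    then show ?thesis unfolding cc by simp
  qed
  ultimately show "- \<i> * (Q - P) = of_real (2 * sin (\<theta> / 2)) * sgn (sgn P + sgn Q)"
    by (simp add: sgn y_def)
  show "- \<i> * (Q - P) = of_real (tan (\<theta> / 2)) * (P + Q)"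
    unfolding diff sum y_def[symmetric] using c by (simp add: tan_def)
qed

lemma norm_chord:
  assumes "norm P = 1" "Q = cis \<theta> * P"
  shows "(norm (Q - P))\<^sup>2 = 2 - 2 * cos \<theta>"
proof -
  have "Q \<bullet> P = cos \<theta>"
    using inner_mult_unit[OF assms(1), of "cis \<theta>" 1] by (simp add: assms(2) inner_complex_def)
  then show ?thesis unfolding norm_diff_squared using assms by (simp add: norm_mult)
qed

text \<open>For \<open>u = pi / 5\<close> one has \<open>3 * u = pi - 2 * u\<close>. Expanding the
  cosines of both sides gives a cubic, from which the factor \<open>c + 1\<close> cancels.\<close>

lemma cos_pi_fifth_root: "4 * (cos (pi / 5))\<^sup>2 - 2 * cos (pi / 5) - 1 = 0"
proof -
  define u c s :: real where "u = pi / 5" and "c = cos u" and "s = sin u"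
  have sc: "s\<^sup>2 + c\<^sup>2 = 1" by (simp add: s_def c_def)
  have "2 * u + u = pi - 2 * u" by (simp add: u_def)
  then have "cos (2 * u + u) = cos (pi - 2 * u)" by (rule arg_cong)
  also have "\<dots> = - cos (2 * u)" by (simp add: cos_diff)
  finally have "cos (2 * u + u) = - cos (2 * u)" .
  then have "(c\<^sup>2 - s\<^sup>2) * c - 2 * s * c * s = - (c\<^sup>2 - s\<^sup>2)"
    unfolding cos_add cos_double sin_double by (simp add: c_def s_def)
  then have "(c + 1) * (4 * c\<^sup>2 - 2 * c - 1) = 0" using sc by algebra
  moreover have "0 < c" unfolding c_def u_def by (intro cos_gt_zero) auto
  ultimately show ?thesis by (simp add: c_def u_def)
qed

lemma angle_le_pi_fifth_or_eq_pi_third: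
  assumes \<theta>: "0 < \<theta>" "\<theta> < pi" and C: "1 / 2 \<le> cos \<theta>" "8 * (cos \<theta>)\<^sup>2 * (1 - cos \<theta>) \<le> 1"
  shows "\<theta> \<in> {0..pi / 5} \<union> {pi / 3}"
proof (cases "cos \<theta> = 1 / 2")
  case True
  then have "cos \<theta> = cos (pi / 3)" by (simp add: cos_60)
  then have "\<theta> = pi / 3"
    by (intro cos_inj_pi[of \<theta> "pi / 3"]) (use \<theta> in linarith)+
  then show ?thesis by blast
next
  case False
  define c where "c = cos (pi / 5)"
  have "cos (pi / 3) < c" unfolding c_def by (intro cos_monotone_0_pi) auto
  then have c: "1 / 2 < c" "4 * c\<^sup>2 - 2 * c - 1 = 0" using cos_pi_fifth_root by (simp_all add: cos_60 c_def)
  have C': "1 / 2 < cos \<theta>" using False C(1) by simp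
  \<comment> \<open>The cubic splits into these factors; their roots relevant here are the cosines
    of \<open>pi / 3\<close> and \<open>pi / 5\<close>.\<close>
  have "0 \<le> (2 * cos \<theta> - 1) * (4 * (cos \<theta>)\<^sup>2 - 2 * cos \<theta> - 1)"
    using C(2) by (simp add: algebra_simps power2_eq_square power3_eq_cube)
  then have "0 \<le> 4 * (cos \<theta>)\<^sup>2 - 2 * cos \<theta> - 1" using C' by (simp add: zero_le_mult_iff)
  then have "0 \<le> (cos \<theta> - c) * (4 * (cos \<theta> + c) - 2)"
    using c(2) by (simp add: algebra_simps power2_eq_square)
  then have "c \<le> cos \<theta>" using C' c(1) by (simp add: zero_le_mult_iff)
  then have "\<theta> \<le> pi / 5" using \<theta> unfolding c_def by (subst (asm) cos_mono_le_eq) auto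
  then show ?thesis using \<theta> by simp
qed

text \<open>The angle is the argument of the quotient of the two directions, below \<open>pi\<close>
  by the orientation of the triangle. The discs \<open>j1\<close> and \<open>j2\<close> are those
  whose circles pass through the ends of the arc.\<close>

lemma configuration_arc:
  fixes c :: "nat \<Rightarrow> complex"
  assumes idx: "p \<in> J" "q \<in> J" "j1 \<in> J" "j2 \<in> J"
    and unit: "dist (c i) (c p) = 1" "dist (c i) (c q) = 1" "dist (c p) (c j1) = 1" "dist (c q) (c j2) = 1"
    and within: "\<And>j. j \<in> J \<Longrightarrow> dist (c p) (c j) \<le> 1" "\<And>j. j \<in> J \<Longrightarrow> dist (c q) (c j) \<le> 1"
    and orient: "0 < orientation (c i) (c p) (c j1)" "0 < orientation (c i) (c j2) (c q)"
      "0 < orientation (c i) (c p) (c q)"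
  obtains \<theta> where "0 < \<theta>" "\<theta> < pi" "c q - c i = cis \<theta> * (c p - c i)" "norm (c p - c i) = 1"
    "circle_flux (\<Inter>j\<in>J. cball (c j) 1) (c i) = - \<i> * ((c q - c i) - (c p - c i))"
    "measure lebesgue {\<phi> \<in> {0..<2 * pi}. c i + cis \<phi> \<in> (\<Inter>j\<in>J. cball (c j) 1)} = \<theta>"
proof -
  define P Q where "P = c p - c i" and "Q = c q - c i"
  have P: "norm P = 1" and Q: "norm Q = 1"
    using unit(1,2) by (simp_all add: P_def Q_def dist_norm norm_minus_commute)
  define z where "z = Q * cnj P"
  define \<theta> where "\<theta> = Arg z"
  have zz: "norm z = 1" by (simp add: z_def norm_mult P Q)
  have "0 < Im z" using orient(3) by (simp add: z_def P_def Q_def orientation_def algebra_simps)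
  then have \<theta>: "0 < \<theta>" "\<theta> < pi" using Arg_lt_pi[of z] by (simp_all add: \<theta>_def)
  have "cis \<theta> = z" 
  proof -
    have "z \<noteq> 0" using zz by auto
    then show ?thesis by (simp add: \<theta>_def cis_Arg sgn_eq zz)
  qed
  moreover have "cnj P * P = 1" using P complex_norm_square[of P] by (simp add: mult.commute)
  ultimately have QP: "Q = cis \<theta> * P" by (simp add: z_def mult.assoc)
  define K where "K = (\<Inter>j\<in>J. cball (c j) 1)"
  have K: "K \<in> sets borel" unfolding K_def by (intro borel_closed closed_INT) auto
  have q: "c q = c i + cis \<theta> * (c p - c i)" using QP by (simp add: P_def Q_def algebra_simps)
  have arc: "c i + cis \<psi> * P \<in> K \<longleftrightarrow> \<psi> \<le> \<theta>" if "0 \<le> \<psi>" "\<psi> < 2 * pi" for \<psi>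
    unfolding P_def K_def
    by (rule circle_inter_discs_eq_arc[OF P[unfolded P_def] q \<theta> within idx(3) unit(3) orient(1)
          idx(4) unit(4) orient(2) that])
  show ?thesis
  proof (rule that[OF \<theta>])
    show "c q - c i = cis \<theta> * (c p - c i)" using QP by (simp only: P_def Q_def)
    show "norm (c p - c i) = 1" using P by (simp only: P_def)
    have "circle_flux K (c i) = - \<i> * (Q - P)"
      unfolding QP by (rule circle_flux_arc[OF K P \<theta> arc])
    then show "circle_flux (\<Inter>j\<in>J. cball (c j) 1) (c i) = - \<i> * ((c q - c i) - (c p - c i))"
      by (simp only: P_def Q_def K_def)
    show "measure lebesgue {\<phi> \<in> {0..<2 * pi}. c i + cis \<phi> \<in> (\<Inter>j\<in>J. cball (c j) 1)} = \<theta>"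
      using measure_angles_arc[OF K P \<theta> arc] by (simp only: K_def)
  qed
qed


text \<open>Only the unit distances that determine the arcs opposite to \<open>c 0\<close>, \<open>c k\<close> and \<open>c (k + 1)\<close> are required; the
  other conditions are strict inequalities at the remaining pairs, so they survive small displacements.\<close>

definition star_configuration :: "nat \<Rightarrow> (nat \<Rightarrow> complex) \<Rightarrow> bool" where
  "star_configuration k c \<longleftrightarrow>
     (\<forall>i j. i < j \<and> j < 2 * k + 1 \<longrightarrow> dist (c i) (c j) \<le> 1) \<and>
     (\<forall>i j l. i < j \<and> j < l \<and> l < 2 * k + 1 \<longrightarrow> 0 < orientation (c i) (c j) (c l)) \<and>
     dist (c 0) (c k) = 1 \<and> dist (c 0) (c (k + 1)) = 1 \<and> dist (c k) (c (2 * k)) = 1 \<and>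
     dist (c 1) (c (k + 1)) = 1 \<and> dist (c (k - 1)) (c (2 * k)) = 1 \<and> dist (c 1) (c (k + 2)) = 1"

definition other_discs :: "nat \<Rightarrow> (nat \<Rightarrow> complex) \<Rightarrow> nat \<Rightarrow> complex set" where
  "other_discs k c i = (\<Inter>j\<in>{..<2 * k + 1} - {i}. cball (c j) 1)"

text \<open>Measured against the other discs, so that it makes sense for displaced configurations;
  for the vertices of \<open>R\<close> it is the length of the opposite arc.\<close>

definition arc_angle :: "nat \<Rightarrow> (nat \<Rightarrow> complex) \<Rightarrow> nat \<Rightarrow> real" where
  "arc_angle k c i = measure lebesgue {\<phi> \<in> {0..<2 * pi}. c i + cis \<phi> \<in> other_discs k c i}"

definition has_arc :: "nat \<Rightarrow> (nat \<Rightarrow> complex) \<Rightarrow> nat \<Rightarrow> nat \<Rightarrow> nat \<Rightarrow> bool" where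
  "has_arc k c i p q \<longleftrightarrow> 0 < arc_angle k c i \<and> arc_angle k c i < pi \<and>
     norm (c p - c i) = 1 \<and> c q - c i = cis (arc_angle k c i) * (c p - c i) \<and>
     circle_flux (other_discs k c i) (c i) = - \<i> * ((c q - c i) - (c p - c i))"

lemma has_arcI:
  assumes "i < 2 * k + 1" "p < 2 * k + 1" "q < 2 * k + 1" "j1 < 2 * k + 1" "j2 < 2 * k + 1"
    and "i \<noteq> p" "i \<noteq> q" "i \<noteq> j1" "i \<noteq> j2"
    and within: "\<And>i j. i < 2 * k + 1 \<Longrightarrow> j < 2 * k + 1 \<Longrightarrow> dist (c i) (c j) \<le> 1"
    and "dist (c i) (c p) = 1" "dist (c i) (c q) = 1" "dist (c p) (c j1) = 1" "dist (c q) (c j2) = 1"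
    and "0 < orientation (c i) (c p) (c j1)" "0 < orientation (c i) (c j2) (c q)"
      "0 < orientation (c i) (c p) (c q)"
  shows "has_arc k c i p q"
proof -
  let ?J = "{..<2 * k + 1} - {i}"
  obtain \<theta> where "0 < \<theta>" "\<theta> < pi" "c q - c i = cis \<theta> * (c p - c i)" "norm (c p - c i) = 1"
    "circle_flux (\<Inter>j\<in>?J. cball (c j) 1) (c i) = - \<i> * ((c q - c i) - (c p - c i))"
    "measure lebesgue {\<phi> \<in> {0..<2 * pi}. c i + cis \<phi> \<in> (\<Inter>j\<in>?J. cball (c j) 1)} = \<theta>"
    by (rule configuration_arc[of p ?J q j1 j2 c i]) (use assms in auto)
  then show ?thesis unfolding has_arc_def arc_angle_def other_discs_def by metis
qed

context
  fixes k :: nat and c :: "nat \<Rightarrow> complex"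
  assumes k: "2 \<le> k" and star: "star_configuration k c"
begin

lemma star_dist_le: "i < 2 * k + 1 \<Longrightarrow> j < 2 * k + 1 \<Longrightarrow> dist (c i) (c j) \<le> 1"
proof -
  assume ij: "i < 2 * k + 1" "j < 2 * k + 1"
  have lt: "dist (c i) (c j) \<le> 1" if "i < j" "j < 2 * k + 1" for i j
    using star that unfolding star_configuration_def by blast
  show ?thesis using ij lt[of i j] lt[of j i] by (cases i j rule: linorder_cases) (simp_all add: dist_commute)
qed

lemma star_orientation: "\<lbrakk>i < j; j < l; l < 2 * k + 1\<rbrakk> \<Longrightarrow> 0 < orientation (c i) (c j) (c l)"
  using star unfolding star_configuration_def by blast

lemma star_unit:
  "dist (c 0) (c k) = 1" "dist (c 0) (c (k + 1)) = 1" "dist (c k) (c (2 * k)) = 1"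
  "dist (c 1) (c (k + 1)) = 1" "dist (c (k - 1)) (c (2 * k)) = 1" "dist (c 1) (c (k + 2)) = 1"
  using star unfolding star_configuration_def by blast+

text \<open>Each end of an arc needs a second circle through it: those around \<open>2 * k\<close>
  and \<open>1\<close> for the arc of \<open>0\<close>, \<open>k - 1\<close> and
  \<open>k + 1\<close> for that of \<open>k\<close>, \<open>k\<close> and \<open>k + 2\<close> for
  that of \<open>k + 1\<close>. This is the origin of the six unit distances in
  \<open>star_configuration\<close>.\<close>

lemma star_has_arc: "has_arc k c 0 k (k + 1)" "has_arc k c k (2 * k) 0" "has_arc k c (k + 1) 0 1"
proof -
  note u = star_unit
  have u': "dist (c k) (c 0) = 1" "dist (c (k + 1)) (c 0) = 1" "dist (c (2 * k)) (c k) = 1"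
    "dist (c (k + 1)) (c 1) = 1" "dist (c (2 * k)) (c (k - 1)) = 1"
    using u by (simp_all add: dist_commute)
  have o: "0 < orientation (c 0) (c k) (c (2 * k))" "0 < orientation (c 0) (c 1) (c (k + 1))"
    "0 < orientation (c 0) (c k) (c (k + 1))" "0 < orientation (c (k - 1)) (c k) (c (2 * k))"
    "0 < orientation (c 1) (c (k + 1)) (c (k + 2))"
    using k by (auto intro!: star_orientation)
  then have o': "0 < orientation (c k) (c (2 * k)) (c (k - 1))" "0 < orientation (c k) (c (k + 1)) (c 0)"
    "0 < orientation (c k) (c (2 * k)) (c 0)" "0 < orientation (c (k + 1)) (c 0) (c k)"
    "0 < orientation (c (k + 1)) (c (k + 2)) (c 1)" "0 < orientation (c (k + 1)) (c 0) (c 1)"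
    by (metis orientation_rotate)+
  show "has_arc k c 0 k (k + 1)"
    by (rule has_arcI[where ?j1.0 = "2 * k" and ?j2.0 = 1]) (use k u u' o star_dist_le in auto)
  show "has_arc k c k (2 * k) 0"
    by (rule has_arcI[where ?j1.0 = "k - 1" and ?j2.0 = "k + 1"])
       (use k u u' o o' star_dist_le in auto)
  show "has_arc k c (k + 1) 0 1"
    by (rule has_arcI[where ?j1.0 = k and ?j2.0 = "k + 2"])
       (use k u u' o o' star_dist_le in auto)
qed

lemma star_inj: "inj_on c {..<2 * k + 1}"
proof (rule linorder_inj_onI')
  fix i j assume ij: "i \<in> {..<2 * k + 1}" "j \<in> {..<2 * k + 1}" "i < j"
  have zero: "orientation p p q = 0" "orientation p q p = 0" "orientation q p p = 0" for p q
    by (simp_all add: orientation_def algebra_simps)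
  \<comment> \<open>A triple with a repeated point has orientation 0, so it suffices to complete
    \<open>i\<close>, \<open>j\<close> by a third index; the pair \<open>0\<close>,
    \<open>2 * k\<close> is completed by 1 in between.\<close>
  consider "j < 2 * k" | "0 < i" | "0 < (1::nat)" "1 < j" "i = 0" "j = 2 * k" using ij k by force
  then show "c i \<noteq> c j"
    by cases (use ij k star_orientation[of i j "2 * k"] star_orientation[of 0 i j]
        star_orientation[of 0 1 "2 * k"] zero in auto)
qed

end

text \<open>Stated for an arbitrary motion and time: it serves the straight motion at time 0 and the
  circular motion at all small times. The velocity conditions express the contributions of
  \<open>k\<close> and \<open>k + 1\<close> through the velocity of \<open>0\<close> alone.\<close>

lemma star_area_derivative:
  fixes c :: "nat \<Rightarrow> real \<Rightarrow> complex"
  assumes k: "2 \<le> k" and star: "star_configuration k (\<lambda>i. c i t)"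
    and der: "\<And>i. i < 2 * k + 1 \<Longrightarrow> (c i has_vector_derivative c' i) (at t)"
    and fixed: "\<And>i. i < 2 * k + 1 \<Longrightarrow> i \<notin> {0, k, k + 1} \<Longrightarrow> c' i = 0"
    and vel_k: "c' k \<bullet> (c k t - c (2 * k) t) = 0" "(c' k - c' 0) \<bullet> (c k t - c 0 t) = 0"
    and vel_Suc_k: "c' (k + 1) \<bullet> (c (k + 1) t - c 1 t) = 0" "(c' (k + 1) - c' 0) \<bullet> (c (k + 1) t - c 0 t) = 0"
  defines "\<theta> \<equiv> arc_angle k (\<lambda>i. c i t)"
  shows "((\<lambda>t. area (\<Inter>i<2 * k + 1. cball (c i t) 1)) has_real_derivative
      c' 0 \<bullet> (- \<i> * ((c (k + 1) t - c 0 t) - (c k t - c 0 t)))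
      + tan (\<theta> k / 2) * (c' 0 \<bullet> (c 0 t - c k t))
      + tan (\<theta> (k + 1) / 2) * (c' 0 \<bullet> (c 0 t - c (k + 1) t))) (at t)"
proof -
  note arcs = star_has_arc[OF k star, unfolded has_arc_def, folded \<theta>_def]
  define N where "N i = circle_flux (other_discs k (\<lambda>i. c i t) i) (c i t)" for i
  have "((\<lambda>t. measure lborel (\<Inter>i<2 * k + 1. cball (c i t) 1)) has_real_derivative
     (\<Sum>i<2 * k + 1. c' i \<bullet> N i)) (at t)"
    unfolding N_def other_discs_def
    by (rule area_disc_intersection_has_real_derivative) (use der star_inj[OF k star] in auto)
  moreover have "measure lborel (\<Inter>i<2 * k + 1. cball (c i t) 1) = area (\<Inter>i<2 * k + 1. cball (c i t) 1)" for t
    by (subst measure_completion) (auto intro!: borel_closed closed_INT)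
  moreover have "(\<Sum>i<2 * k + 1. c' i \<bullet> N i) = (\<Sum>i\<in>{0, k, k + 1}. c' i \<bullet> N i)"
    using fixed k by (intro sum.mono_neutral_right) auto
  moreover have "(\<Sum>i\<in>{0, k, k + 1}. c' i \<bullet> N i) = c' 0 \<bullet> N 0 + c' k \<bullet> N k + c' (k + 1) \<bullet> N (k + 1)"
    using k by simp
  moreover have "c' k \<bullet> N k = tan (\<theta> k / 2) * (c' 0 \<bullet> (c 0 t - c k t))"
  proof -
    have "c' k \<bullet> (c (2 * k) t - c k t) = 0" "(c' k - c' 0) \<bullet> (c 0 t - c k t) = 0"
      using vel_k by (simp_all add: inner_diff_right)
    moreover have "N k = - \<i> * ((c 0 t - c k t) - (c (2 * k) t - c k t))"
      unfolding N_def using arcs(2) by blast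
    ultimately show ?thesis
      using arcs(2) velocity_flux_clockwise by metis
  qed
  moreover have "c' (k + 1) \<bullet> N (k + 1) = tan (\<theta> (k + 1) / 2) * (c' 0 \<bullet> (c 0 t - c (k + 1) t))"
  proof -
    have "c' (k + 1) \<bullet> (c 1 t - c (k + 1) t) = 0" "(c' (k + 1) - c' 0) \<bullet> (c 0 t - c (k + 1) t) = 0"
      using vel_Suc_k by (simp_all add: inner_diff_right)
    moreover have "N (k + 1) = - \<i> * ((c 1 t - c (k + 1) t) - (c 0 t - c (k + 1) t))"
      unfolding N_def using arcs(3) by blast
    ultimately show ?thesis
      using arcs(3) velocity_flux_counterclockwise by metis
  qed
  moreover have "N 0 = - \<i> * ((c (k + 1) t - c 0 t) - (c k t - c 0 t))"
    unfolding N_def using arcs(1) by blast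
  ultimately show ?thesis by (simp only:)
qed

section \<open>The polygon under straight displacements of one vertex\<close>

locale labelled_reuleaux_polygon =
  fixes R :: "complex set" and x :: "nat \<Rightarrow> complex" and n k :: nat
  assumes R: "reuleaux_polygon R" and n: "n = 2 * k + 1" and n_ge: "5 \<le> n"
    and labelling: "ccw_labelling R n x"
begin

lemma k_ge: "2 \<le> k"
  using n n_ge by simp

lemma R_eq: "R = (\<Inter>i<n. cball (x i) 1)"
proof -
  have "vertices R = x ` {..<n}" using labelling by (auto simp: ccw_labelling_def bij_betw_def)
  then show ?thesis using reuleaux_polygon_eq_Inter_vertices(2)[OF R] by simp
qed

lemma dist_eq_one_iff: "i < j \<Longrightarrow> j < n \<Longrightarrow> dist (x i) (x j) = 1 \<longleftrightarrow> j - i = k \<or> j - i = k + 1"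
  using reuleaux_unit_distances[OF R n labelling] .

lemma vertex_mem: "i < n \<Longrightarrow> x i \<in> R"
proof -
  assume "i < n"
  then have "x i \<in> vertices R" using labelling by (auto simp: ccw_labelling_def bij_betw_def)
  then show ?thesis using R by (auto simp: vertices_constant_width_iff reuleaux_polygon_def)
qed

lemma dist_le_one: "i < n \<Longrightarrow> j < n \<Longrightarrow> dist (x i) (x j) \<le> 1"
  using R vertex_mem by (auto simp: reuleaux_polygon_def intro: constant_width_dist_le)

lemma star: "star_configuration k x"
proof -
  have "0 < orientation (x i) (x j) (x l)" if "i < j" "j < l" "l < n" for i j l
    using labelling that by (auto simp: ccw_labelling_def)
  then show ?thesis
    using k_ge n unfolding star_configuration_def
    by (auto simp: dist_eq_one_iff intro!: dist_le_one)
qed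

text \<open>Since \<open>R\<close> lies in the disc around \<open>x i\<close>, a point of the circle
  around \<open>x i\<close> that belongs to \<open>R\<close> is automatically a boundary point of
  \<open>R\<close>.\<close>

lemma opposite_arc_length_eq:
  assumes i: "i < n"
  shows "opposite_arc_length R (x i) = arc_angle k x i"
proof -
  have sub: "R \<subseteq> cball (x i) 1" using i by (auto simp: R_eq)
  have "x i + cis \<phi> \<in> frontier R \<inter> frontier (cball (x i) 1) \<longleftrightarrow> x i + cis \<phi> \<in> other_discs k x i" for \<phi>
  proof -
    have on: "dist (x i) (x i + cis \<phi>) = 1" by (simp add: dist_norm)
    have "R = cball (x i) 1 \<inter> other_discs k x i"
      using i by (auto simp: R_eq other_discs_def n)
    then have mem: "x i + cis \<phi> \<in> R \<longleftrightarrow> x i + cis \<phi> \<in> other_discs k x i" using on by simp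
    have "closed R" unfolding R_eq by (intro closed_INT) auto
    moreover have "x i + cis \<phi> \<notin> interior R" using interior_mono[OF sub] on by auto
    ultimately have "x i + cis \<phi> \<in> frontier R \<longleftrightarrow> x i + cis \<phi> \<in> R" by (auto simp: frontier_def)
    then show ?thesis using mem on by simp
  qed
  then show ?thesis
    unfolding opposite_arc_length_def unit_circle_length_def arc_angle_def by simp
qed

text \<open>Depends only on the new position \<open>y\<close> of \<open>x 0\<close>, so that
  straight and circular motions share it. The signs select the branches passing through
  \<open>x k\<close> and \<open>x (k + 1)\<close>.\<close>

definition displaced :: "complex \<Rightarrow> nat \<Rightarrow> complex" where
  "displaced y i = (if i = 0 then y else if i = k then circles_meet (- 1) (x (2 * k)) y
     else if i = k + 1 then circles_meet 1 (x 1) y else x i)"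

text \<open>Displacements of \<open>x 0\<close> below this bound keep its distances to
  \<open>x (2 * k)\<close> and \<open>x 1\<close> strictly between 0 and 2; the 1 serves the upper
  bound, as both distances start at 1 or less.\<close>

definition radius :: real where
  "radius = min 1 (min (dist (x 0) (x (2 * k))) (dist (x 0) (x 1)))"

lemma sgn_orientation:
  "sgn (orientation (x 0) (x (2 * k)) (x k)) = - 1" "sgn (orientation (x 0) (x 1) (x (k + 1))) = 1"
proof -
  have "0 < orientation (x 0) (x k) (x (2 * k))" "0 < orientation (x 0) (x 1) (x (k + 1))"
    using k_ge by (auto intro!: star_orientation[OF k_ge star])
  moreover have "orientation (x 0) (x (2 * k)) (x k) = - orientation (x 0) (x k) (x (2 * k))"
    by (metis orientation_swap orientation_rotate)
  ultimately show "sgn (orientation (x 0) (x (2 * k)) (x k)) = - 1"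
    "sgn (orientation (x 0) (x 1) (x (k + 1))) = 1" by simp_all
qed

lemma near_x0:
  "0 < dist (x 0) (x (2 * k))" "dist (x 0) (x (2 * k)) \<le> 1" "0 < dist (x 0) (x 1)" "dist (x 0) (x 1) \<le> 1"
  using star_inj[OF k_ge star] k_ge n
  by (auto intro!: dist_le_one dest: inj_onD[where x = 0])

lemma radius_pos: "0 < radius"
  using near_x0 by (simp add: radius_def)

lemma displaced_x0: "displaced (x 0) i = x i"
proof -
  note u = star_unit[OF k_ge star]
  have "circles_meet (- 1) (x (2 * k)) (x 0) = x k"
    using circles_meet_orientation[of "x k" "x 0" "x (2 * k)"] sgn_orientation(1) near_x0 u
    by (simp add: dist_commute)
  moreover have "circles_meet 1 (x 1) (x 0) = x (k + 1)"
    using circles_meet_orientation[of "x (k + 1)" "x 0" "x 1"] sgn_orientation(2) near_x0 u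
    by (simp add: dist_commute)
  ultimately show ?thesis by (simp add: displaced_def)
qed

lemma perturbed_polygon_eq:
  assumes v: "norm v = 1" and t: "\<bar>t\<bar> < radius"
  shows "perturbed_polygon n k x v t = (\<Inter>i<2 * k + 1. cball (displaced (x 0 + t *\<^sub>R v) i) 1)"
proof -
  note u = star_unit[OF k_ge star]
  have "moving_intersection (x 0) v (x (n - 1)) (x k) t = circles_meet (- 1) (x (2 * k)) (x 0 + t *\<^sub>R v)"
    using moving_intersection_eq_circles_meet[OF v, of "x k" "x 0" "x (2 * k)" t] t u near_x0
    by (simp add: radius_def n sgn_orientation dist_commute)
  moreover have "moving_intersection (x 0) v (x 1) (x (k + 1)) t = circles_meet 1 (x 1) (x 0 + t *\<^sub>R v)"
    using moving_intersection_eq_circles_meet[OF v, of "x (k + 1)" "x 0" "x 1" t] t u near_x0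
      sgn_orientation(2)
    by (simp add: radius_def dist_commute)
  ultimately have "perturbed_vertex n k x v t i = displaced (x 0 + t *\<^sub>R v) i" for i
    by (simp add: perturbed_vertex_def displaced_def)
  then show ?thesis by (simp add: perturbed_polygon_def n)
qed

lemma area_derivative:
  assumes v: "norm v = 1"
  shows "((\<lambda>t. area (perturbed_polygon n k x v t)) has_real_derivative
      v \<bullet> (- \<i> * ((x (k + 1) - x 0) - (x k - x 0)))
      + tan (arc_angle k x k / 2) * (v \<bullet> (x 0 - x k))
      + tan (arc_angle k x (k + 1) / 2) * (v \<bullet> (x 0 - x (k + 1)))) (at 0)"
proof -
  have line: "((\<lambda>t. x 0 + t *\<^sub>R v) has_vector_derivative v) (at 0)"
    by (auto intro!: derivative_eq_intros)
  obtain z where z: "((\<lambda>t. circles_meet (- 1) (x (2 * k)) (x 0 + t *\<^sub>R v)) has_vector_derivative z) (at 0)"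
    "z \<bullet> (x k - x (2 * k)) = 0" "(z - v) \<bullet> (x k - x 0) = 0"
    using circles_meet_velocity[OF line, of "x (2 * k)" "- 1"] near_x0 displaced_x0[of k] k_ge
    by (auto simp: displaced_def)
  obtain y where y: "((\<lambda>t. circles_meet 1 (x 1) (x 0 + t *\<^sub>R v)) has_vector_derivative y) (at 0)"
    "y \<bullet> (x (k + 1) - x 1) = 0" "(y - v) \<bullet> (x (k + 1) - x 0) = 0"
    using circles_meet_velocity[OF line, of "x 1" 1] near_x0 displaced_x0[of "k + 1"]
    by (auto simp: displaced_def)
  define c' where "c' i = (if i = 0 then v else if i = k then z else if i = k + 1 then y else 0)" for i
  have c': "c' 0 = v" "c' k = z" "c' (k + 1) = y" using k_ge by (auto simp: c'_def)
  have "((\<lambda>t. area (\<Inter>i<2 * k + 1. cball (displaced (x 0 + t *\<^sub>R v) i) 1)) has_real_derivative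
      v \<bullet> (- \<i> * ((x (k + 1) - x 0) - (x k - x 0)))
      + tan (arc_angle k x k / 2) * (v \<bullet> (x 0 - x k))
      + tan (arc_angle k x (k + 1) / 2) * (v \<bullet> (x 0 - x (k + 1)))) (at 0)"
  proof (rule star_area_derivative[OF k_ge, where c' = c' and t = 0 and
        c = "\<lambda>i t. displaced (x 0 + t *\<^sub>R v) i", simplified displaced_x0 scaleR_zero_left add_0_right c'])
    show "star_configuration k (\<lambda>i. x i)" using star by simp
    show "((\<lambda>t. displaced (x 0 + t *\<^sub>R v) i) has_vector_derivative c' i) (at 0)" for i
      using line z(1) y(1) by (simp add: displaced_def c'_def)
    show "c' i = 0" if "i \<notin> {0, k, k + 1}" for i using that by (simp add: c'_def)
  qed (use y z in auto)
  then show ?thesis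
    by (rule has_field_derivative_transform_within_open[where S = "{- radius<..<radius}"])
       (use v radius_pos in \<open>auto simp: perturbed_polygon_eq\<close>)
qed

end


section \<open>Critical points: equality and range of the three angles\<close>

context labelled_reuleaux_polygon
begin

lemmas arcs = star_has_arc[OF k_ge star, unfolded has_arc_def]

lemma flux_eq_bisector:
  "v \<bullet> (- \<i> * ((x (k + 1) - x 0) - (x k - x 0)))
   = 2 * sin (arc_angle k x 0 / 2) * (v \<bullet> bisector (x k) (x 0) (x (k + 1)))"
proof -
  have "- \<i> * ((x (k + 1) - x 0) - (x k - x 0))
      = of_real (2 * sin (arc_angle k x 0 / 2)) * bisector (x k) (x 0) (x (k + 1))"
    unfolding bisector_def using arcs(1) by (intro chord_flux_eq_bisector(1)) blast+
  then show ?thesis by (simp only: scaleR_conv_of_real[symmetric] inner_scaleR_right)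
qed

text \<open>The derivative is tested on \<open>\<i> * P\<close> and \<open>\<i> * Q\<close>. Each is
  orthogonal to one of the two unit vectors and isolates one difference of tangents; the tangent of
  the half angle determines the angle.\<close>

lemma critical_point_angles:
  assumes crit: "\<And>v. norm v = 1 \<Longrightarrow>
      v \<bullet> (- \<i> * ((x (k + 1) - x 0) - (x k - x 0)))
      + tan (arc_angle k x k / 2) * (v \<bullet> (x 0 - x k))
      + tan (arc_angle k x (k + 1) / 2) * (v \<bullet> (x 0 - x (k + 1))) = 0"
  shows "arc_angle k x 0 = arc_angle k x k" "arc_angle k x k = arc_angle k x (k + 1)"
proof -
  define \<tau> where "\<tau> i = tan (arc_angle k x i / 2)" for i
  define P Q where "P = x k - x 0" and "Q = x (k + 1) - x 0"
  have P: "norm P = 1" and QP: "Q = cis (arc_angle k x 0) * P" and \<theta>: "0 < arc_angle k x 0" "arc_angle k x 0 < pi"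
    using arcs(1) unfolding P_def Q_def by blast+
  have Q: "norm Q = 1" using P by (simp add: QP norm_mult)
  have flux: "- \<i> * (Q - P) = \<tau> 0 *\<^sub>R (P + Q)"
    unfolding \<tau>_def scaleR_conv_of_real using QP by (intro chord_flux_eq_bisector(2) P \<theta>)
  have zero: "(\<tau> 0 - \<tau> k) * (v \<bullet> P) + (\<tau> 0 - \<tau> (k + 1)) * (v \<bullet> Q) = 0" if "norm v = 1" for v
  proof -
    have PQ: "x 0 - x k = - P" "x 0 - x (k + 1) = - Q" by (simp_all add: P_def Q_def)
    have "v \<bullet> (- \<i> * (Q - P)) + \<tau> k * (v \<bullet> (x 0 - x k)) + \<tau> (k + 1) * (v \<bullet> (x 0 - x (k + 1))) = 0"
      unfolding P_def Q_def \<tau>_def by (rule crit[OF that])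
    from this[unfolded flux PQ inner_scaleR_right inner_add_right inner_minus_right]
    show ?thesis by algebra
  qed
  have PQ: "(\<i> * P) \<bullet> P = 0" "(\<i> * Q) \<bullet> Q = 0" by (simp_all add: inner_complex_def)
  have "(\<i> * P) \<bullet> Q = sin (arc_angle k x 0)"
    using inner_mult_unit[OF P, of \<i> "cis (arc_angle k x 0)"] by (simp add: QP inner_complex_def)
  then have ne: "(\<i> * P) \<bullet> Q \<noteq> 0" using sin_gt_zero[OF \<theta>] by simp
  moreover have "(\<i> * Q) \<bullet> P = - ((\<i> * P) \<bullet> Q)" by (simp add: inner_complex_def)
  ultimately have eq: "\<tau> 0 = \<tau> (k + 1)" "\<tau> 0 = \<tau> k"
    using zero[of "\<i> * P"] zero[of "\<i> * Q"] P Q PQ by (auto simp: norm_mult)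
  have inv: "arc_angle k x i = 2 * arctan (\<tau> i)" if "i \<in> {0, k, k + 1}" for i
    using that arcs unfolding \<tau>_def by (subst arctan_tan) auto
  show "arc_angle k x 0 = arc_angle k x k" "arc_angle k x k = arc_angle k x (k + 1)"
    using inv[of 0] inv[of k] inv[of "k + 1"] eq by simp_all
qed

text \<open>With a common angle, \<open>x 1\<close> and \<open>x (2 * k)\<close> arise from
  \<open>x k\<close> and \<open>x 0\<close> by rotations through multiples of
  \<open>\<theta>\<close>, so their distance depends on \<open>\<theta>\<close> alone. The chord
  from \<open>x k\<close> to \<open>x (k + 1)\<close> supplies the lower bound on the
  cosine.\<close>

lemma equal_angles_range:
  assumes eq: "arc_angle k x k = arc_angle k x 0" "arc_angle k x (k + 1) = arc_angle k x 0"
  shows "arc_angle k x 0 \<in> {0..pi / 5} \<union> {pi / 3}"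
proof -
  define \<theta> where "\<theta> = arc_angle k x 0"
  define P Q where "P = x k - x 0" and "Q = x (k + 1) - x 0"
  have P: "norm P = 1" and QP: "Q = cis \<theta> * P" and \<theta>: "0 < \<theta>" "\<theta> < pi"
    using arcs(1) unfolding P_def Q_def \<theta>_def by blast+
  have "(norm (Q - P))\<^sup>2 \<le> 1"
    using dist_le_one[of "k + 1" k] k_ge n by (simp add: P_def Q_def dist_norm power_le_one_iff)
  then have C: "1 / 2 \<le> cos \<theta>" using norm_chord[OF P QP] by simp
  have "x 0 - x k = cis \<theta> * (x (2 * k) - x k)" using arcs(2) eq(1) unfolding \<theta>_def by metis
  then have "cis (- \<theta>) * (x 0 - x k) = x (2 * k) - x k"
    by (simp add: mult.assoc[symmetric] cis_mult)
  then have a: "x (2 * k) - x 0 = P - cis (- \<theta>) * P" by (simp add: P_def algebra_simps)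
  have "x 1 - x (k + 1) = cis \<theta> * (x 0 - x (k + 1))" using arcs(3) eq(2) unfolding \<theta>_def by metis
  then have b: "x 1 - x 0 = Q - cis \<theta> * Q" by (simp add: Q_def algebra_simps)
  define w where "w = cis \<theta> - cis \<theta> * cis \<theta> - 1 + cis (- \<theta>)"
  have "x 1 - x (2 * k) = w * P"
    using a b unfolding w_def QP by (simp add: algebra_simps)
  then have "norm (x 1 - x (2 * k)) = norm w" using P by (simp add: norm_mult)
  moreover have "norm (x 1 - x (2 * k)) \<le> 1"
    using dist_le_one[of 1 "2 * k"] k_ge n by (simp add: dist_norm)
  ultimately have "(norm w)\<^sup>2 \<le> 1" by (simp add: power_le_one_iff)
  moreover have "(norm w)\<^sup>2 = 8 * (cos \<theta>)\<^sup>2 * (1 - cos \<theta>)"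
  proof -
    define s c where "s = sin \<theta>" and "c = cos \<theta>"
    have sc: "s\<^sup>2 + c\<^sup>2 = 1" by (simp add: s_def c_def)
    have "(norm w)\<^sup>2 = (c - (c * c - s * s) - 1 + c)\<^sup>2 + (s - (s * c + c * s) - s)\<^sup>2"
      unfolding cmod_power2 by (simp add: w_def s_def c_def)
    also have "\<dots> = 8 * c\<^sup>2 * (1 - c)" using sc by algebra
    finally show ?thesis by (simp add: c_def)
  qed
  ultimately show ?thesis
    unfolding \<theta>_def[symmetric] by (intro angle_le_pi_fifth_or_eq_pi_third \<theta> C) simp
qed

subsection \<open>Moving a vertex along a unit circle\<close>

text \<open>Clockwise rotation of \<open>x 0\<close> about \<open>x k\<close>, along the arc
  opposite to \<open>x k\<close> towards \<open>x (2 * k)\<close>. In this direction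
  \<open>x 0\<close> recedes from \<open>x 1\<close> when \<open>\<theta>\<close> is a common angle
  of \<open>x 0\<close> and \<open>x (k + 1)\<close> below \<open>pi / 3\<close>.\<close>

definition orbit :: "real \<Rightarrow> complex" where
  "orbit \<alpha> = x k - cis (- \<alpha>) * (x k - x 0)"

text \<open>The point \<open>x k\<close> keeps its unit distances to the orbit and to
  \<open>x (2 * k)\<close> while at rest, so only \<open>0\<close> and \<open>k + 1\<close>
  move.\<close>

definition curve :: "nat \<Rightarrow> real \<Rightarrow> complex" where
  "curve i \<alpha> = (if i = 0 then orbit \<alpha> else if i = k + 1 then circles_meet 1 (x 1) (orbit \<alpha>) else x i)"

lemma curve_simps:
  "curve 0 \<alpha> = orbit \<alpha>" "curve (k + 1) \<alpha> = circles_meet 1 (x 1) (orbit \<alpha>)"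
  "i \<notin> {0, k + 1} \<Longrightarrow> curve i \<alpha> = x i" "curve k \<alpha> = x k" "curve 1 \<alpha> = x 1"
  using k_ge by (auto simp: curve_def)

lemma curve_0: "curve i 0 = x i"
  using displaced_x0[of i] k_ge by (auto simp: curve_def orbit_def displaced_def)

lemma dist_orbit: "dist (orbit \<alpha>) (x k) = 1"
  using arcs(1) by (simp add: orbit_def dist_norm norm_mult)

lemma orbit_derivative: "(orbit has_vector_derivative \<i> * (x k - orbit \<alpha>)) (at \<alpha>)"
proof -
  have "((\<lambda>\<alpha>. cis (- \<alpha>)) has_vector_derivative - \<i> * cis (- \<alpha>)) (at \<alpha>)"
    by (auto simp: has_vector_derivative_complex_iff intro!: derivative_eq_intros
        simp flip: has_real_derivative_iff_has_vector_derivative)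
  then have "((\<lambda>\<alpha>. x k - cis (- \<alpha>) * (x k - x 0)) has_vector_derivative
      0 - (- \<i> * cis (- \<alpha>)) * (x k - x 0)) (at \<alpha>)"
    by (intro has_vector_derivative_diff has_vector_derivative_const has_vector_derivative_mult_left)
  then show ?thesis unfolding orbit_def[abs_def] by (simp add: mult.assoc)
qed

lemma curve_tendsto: "(curve i \<longlongrightarrow> x i) (at 0)"
proof -
  have o: "(orbit \<longlongrightarrow> orbit 0) (at 0)"
    using has_vector_derivative_continuous[OF orbit_derivative[of 0]] by (simp add: isCont_def)
  have o0: "orbit 0 = x 0" by (simp add: orbit_def)
  have m: "((\<lambda>\<alpha>. circles_meet 1 (x 1) (orbit \<alpha>)) \<longlongrightarrow> circles_meet 1 (x 1) (orbit 0)) (at 0)"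
  proof -
    obtain z' where "((\<lambda>\<alpha>. circles_meet 1 (x 1) (orbit \<alpha>)) has_vector_derivative z') (at 0)"
      using circles_meet_differentiable[OF orbit_derivative[of 0], of "x 1" 1] near_x0 o0 by auto
    from has_vector_derivative_continuous[OF this] show ?thesis by (simp add: isCont_def)
  qed
  consider "i = 0" | "i = k + 1" | "i \<notin> {0, k + 1}" by blast
  then show ?thesis
  proof cases
    case 1
    then show ?thesis using o o0 by (simp add: curve_def[abs_def])
  next
    case 2
    then show ?thesis using m curve_0[of "k + 1"] by (simp add: curve_def[abs_def])
  qed (simp add: curve_def[abs_def])
qed

text \<open>Strict inequalities persist by continuity. The unit distances that involve a moving
  vertex are those of the pairs \<open>0\<close>, \<open>k\<close>; \<open>0\<close>,
  \<open>k + 1\<close>; and \<open>1\<close>, \<open>k + 1\<close>, and the construction preserves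
  these exactly.\<close>

lemma eventually_curve_star: "\<forall>\<^sub>F \<alpha> in at 0. star_configuration k (\<lambda>i. curve i \<alpha>)"
proof -
  have orient: "\<forall>\<^sub>F \<alpha> in at 0. \<forall>i\<in>{..<n}. \<forall>j\<in>{..<n}. \<forall>l\<in>{..<n}.
      i < j \<and> j < l \<longrightarrow> 0 < orientation (curve i \<alpha>) (curve j \<alpha>) (curve l \<alpha>)"
  proof (intro eventually_ball_finite ballI finite_lessThan)
    fix i j l assume l: "l \<in> {..<n}"
    show "\<forall>\<^sub>F \<alpha> in at 0. i < j \<and> j < l \<longrightarrow> 0 < orientation (curve i \<alpha>) (curve j \<alpha>) (curve l \<alpha>)"
    proof (cases "i < j \<and> j < l")
      case True
      have "((\<lambda>\<alpha>. orientation (curve i \<alpha>) (curve j \<alpha>) (curve l \<alpha>))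
          \<longlongrightarrow> orientation (x i) (x j) (x l)) (at 0)"
        unfolding orientation_def by (intro tendsto_intros curve_tendsto)
      moreover have "0 < orientation (x i) (x j) (x l)"
        using True l n by (intro star_orientation[OF k_ge star]) auto
      ultimately have "\<forall>\<^sub>F \<alpha> in at 0. 0 < orientation (curve i \<alpha>) (curve j \<alpha>) (curve l \<alpha>)"
        by (rule order_tendstoD(1))
      then show ?thesis by eventually_elim simp
    qed auto
  qed
  have "((\<lambda>\<alpha>. dist (orbit \<alpha>) (x 1)) \<longlongrightarrow> dist (x 0) (x 1)) (at 0)"
    using curve_tendsto[of 0] by (intro tendsto_intros) (simp add: curve_def[abs_def])
  from order_tendstoD(1)[OF this near_x0(3)] order_tendstoD(2)[OF this, of 2] near_x0(4)
  have gap: "\<forall>\<^sub>F \<alpha> in at 0. 0 < dist (orbit \<alpha>) (x 1)" "\<forall>\<^sub>F \<alpha> in at 0. dist (orbit \<alpha>) (x 1) < 2"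
    by simp_all
  have unit: "\<forall>\<^sub>F \<alpha> in at 0. dist (curve (k + 1) \<alpha>) (orbit \<alpha>) = 1 \<and> dist (curve (k + 1) \<alpha>) (x 1) = 1"
    unfolding curve_simps(2) using gap by eventually_elim (simp add: circles_meet_on_circles)
  have dist: "\<forall>\<^sub>F \<alpha> in at 0. \<forall>i\<in>{..<n}. \<forall>j\<in>{..<n}. i < j \<longrightarrow> dist (curve i \<alpha>) (curve j \<alpha>) \<le> 1"
  proof (intro eventually_ball_finite ballI finite_lessThan)
    fix i j assume ij: "i \<in> {..<n}" "j \<in> {..<n}"
    consider "\<not> i < j" | "i < j" "dist (x i) (x j) < 1" | "i < j" "dist (x i) (x j) = 1"
      using dist_le_one[of i j] ij by fastforce
    then show "\<forall>\<^sub>F \<alpha> in at 0. i < j \<longrightarrow> dist (curve i \<alpha>) (curve j \<alpha>) \<le> 1"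
    proof cases
      case 2
      have "((\<lambda>\<alpha>. dist (curve i \<alpha>) (curve j \<alpha>)) \<longlongrightarrow> dist (x i) (x j)) (at 0)"
        by (intro tendsto_intros curve_tendsto)
      from order_tendstoD(2)[OF this 2(2)] show ?thesis by eventually_elim simp
    next
      case 3
      then have "j - i = k \<or> j - i = k + 1" using dist_eq_one_iff ij by simp
      then consider "i = 0" "j = k" | "i = 0" "j = k + 1" | "i = 1" "j = k + 1" | "i \<notin> {0, k + 1}" "j \<notin> {0, k + 1}"
        using 3(1) ij n by force
      then show ?thesis
      proof cases
        case 1
        then show ?thesis by (simp add: curve_simps dist_orbit)
      next
        case c2: 2
        show ?thesis
          using unit by eventually_elim (use c2 in \<open>simp add: curve_simps(1) dist_commute\<close>)
      next
        case c3: 3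
        show ?thesis
          using unit by eventually_elim (use c3 curve_simps(5) in \<open>simp add: dist_commute\<close>)
      next
        case 4
        then show ?thesis using 3(2) by (simp add: curve_simps(3))
      qed
    qed simp
  qed
  have fixed: "dist (x k) (x (2 * k)) = 1" "dist (x (k - 1)) (x (2 * k)) = 1" "dist (x 1) (x (k + 2)) = 1"
    using star_unit[OF k_ge star] by auto
  have c: "curve (2 * k) \<alpha> = x (2 * k)" "curve (k - 1) \<alpha> = x (k - 1)" "curve (k + 2) \<alpha> = x (k + 2)" for \<alpha>
    using k_ge by (auto intro!: curve_simps(3))
  show ?thesis
    using orient dist unit
  proof eventually_elim
    case (elim \<alpha>)
    have "dist (orbit \<alpha>) (curve (k + 1) \<alpha>) = 1" "dist (x 1) (curve (k + 1) \<alpha>) = 1"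
      using elim(3) by (simp_all add: dist_commute)
    moreover have "\<forall>i j. i < j \<and> j < 2 * k + 1 \<longrightarrow> dist (curve i \<alpha>) (curve j \<alpha>) \<le> 1"
      using elim(2) n by auto
    moreover have "\<forall>i j l. i < j \<and> j < l \<and> l < 2 * k + 1 \<longrightarrow> 0 < orientation (curve i \<alpha>) (curve j \<alpha>) (curve l \<alpha>)"
      using elim(1) n by auto
    ultimately show ?case
      unfolding star_configuration_def c curve_simps(1,4,5) using fixed dist_orbit by blast
  qed
qed

lemma curve_velocity:
  assumes "star_configuration k (\<lambda>i. curve i \<alpha>)"
  obtains z where "(curve (k + 1) has_vector_derivative z) (at \<alpha>)"
    "z \<bullet> (curve (k + 1) \<alpha> - x 1) = 0" "(z - \<i> * (x k - orbit \<alpha>)) \<bullet> (curve (k + 1) \<alpha> - orbit \<alpha>) = 0"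
proof -
  have "curve 0 \<alpha> \<noteq> curve 1 \<alpha>" using star_inj[OF k_ge assms] k_ge by (auto dest!: inj_onD[where x = 0])
  then have "0 < dist (orbit \<alpha>) (x 1)" by (simp add: curve_simps(1,5) del: One_nat_def)
  moreover have "dist (orbit \<alpha>) (x 1) \<le> 1"
    using star_dist_le[OF k_ge assms, of 0 1] k_ge by (simp add: curve_simps(1,5) del: One_nat_def)
  ultimately have gap: "0 < dist (orbit \<alpha>) (x 1)" "dist (orbit \<alpha>) (x 1) < 2" by simp_all
  have eq: "curve (k + 1) = (\<lambda>\<alpha>. circles_meet 1 (x 1) (orbit \<alpha>))"
    by (rule ext) (rule curve_simps(2))
  show ?thesis
    by (rule circles_meet_velocity[OF orbit_derivative gap abs_one], rule that; simp only: eq)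
qed

end


section \<open>Decrease of the area along the circular motion\<close>

context labelled_reuleaux_polygon
begin

definition curve_area :: "real \<Rightarrow> real" where
  "curve_area \<alpha> = area (\<Inter>i<2 * k + 1. cball (curve i \<alpha>) 1)"

text \<open>The velocity \<open>\<i> * P\<close> of \<open>x 0\<close> is orthogonal to
  \<open>P\<close>, which kills the term of the resting \<open>x k\<close>. Only inner products with
  \<open>Q\<close> survive, and they equal \<open>sin (\<theta> 0)\<close> up to sign.\<close>

lemma curve_area_derivative:
  assumes star\<alpha>: "star_configuration k (\<lambda>i. curve i \<alpha>)"
  defines "\<theta> \<equiv> arc_angle k (\<lambda>i. curve i \<alpha>)"
  shows "(curve_area has_real_derivative sin (\<theta> 0) * (tan (\<theta> 0 / 2) - tan (\<theta> (k + 1) / 2))) (at \<alpha>)"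
proof -
  define P Q where "P = x k - orbit \<alpha>" and "Q = curve (k + 1) \<alpha> - orbit \<alpha>"
  note arcs = star_has_arc[OF k_ge star\<alpha>, unfolded has_arc_def, folded \<theta>_def, unfolded curve_simps(1,4)]
  have P: "norm P = 1" and QP: "Q = cis (\<theta> 0) * P" and \<theta>: "0 < \<theta> 0" "\<theta> 0 < pi"
    using arcs(1) unfolding P_def Q_def by blast+
  obtain z where z: "(curve (k + 1) has_vector_derivative z) (at \<alpha>)"
    "z \<bullet> (curve (k + 1) \<alpha> - x 1) = 0" "(z - \<i> * P) \<bullet> (curve (k + 1) \<alpha> - orbit \<alpha>) = 0"
    unfolding P_def by (rule curve_velocity[OF star\<alpha>])
  define c' where "c' i = (if i = 0 then \<i> * P else if i = k + 1 then z else 0)" for i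
  have c': "c' 0 = \<i> * P" "c' k = 0" "c' (k + 1) = z" using k_ge by (auto simp: c'_def)
  have PP: "(\<i> * P) \<bullet> P = 0" by (simp add: inner_complex_def)
  have PQ: "(\<i> * P) \<bullet> Q = sin (\<theta> 0)"
    using inner_mult_unit[OF P, of \<i> "cis (\<theta> 0)"] by (simp add: QP inner_complex_def)
  have der: "(curve_area has_real_derivative
      c' 0 \<bullet> (- \<i> * ((curve (k + 1) \<alpha> - curve 0 \<alpha>) - (curve k \<alpha> - curve 0 \<alpha>)))
      + tan (\<theta> k / 2) * (c' 0 \<bullet> (curve 0 \<alpha> - curve k \<alpha>))
      + tan (\<theta> (k + 1) / 2) * (c' 0 \<bullet> (curve 0 \<alpha> - curve (k + 1) \<alpha>))) (at \<alpha>)"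
    unfolding curve_area_def[abs_def] \<theta>_def
  proof (rule star_area_derivative[where c = curve and t = \<alpha> and c' = c', OF k_ge star\<alpha>])
    show "(curve i has_vector_derivative c' i) (at \<alpha>)" for i
    proof -
      consider "i = 0" | "i = k + 1" | "i \<notin> {0, k + 1}" by blast
      then show ?thesis
      proof cases
        case 1
        then show ?thesis
          using orbit_derivative[of \<alpha>] by (simp add: c'_def P_def curve_def[abs_def])
      next
        case 2
        then show ?thesis using z(1) by (simp add: c'_def)
      qed (simp add: c'_def curve_def[abs_def])
    qed
    show "c' i = 0" if "i \<notin> {0, k, k + 1}" for i using that by (simp add: c'_def)
    show "c' k \<bullet> (curve k \<alpha> - curve (2 * k) \<alpha>) = 0" unfolding c' by simp
    show "(c' k - c' 0) \<bullet> (curve k \<alpha> - curve 0 \<alpha>) = 0"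
      unfolding c' curve_simps(1,4) using PP by (simp add: P_def[symmetric])
    show "c' (k + 1) \<bullet> (curve (k + 1) \<alpha> - curve 1 \<alpha>) = 0"
      "(c' (k + 1) - c' 0) \<bullet> (curve (k + 1) \<alpha> - curve 0 \<alpha>) = 0"
      unfolding c' curve_simps(1,5) using z(2,3) by simp_all
  qed
  have flux: "- \<i> * (Q - P) = tan (\<theta> 0 / 2) *\<^sub>R (P + Q)"
    unfolding scaleR_conv_of_real using QP by (intro chord_flux_eq_bisector(2) P \<theta>)
  have neg: "orbit \<alpha> - x k = - P" "orbit \<alpha> - curve (k + 1) \<alpha> = - Q" by (simp_all add: P_def Q_def)
  show ?thesis
    using der[unfolded c' curve_simps(1,4), folded P_def Q_def,
        unfolded flux neg inner_scaleR_right inner_add_right inner_minus_right PP PQ]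
    by (simp add: algebra_simps)
qed

text \<open>The chords of the arcs around the orbit point and around the moving vertex
  \<open>k + 1\<close>. A squared chord is \<open>2 - 2 * cos\<close> of its angle, so the sign of
  the gap compares the two angles through a function that is easy to differentiate.\<close>

definition chord_gap :: "real \<Rightarrow> real" where
  "chord_gap \<alpha> = (norm (curve (k + 1) \<alpha> - x k))\<^sup>2 - (norm (x 1 - orbit \<alpha>))\<^sup>2"

lemma curve_area_derivative_neg:
  assumes star\<alpha>: "star_configuration k (\<lambda>i. curve i \<alpha>)" and gap: "chord_gap \<alpha> < 0"
  shows "\<exists>d. (curve_area has_real_derivative d) (at \<alpha>) \<and> d < 0"
proof -
  define \<theta> where "\<theta> = arc_angle k (\<lambda>i. curve i \<alpha>)"
  note arcs = star_has_arc[OF k_ge star\<alpha>, unfolded has_arc_def, folded \<theta>_def, unfolded curve_simps(1,4,5)]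
  have "(norm ((curve (k + 1) \<alpha> - orbit \<alpha>) - (x k - orbit \<alpha>)))\<^sup>2 = 2 - 2 * cos (\<theta> 0)"
    using arcs(1) by (intro norm_chord) blast+
  moreover have "(norm ((x 1 - curve (k + 1) \<alpha>) - (orbit \<alpha> - curve (k + 1) \<alpha>)))\<^sup>2 = 2 - 2 * cos (\<theta> (k + 1))"
    using arcs(3) by (intro norm_chord) blast+
  ultimately have "cos (\<theta> (k + 1)) < cos (\<theta> 0)" using gap by (simp add: chord_gap_def)
  then have "\<theta> 0 < \<theta> (k + 1)" using arcs(1,3) by (subst (asm) cos_mono_less_eq) auto
  then have "tan (\<theta> 0 / 2) < tan (\<theta> (k + 1) / 2)" using arcs(1,3) by (intro tan_monotone) auto
  then have "sin (\<theta> 0) * (tan (\<theta> 0 / 2) - tan (\<theta> (k + 1) / 2)) < 0"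
    using arcs(1) by (intro mult_pos_neg sin_gt_zero) auto
  with curve_area_derivative[OF star\<alpha>] show ?thesis unfolding \<theta>_def by blast
qed

lemma
  assumes eq: "arc_angle k x (k + 1) = arc_angle k x 0"
  shows chord_gap_0: "chord_gap 0 = 0"
    and chord_gap_derivative:
      "(chord_gap has_real_derivative 4 * sin (arc_angle k x 0) * (1 - 2 * cos (arc_angle k x 0))) (at 0)"
proof -
  define \<theta> where "\<theta> = arc_angle k x 0"
  define s c where "s = sin \<theta>" and "c = cos \<theta>"
  define P Q where "P = x k - x 0" and "Q = x (k + 1) - x 0"
  have P: "norm P = 1" and QP: "Q = cis \<theta> * P" and \<theta>: "0 < \<theta>" "\<theta> < pi"
    using arcs(1) unfolding P_def Q_def \<theta>_def by blast+
  have U: "norm (x 0 - x (k + 1)) = 1" and SU: "x 1 - x (k + 1) = cis \<theta> * (x 0 - x (k + 1))"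
    using arcs(3) eq unfolding \<theta>_def by metis+
  have sc: "s\<^sup>2 + c\<^sup>2 = 1" and s: "s \<noteq> 0" using sin_gt_zero[OF \<theta>] by (simp_all add: s_def c_def)
  have o0: "orbit 0 = x 0" by (simp add: orbit_def)
  show "chord_gap 0 = 0"
    using norm_chord[OF P QP] norm_chord[OF U SU] unfolding chord_gap_def curve_0 o0
    by (simp add: P_def Q_def)
  obtain z where z: "(curve (k + 1) has_vector_derivative z) (at 0)"
    "z \<bullet> (x (k + 1) - x 1) = 0" "(z - \<i> * P) \<bullet> Q = 0"
    using curve_velocity[of 0, unfolded curve_0 o0, folded P_def Q_def, OF star] by blast
  obtain a where a: "z = a * P" using unit_complex_frame[OF P] .
  have "x (k + 1) - x 1 = (cis \<theta> * cis \<theta>) * P"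
  proof -
    have "x (k + 1) - x 1 = - (cis \<theta> * (x 0 - x (k + 1)))" unfolding SU[symmetric] by simp
    also have "x 0 - x (k + 1) = - Q" by (simp add: Q_def)
    finally show ?thesis by (simp add: QP mult.assoc)
  qed
  then have "a \<bullet> (cis \<theta> * cis \<theta>) = 0" using z(2) inner_mult_unit[OF P] a by metis
  moreover have "(a - \<i>) \<bullet> cis \<theta> = 0"
    using z(3) inner_mult_unit[OF P, of "a - \<i>" "cis \<theta>"] by (simp add: a QP left_diff_distrib)
  ultimately have "Re a * (c * c - s * s) + Im a * (2 * s * c) = 0" "Re a * c + (Im a - 1) * s = 0"
    by (simp_all add: inner_complex_def s_def c_def algebra_simps)
  \<comment> \<open>Eliminating \<open>Im a\<close> from the two orthogonality conditions; the
    factor \<open>s\<close> is cancelled in the next step.\<close>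
  then have "s * Re a = s * (2 * s * c)" using sc by algebra
  then have Re_a: "Re a = 2 * s * c" using s by simp
  have x1: "x 1 - x 0 = (cis \<theta> - cis \<theta> * cis \<theta>) * P"
  proof -
    have "x 1 - x 0 = cis \<theta> * (x 0 - x (k + 1)) + Q" unfolding SU[symmetric] Q_def by simp
    also have "x 0 - x (k + 1) = - Q" by (simp add: Q_def)
    finally show ?thesis by (simp add: QP algebra_simps)
  qed
  have "((\<lambda>\<alpha>. curve (k + 1) \<alpha> - x k) has_vector_derivative z - 0) (at 0)"
    by (intro has_vector_derivative_diff z has_vector_derivative_const)
  from has_real_derivative_norm_squared[OF this]
  have d1: "((\<lambda>\<alpha>. (norm (curve (k + 1) \<alpha> - x k))\<^sup>2) has_real_derivative 2 * (z \<bullet> (x (k + 1) - x k))) (at 0)"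
    by (simp only: curve_0 diff_zero)
  have "((\<lambda>\<alpha>. x 1 - orbit \<alpha>) has_vector_derivative 0 - \<i> * P) (at 0)"
    using orbit_derivative[of 0] unfolding o0 P_def
    by (intro has_vector_derivative_diff has_vector_derivative_const)
  from has_real_derivative_norm_squared[OF this]
  have d2: "((\<lambda>\<alpha>. (norm (x 1 - orbit \<alpha>))\<^sup>2) has_real_derivative 2 * ((0 - \<i> * P) \<bullet> (x 1 - x 0))) (at 0)"
    by (simp only: o0)
  have "x (k + 1) - x k = (cis \<theta> - 1) * P" using QP by (simp add: P_def Q_def algebra_simps)
  then have "z \<bullet> (x (k + 1) - x k) = a \<bullet> (cis \<theta> - 1)"
    using inner_mult_unit[OF P] a by metis
  moreover have "a \<bullet> (cis \<theta> - 1) = (a - \<i>) \<bullet> cis \<theta> + s - Re a"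
    by (simp add: inner_complex_def s_def algebra_simps)
  ultimately have e1: "z \<bullet> (x (k + 1) - x k) = s - 2 * s * c"
    using \<open>(a - \<i>) \<bullet> cis \<theta> = 0\<close> Re_a by simp
  have "(\<i> * P) \<bullet> (x 1 - x 0) = s - 2 * s * c"
    unfolding x1 inner_mult_unit[OF P] by (simp add: inner_complex_def s_def c_def)
  then have "2 * (z \<bullet> (x (k + 1) - x k)) - 2 * ((0 - \<i> * P) \<bullet> (x 1 - x 0)) = 4 * s * (1 - 2 * c)"
    unfolding e1 by (simp add: algebra_simps)
  then show "(chord_gap has_real_derivative 4 * sin (arc_angle k x 0) * (1 - 2 * cos (arc_angle k x 0))) (at 0)"
    using DERIV_diff[OF d1 d2] unfolding chord_gap_def[abs_def] s_def c_def \<theta>_def by simp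
qed

text \<open>Links the circular motion to the perturbations of the theorem: the resting
  \<open>x k\<close> is still the intersection point on the side selected by the sign
  \<open>- 1\<close>.\<close>

lemma displaced_orbit:
  assumes star\<alpha>: "star_configuration k (\<lambda>i. curve i \<alpha>)"
  shows "displaced (orbit \<alpha>) i = curve i \<alpha>"
proof -
  have x2k: "curve (2 * k) \<alpha> = x (2 * k)" using k_ge by (intro curve_simps(3)) auto
  have "0 < orientation (orbit \<alpha>) (x k) (x (2 * k))"
    using star_orientation[OF k_ge star\<alpha>, of 0 k "2 * k"] k_ge unfolding curve_simps(1,4) x2k by simp
  moreover have "orientation (orbit \<alpha>) (x (2 * k)) (x k) = - orientation (orbit \<alpha>) (x k) (x (2 * k))"
    by (metis orientation_swap orientation_rotate)
  ultimately have sgn: "sgn (orientation (orbit \<alpha>) (x (2 * k)) (x k)) = - 1" by simp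
  have "curve 0 \<alpha> \<noteq> curve (2 * k) \<alpha>"
    using star_inj[OF k_ge star\<alpha>] k_ge by (auto dest!: inj_onD[where x = 0])
  then have "0 < dist (orbit \<alpha>) (x (2 * k))" unfolding curve_simps(1) x2k by simp
  moreover have "dist (orbit \<alpha>) (x (2 * k)) \<le> 1"
    using star_dist_le[OF k_ge star\<alpha>, of 0 "2 * k"] unfolding curve_simps(1) x2k by simp
  moreover have "dist (x k) (x (2 * k)) = 1" using star_unit[OF k_ge star] by simp
  ultimately have "circles_meet (- 1) (x (2 * k)) (orbit \<alpha>) = x k"
    using circles_meet_orientation[of "x k" "orbit \<alpha>" "x (2 * k)", unfolded sgn] dist_orbit
    by (simp add: dist_commute)
  then show ?thesis by (simp add: displaced_def curve_def)
qed

text \<open>At time 0 the derivative along the curve vanishes, but it is negative at all small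
  positive times because \<open>chord_gap\<close> starts at 0 and decreases. The resulting polygon
  of smaller area is also reached by a straight displacement.\<close>

lemma not_local_area_minimizer:
  assumes eq: "arc_angle k x (k + 1) = arc_angle k x 0" and le: "arc_angle k x 0 \<le> pi / 5"
  shows "\<not> local_area_minimizer n k R x"
proof
  assume "local_area_minimizer n k R x"
  then obtain \<epsilon> where \<epsilon>: "0 < \<epsilon>"
    and min: "\<And>v t. norm v = 1 \<Longrightarrow> 0 \<le> t \<Longrightarrow> t < \<epsilon> \<Longrightarrow> area R \<le> area (perturbed_polygon n k x v t)"
    unfolding local_area_minimizer_def by blast
  have \<theta>: "0 < arc_angle k x 0" "arc_angle k x 0 < pi" using arcs(1) by blast+
  \<comment> \<open>From \<open>pi / 5 < pi / 3\<close>: this is the inequality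
    \<open>1 < 2 * cos \<theta>\<close> that makes the derivative of the gap negative.\<close>
  have "cos (pi / 3) < cos (arc_angle k x 0)" using \<theta> le by (intro cos_monotone_0_pi) auto
  then have "4 * sin (arc_angle k x 0) * (1 - 2 * cos (arc_angle k x 0)) < 0"
    using sin_gt_zero[OF \<theta>] by (intro mult_pos_neg) (simp_all add: cos_60)
  from DERIV_neg_dec_right[OF chord_gap_derivative[OF eq] this]
  obtain \<delta>1 where \<delta>1: "0 < \<delta>1" "\<And>\<alpha>. 0 < \<alpha> \<Longrightarrow> \<alpha> < \<delta>1 \<Longrightarrow> chord_gap \<alpha> < 0"
    using chord_gap_0[OF eq] by auto
  have "(orbit \<longlongrightarrow> x 0) (at 0)" using curve_tendsto[of 0] by (simp add: curve_def[abs_def])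
  then have "\<forall>\<^sub>F \<alpha> in at 0. dist (orbit \<alpha>) (x 0) < min \<epsilon> radius"
    using \<epsilon> radius_pos by (intro tendstoD) auto
  with eventually_curve_star
  have "\<forall>\<^sub>F \<alpha> in at 0. star_configuration k (\<lambda>i. curve i \<alpha>) \<and> dist (orbit \<alpha>) (x 0) < min \<epsilon> radius"
    by (rule eventually_conj)
  then obtain \<delta>2 where \<delta>2: "0 < \<delta>2"
    "\<And>\<alpha>. \<alpha> \<noteq> 0 \<Longrightarrow> \<bar>\<alpha>\<bar> < \<delta>2 \<Longrightarrow> star_configuration k (\<lambda>i. curve i \<alpha>) \<and> dist (orbit \<alpha>) (x 0) < min \<epsilon> radius"
    unfolding eventually_at by (auto simp: dist_real_def)
  define \<alpha> where "\<alpha> = min \<delta>1 \<delta>2 / 2"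
  have \<alpha>: "0 < \<alpha>" "\<alpha> < \<delta>1" "\<alpha> < \<delta>2" using \<delta>1 \<delta>2 by (auto simp: \<alpha>_def)
  have star_at: "star_configuration k (\<lambda>i. curve i \<beta>)" if "0 \<le> \<beta>" "\<beta> \<le> \<alpha>" for \<beta>
    using \<delta>2(2)[of \<beta>] that \<alpha> star by (cases "\<beta> = 0") (auto simp: curve_0)
  have "curve_area \<alpha> < curve_area 0"
  proof (rule DERIV_neg_imp_decreasing_open[OF \<alpha>(1)])
    show "\<exists>d. (curve_area has_real_derivative d) (at \<beta>) \<and> d < 0" if "0 < \<beta>" "\<beta> < \<alpha>" for \<beta>
      using curve_area_derivative_neg[OF star_at[of \<beta>]] \<delta>1(2)[of \<beta>] that \<alpha> by auto
    show "continuous_on {0..\<alpha>} curve_area"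
      using curve_area_derivative[OF star_at]
      by (intro continuous_at_imp_continuous_on ballI DERIV_isCont) auto
  qed
  also have "curve_area 0 = area R" unfolding curve_area_def curve_0 R_eq n ..
  finally have less: "curve_area \<alpha> < area R" .
  define w where "w = orbit \<alpha> - x 0"
  \<comment> \<open>The straight displacement from \<open>x 0\<close> to the end of the curve; the
    value 1 merely keeps \<open>v\<close> a unit vector should \<open>w\<close> be 0.\<close>
  define v where "v = (if w = 0 then 1 else sgn w)"
  have v: "norm v = 1" "norm w *\<^sub>R v = w" by (auto simp: v_def norm_sgn sgn_div_norm)
  have w: "norm w < \<epsilon>" "norm w < radius" using \<delta>2(2)[of \<alpha>] \<alpha> by (auto simp: w_def dist_norm)
  have "perturbed_polygon n k x v (norm w) = (\<Inter>i<2 * k + 1. cball (displaced (x 0 + norm w *\<^sub>R v) i) 1)"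
    using w(2) by (intro perturbed_polygon_eq v) simp
  also have "x 0 + norm w *\<^sub>R v = orbit \<alpha>" unfolding v(2) by (simp add: w_def)
  finally have "area (perturbed_polygon n k x v (norm w)) = curve_area \<alpha>"
    using displaced_orbit[OF star_at[of \<alpha>]] \<alpha>(1) by (simp add: curve_area_def)
  with min[OF v(1) norm_ge_zero w(1)] less show False by simp
qed

end

theorem theorem8:
  fixes R :: "complex set" and x :: "nat \<Rightarrow> complex" and n k :: nat
    and \<theta> :: "nat \<Rightarrow> real" and b :: complex
  assumes "reuleaux_polygon R"
    and "num_sides R = n" and "n = 2 * k + 1" and "n \<ge> 5"
    and "ccw_labelling R n x"
    and "\<theta> = (\<lambda>i. opposite_arc_length R (x i))"
    and "b = bisector (x k) (x 0) (x (k + 1))"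
  shows
    "(\<forall>v. norm v = 1 \<longrightarrow>
        ((\<lambda>t. area (perturbed_polygon n k x v t)) has_real_derivative
           2 * sin (\<theta> 0 / 2) * (v \<bullet> b)
           + tan (\<theta> k / 2) * (v \<bullet> (x 0 - x k))
           + tan (\<theta> (k + 1) / 2) * (v \<bullet> (x 0 - x (k + 1)))) (at 0))
     \<and> ((\<forall>v. norm v = 1 \<longrightarrow>
           ((\<lambda>t. area (perturbed_polygon n k x v t)) has_real_derivative 0) (at 0)) \<longrightarrow>
         \<theta> 0 = \<theta> k \<and> \<theta> k = \<theta> (k + 1) \<and>
         {\<theta> 0, \<theta> k, \<theta> (k + 1)} \<subseteq> {0..pi / 5} \<union> {pi / 3})
     \<and> (\<theta> 0 = \<theta> k \<and> \<theta> k = \<theta> (k + 1) \<and> \<theta> 0 \<le> pi / 5 \<longrightarrow>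
         \<not> local_area_minimizer n k R x)"
proof -
  interpret labelled_reuleaux_polygon R x n k by unfold_locales (use assms in auto)
  have \<theta>: "\<theta> 0 = arc_angle k x 0" "\<theta> k = arc_angle k x k" "\<theta> (k + 1) = arc_angle k x (k + 1)"
    using k_ge n unfolding assms(6) by (auto intro!: opposite_arc_length_eq)
  note deriv = area_derivative
  have "\<theta> 0 = \<theta> k \<and> \<theta> k = \<theta> (k + 1) \<and> {\<theta> 0, \<theta> k, \<theta> (k + 1)} \<subseteq> {0..pi / 5} \<union> {pi / 3}"
    if crit: "\<forall>v. norm v = 1 \<longrightarrow>
      ((\<lambda>t. area (perturbed_polygon n k x v t)) has_real_derivative 0) (at 0)"
  proof -
    have "v \<bullet> (- \<i> * ((x (k + 1) - x 0) - (x k - x 0)))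
      + tan (arc_angle k x k / 2) * (v \<bullet> (x 0 - x k))
      + tan (arc_angle k x (k + 1) / 2) * (v \<bullet> (x 0 - x (k + 1))) = 0" if "norm v = 1" for v
      using DERIV_unique[OF deriv[OF that]] crit that by blast
    from critical_point_angles[OF this]
    have "\<theta> 0 = \<theta> k" "\<theta> k = \<theta> (k + 1)" unfolding \<theta> by blast+
    moreover from this have "\<theta> 0 \<in> {0..pi / 5} \<union> {pi / 3}"
      using equal_angles_range unfolding \<theta> by simp
    ultimately show ?thesis by simp
  qed
  moreover have "\<not> local_area_minimizer n k R x" if "\<theta> 0 = \<theta> k \<and> \<theta> k = \<theta> (k + 1) \<and> \<theta> 0 \<le> pi / 5"
    using that not_local_area_minimizer unfolding \<theta> by simp
  ultimately show ?thesis
    using deriv[unfolded flux_eq_bisector] unfolding \<theta> assms(7) by blast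
qed

end
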